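(* Let $(X,d,m)$ be a metric measure space and $(\mathcal{E},\mathcal{F})$ a regular symmetric Dirichlet form in $L^2(X;m)$ satisfying the standing assumptions (A-1)--(A-3) and (M-1)--(M-3) spelled out in the context. For $x\in X$, $r>0$ let $V^{(c)}(x,r)=m(\overline{B}(x,r)\cap X^{(c)})$ and $V^{(j)}(x,r)=m(\overline{B}(x,r)\cap X^{(j)})$, where $\overline{B}(x,r)=\{z\in X:d(x,z)\le r\}$, and let $$\omega(r)=\sup_{x\in X^{(j)}}\int_{x\ne y}(d(x,y)\wedge r)^2\,j(x,dy).$$ If $$\liminf_{r\to\infty}\frac1{r^2}\Big[V^{(c)}(x_0,r)+V^{(j)}(x_0,r)\,\omega(r)\Big]<\infty$$ for some $x_0\in X$, then $(\mathcal{E},\mathcal{F})$ is recurrent.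
   Context: $(X,d,m)$ is a metric measure space such that every ball $B(x,r)=\{z\in X: d(x,z)<r\}$ ($x\in X$, $r>0$) is pre-compact, and $m$ is a Radon measure with full support. $(\mathcal{E},\mathcal{F})$ is a regular symmetric Dirichlet form in $L^2(X;m)$, $\mathcal{F}_e$ its extended Dirichlet space, $\tilde u$ a quasi-continuous version of $u\in\mathcal{F}_e$, and $C_0(X)$ the space of real-valued continuous functions on $X$ with compact support. By the Beurling--Deny theorem, for $u,v\in\mathcal{F}_e$, $$\mathcal{E}(u,v)=\mathcal{E}^{(c)}(u,v)+\iint_{x\ne y}(\tilde u(x)-\tilde u(y))(\tilde v(x)-\tilde v(y))\,J(dx,dy)+\int_X\tilde u\tilde v\,dk,$$ where $(\mathcal{E}^{(c)},C_0(X)\cap\mathcal{F})$ is a strongly local symmetric form, $J$ is a symmetric positive Radon measure on $X\times X$ off the diagonal, and $k$ is a positive Radon measure on $X$. Let $\mu_{\langle u,v\rangle}$ be the bounded signed (energy) measure with $\mathcal{E}^{(c)}(u,v)=\frac12\mu_{\langle u,v\rangle}(X)$. Standing assumptions (A): (A-1) $k=0$ (no killing). (A-2) For all $u,v\in\mathcal{F}_e$, $\mu_{\langle u,v\rangle}$ is absolutely continuous with respect to $m$; its density is denoted $\Gamma^{(c)}(u,v)$. (A-3) $J$ has a symmetric kernel $j(x,dy)$ over $X\times\mathcal{B}(X)$: $J(dx,dy)=j(x,dy)\,m(dx)=j(y,dx)\,m(dy)=J(dy,dx)$. Set $\Gamma^{(j)}(u,v)(x)=\int_{x\ne y}(\tilde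 u(x)-\tilde u(y))(\tilde v(x)-\tilde v(y))\,j(x,dy)$. Thus $\mathcal{E}(u,v)=\frac12\int_X\Gamma^{(c)}(u,v)\,dm+\int_X\Gamma^{(j)}(u,v)\,dm$. $\mathcal{F}_{\rm loc}$ is the set of measurable $u$ such that for each relatively compact open $G\subset X$ there is $w\in\mathcal{F}$ with $u|_G=w|_G$ $m$-a.e.; $\Gamma^{(c)}$ extends to $\mathcal{F}_{\rm loc}$ by strong locality. For a compact set $K\subset X$ let $\psi_K(\cdot)=\inf_{y\in K}d(\cdot,y)$. $X^{(c)}=\{x\in X:\Gamma^{(c)}\ne0\}$ is the smallest measurable set (up to $m$-null sets) outside which $\Gamma^{(c)}(u,u)=0$ $m$-a.e. for all $u\in\mathcal{F}$; $X^{(j)}=\{x\in X:\Gamma^{(j)}\ne0\}$ is the set of $x$ with $j(x,X\setminus\{x\})>0$. Standing assumptions (M): (M-1) $\psi_K\in\mathcal{F}_{\rm loc}$ for every compact $K\subset X$. (M-2) $M_c:=\operatorname{ess\,sup}_{x\in X^{(c)}}\Gamma^{(c)}(d,d)(x)<\infty$, meaning $\Gamma^{(c)}(\psi_K,\psi_K)\le M_c<\infty$ $m$-a.e. on $X^{(c)}$ for every nonempty compact $K\subset X$. (M-3) $M_j:=\operatorname{ess\,sup}_{x\in X^{(j)}}\int_{x\ne y}(1\wedge d^2(x,y))\,j(x,dy)<\infty$. Let $(T_t)_{t\ge0}$ be the semigroup associated with $(\mathcal{E},\mathcal{F})$ and $G=\int_0^\infty T_t\,dt$. $(\mathcal{E},\mathcal{F})$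 is recurrent if for every $f\in L^1_+(X;m)$ (nonnegative integrable functions), $Gf(x)=0$ or $Gf(x)=\infty$ for $m$-a.e. $x\in X$. *)

theory Defs
  imports "HOL-Analysis.Analysis"
begin

text \<open>
  Elements of function spaces over \<^term>\<open>m\<close> are represented by real-valued functions; all objects
  depending only on the class modulo \<^term>\<open>m\<close>-null sets are specified up to such null sets.
\<close>

section \<open>Radon measures\<close>

text \<open>A Radon measure on the open subset \<open>U\<close>, viewed as a Borel measure on the whole space
  that does not charge the complement of \<open>U\<close>.\<close>

definition radon_on :: "'a::metric_space set \<Rightarrow> 'a measure \<Rightarrow> bool" where
  "radon_on U M \<longleftrightarrow>
     sets M = sets borel \<and>
     emeasure M (- U) = 0 \<and>
     (\<forall>K. compact K \<and> K \<subseteq> U \<longrightarrow> emeasure M K < \<infinity>) \<and>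
     (\<forall>A\<in>sets borel. A \<subseteq> U \<longrightarrow>
        emeasure M A = (INF V\<in>{V. open V \<and> A \<subseteq> V \<and> V \<subseteq> U}. emeasure M V)) \<and>
     (\<forall>V. open V \<and> V \<subseteq> U \<longrightarrow>
        emeasure M V = (SUP K\<in>{K. compact K \<and> K \<subseteq> V}. emeasure M K))"

definition metric_measure_space :: "'a::metric_space measure \<Rightarrow> bool" where
  "metric_measure_space m \<longleftrightarrow>
     (\<forall>(x::'a) r. 0 < r \<longrightarrow> compact (closure (ball x r))) \<and>
     radon_on UNIV m \<and>
     (\<forall>G. open G \<and> G \<noteq> {} \<longrightarrow> 0 < emeasure m G)"

section \<open>Regular symmetric Dirichlet forms\<close>

definition L2 :: "'a measure \<Rightarrow> ('a \<Rightarrow> real) set" where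
  "L2 m = {u \<in> borel_measurable m. integrable m (\<lambda>x. (u x)\<^sup>2)}"

definition inner2 :: "'a measure \<Rightarrow> ('a \<Rightarrow> real) \<Rightarrow> ('a \<Rightarrow> real) \<Rightarrow> real" where
  "inner2 m u v = (\<integral>x. u x * v x \<partial>m)"

definition C0 :: "('a::metric_space \<Rightarrow> real) set" where
  "C0 = {u. continuous_on UNIV u \<and> compact (closure {x. u x \<noteq> 0})}"

definition nonneg_symmetric_form ::
  "'a measure \<Rightarrow> ('a \<Rightarrow> real) set \<Rightarrow> (('a \<Rightarrow> real) \<Rightarrow> ('a \<Rightarrow> real) \<Rightarrow> real) \<Rightarrow> bool" where
  "nonneg_symmetric_form m D B \<longleftrightarrow>
     (\<lambda>x. 0) \<in> D \<and>
     (\<forall>u\<in>D. \<forall>v\<in>D. (\<lambda>x. u x + v x) \<in> D) \<and>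
     (\<forall>u\<in>D. \<forall>c. (\<lambda>x. c * u x) \<in> D) \<and>
     (\<forall>u\<in>D. \<forall>v\<in>borel_measurable m. (AE x in m. u x = v x) \<longrightarrow>
        v \<in> D \<and> (\<forall>w\<in>D. B v w = B u w)) \<and>
     (\<forall>u\<in>D. \<forall>v\<in>D. B u v = B v u) \<and>
     (\<forall>u\<in>D. \<forall>v\<in>D. \<forall>w\<in>D. B (\<lambda>x. u x + v x) w = B u w + B v w) \<and>
     (\<forall>u\<in>D. \<forall>v\<in>D. \<forall>c. B (\<lambda>x. c * u x) v = c * B u v) \<and>
     (\<forall>u\<in>D. 0 \<le> B u u)"

definition form1 ::
  "'a measure \<Rightarrow> (('a \<Rightarrow> real) \<Rightarrow> ('a \<Rightarrow> real) \<Rightarrow> real) \<Rightarrow> ('a \<Rightarrow> real) \<Rightarrow> ('a \<Rightarrow> real) \<Rightarrow> real" where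
  "form1 m E u v = E u v + inner2 m u v"

definition form_cauchy ::
  "(('a \<Rightarrow> real) \<Rightarrow> ('a \<Rightarrow> real) \<Rightarrow> real) \<Rightarrow> (nat \<Rightarrow> 'a \<Rightarrow> real) \<Rightarrow> bool" where
  "form_cauchy B f \<longleftrightarrow>
     (\<forall>e>0. \<exists>N. \<forall>i\<ge>N. \<forall>k\<ge>N. B (\<lambda>x. f i x - f k x) (\<lambda>x. f i x - f k x) < e)"

definition dirichlet_form ::
  "'a measure \<Rightarrow> ('a \<Rightarrow> real) set \<Rightarrow> (('a \<Rightarrow> real) \<Rightarrow> ('a \<Rightarrow> real) \<Rightarrow> real) \<Rightarrow> bool" where
  "dirichlet_form m F E \<longleftrightarrow>
     F \<subseteq> L2 m \<and>
     nonneg_symmetric_form m F E \<and>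
     (\<forall>f\<in>L2 m. \<forall>e>0. \<exists>u\<in>F. inner2 m (\<lambda>x. f x - u x) (\<lambda>x. f x - u x) < e) \<and>
     (\<forall>f. (\<forall>n. f n \<in> F) \<and> form_cauchy (form1 m E) f \<longrightarrow>
        (\<exists>u\<in>F. (\<lambda>n. form1 m E (\<lambda>x. f n x - u x) (\<lambda>x. f n x - u x)) \<longlonglongrightarrow> 0)) \<and>
     (\<forall>u\<in>F. (\<lambda>x. min 1 (max 0 (u x))) \<in> F \<and>
        E (\<lambda>x. min 1 (max 0 (u x))) (\<lambda>x. min 1 (max 0 (u x))) \<le> E u u)"

definition regular_dirichlet_form ::
  "'a::metric_space measure \<Rightarrow> ('a \<Rightarrow> real) set \<Rightarrow> (('a \<Rightarrow> real) \<Rightarrow> ('a \<Rightarrow> real) \<Rightarrow> real) \<Rightarrow> bool" where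
  "regular_dirichlet_form m F E \<longleftrightarrow>
     dirichlet_form m F E \<and>
     (\<forall>u\<in>F. \<forall>e>0. \<exists>v\<in>C0 \<inter> F. form1 m E (\<lambda>x. u x - v x) (\<lambda>x. u x - v x) < e) \<and>
     (\<forall>f\<in>C0. \<forall>e>0. \<exists>v\<in>C0 \<inter> F. \<forall>x. \<bar>f x - v x\<bar> < e)"

section \<open>Extended Dirichlet space and quasi-continuity\<close>

definition approx_seq ::
  "'a measure \<Rightarrow> ('a \<Rightarrow> real) set \<Rightarrow> (('a \<Rightarrow> real) \<Rightarrow> ('a \<Rightarrow> real) \<Rightarrow> real) \<Rightarrow>
    ('a \<Rightarrow> real) \<Rightarrow> (nat \<Rightarrow> 'a \<Rightarrow> real) \<Rightarrow> bool" where
  "approx_seq m F E u f \<longleftrightarrow>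
     (\<forall>n. f n \<in> F) \<and> form_cauchy E f \<and> (AE x in m. (\<lambda>n. f n x) \<longlonglongrightarrow> u x)"

definition extended_space ::
  "'a measure \<Rightarrow> ('a \<Rightarrow> real) set \<Rightarrow> (('a \<Rightarrow> real) \<Rightarrow> ('a \<Rightarrow> real) \<Rightarrow> real) \<Rightarrow> ('a \<Rightarrow> real) set" where
  "extended_space m F E = {u \<in> borel_measurable m. \<exists>f. approx_seq m F E u f}"

text \<open>The (unique) extension of \<open>E\<close> to the extended Dirichlet space.\<close>

definition extended_form ::
  "'a measure \<Rightarrow> ('a \<Rightarrow> real) set \<Rightarrow> (('a \<Rightarrow> real) \<Rightarrow> ('a \<Rightarrow> real) \<Rightarrow> real) \<Rightarrow>
    (('a \<Rightarrow> real) \<Rightarrow> ('a \<Rightarrow> real) \<Rightarrow> real) \<Rightarrow> bool" where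
  "extended_form m F E Ee \<longleftrightarrow>
     (\<forall>u\<in>extended_space m F E. \<forall>v\<in>extended_space m F E. \<forall>f g.
        approx_seq m F E u f \<and> approx_seq m F E v g \<longrightarrow> (\<lambda>n. E (f n) (g n)) \<longlonglongrightarrow> Ee u v)"

text \<open>The 1-capacity of an open set.\<close>

definition capacity ::
  "'a measure \<Rightarrow> ('a \<Rightarrow> real) set \<Rightarrow> (('a \<Rightarrow> real) \<Rightarrow> ('a \<Rightarrow> real) \<Rightarrow> real) \<Rightarrow> 'a set \<Rightarrow> ennreal" where
  "capacity m F E G =
     (INF u\<in>{u \<in> F. AE x in m. x \<in> G \<longrightarrow> 1 \<le> u x}. ennreal (form1 m E u u))"

text \<open>Off a polar set a quasi-continuous function agrees with a real-valued Borel function, so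
  versions are taken in this form, as needed for integration against \<open>J\<close> and \<open>k\<close>.\<close>

definition quasi_continuous_version ::
  "'a::metric_space measure \<Rightarrow> ('a \<Rightarrow> real) set \<Rightarrow> (('a \<Rightarrow> real) \<Rightarrow> ('a \<Rightarrow> real) \<Rightarrow> real) \<Rightarrow>
    ('a \<Rightarrow> real) \<Rightarrow> ('a \<Rightarrow> real) \<Rightarrow> bool" where
  "quasi_continuous_version m F E u w \<longleftrightarrow>
     w \<in> borel_measurable borel \<and>
     (AE x in m. w x = u x) \<and>
     (\<forall>e>0. \<exists>G. open G \<and> capacity m F E G < e \<and> continuous_on (- G) w)"

section \<open>Beurling--Deny decomposition and energy measures\<close>

definition strongly_local ::
  "('a::metric_space \<Rightarrow> real) set \<Rightarrow> (('a \<Rightarrow> real) \<Rightarrow> ('a \<Rightarrow> real) \<Rightarrow> real) \<Rightarrow> bool" where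
  "strongly_local D B \<longleftrightarrow>
     (\<forall>u\<in>D. \<forall>v\<in>D. (\<exists>U c. open U \<and> closure {x. u x \<noteq> 0} \<subseteq> U \<and> (\<forall>x\<in>U. v x = c)) \<longrightarrow> B u v = 0)"

text \<open>\<open>J\<close> does not charge the diagonal, so its integrals are integrals over \<open>x \<noteq> y\<close>.\<close>

definition beurling_deny ::
  "'a::metric_space measure \<Rightarrow> ('a \<Rightarrow> real) set \<Rightarrow> (('a \<Rightarrow> real) \<Rightarrow> ('a \<Rightarrow> real) \<Rightarrow> real) \<Rightarrow>
    (('a \<Rightarrow> real) \<Rightarrow> ('a \<Rightarrow> real) \<Rightarrow> real) \<Rightarrow> (('a \<Rightarrow> real) \<Rightarrow> ('a \<Rightarrow> real) \<Rightarrow> real) \<Rightarrow>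
    ('a \<times> 'a) measure \<Rightarrow> 'a measure \<Rightarrow> bool" where
  "beurling_deny m F E Ee Ec J k \<longleftrightarrow>
     nonneg_symmetric_form m (extended_space m F E) Ec \<and>
     strongly_local (C0 \<inter> F) Ec \<and>
     radon_on {(x, y). x \<noteq> y} J \<and>
     (\<forall>A\<in>sets borel. emeasure J {(x, y). (y, x) \<in> A} = emeasure J A) \<and>
     radon_on UNIV k \<and>
     (\<forall>u\<in>extended_space m F E. \<forall>v\<in>extended_space m F E. \<forall>u' v'.
        quasi_continuous_version m F E u u' \<and> quasi_continuous_version m F E v v' \<longrightarrow>
        integrable J (\<lambda>(x, y). (u' x - u' y) * (v' x - v' y)) \<and>
        integrable k (\<lambda>x. u' x * v' x) \<and>
        Ee u v = Ec u v + (\<integral>(x, y). (u' x - u' y) * (v' x - v' y) \<partial>J) + (\<integral>x. u' x * v' x \<partial>k))"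

text \<open>The signed measure obtained by polarizing the family of measures \<open>mu u\<close>.\<close>

definition polarized ::
  "(('a \<Rightarrow> real) \<Rightarrow> 'a measure) \<Rightarrow> ('a \<Rightarrow> real) \<Rightarrow> ('a \<Rightarrow> real) \<Rightarrow> 'a set \<Rightarrow> real" where
  "polarized mu u v A =
     (measure (mu (\<lambda>x. u x + v x)) A - measure (mu u) A - measure (mu v) A) / 2"

text \<open>
  \<open>mu u\<close> is the energy measure \<open>\<mu>\<^sub>\<langle>\<^sub>u\<^sub>,\<^sub>u\<^sub>\<rangle>\<close> of the strongly local part. Total masses do not determine
  it; as usual it is given by the defining formula for bounded \<open>u\<close> in \<open>F\<close> and extended by continuity
  along approximating sequences.
\<close>

definition energy_measure ::
  "'a::metric_space measure \<Rightarrow> ('a \<Rightarrow> real) set \<Rightarrow> (('a \<Rightarrow> real) \<Rightarrow> ('a \<Rightarrow> real) \<Rightarrow> real) \<Rightarrow>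
    (('a \<Rightarrow> real) \<Rightarrow> ('a \<Rightarrow> real) \<Rightarrow> real) \<Rightarrow> (('a \<Rightarrow> real) \<Rightarrow> 'a measure) \<Rightarrow> bool" where
  "energy_measure m F E Ec mu \<longleftrightarrow>
     (\<forall>u\<in>extended_space m F E. sets (mu u) = sets borel \<and> finite_measure (mu u)) \<and>
     (\<forall>u\<in>F. \<forall>f\<in>C0 \<inter> F. (\<exists>C. AE x in m. \<bar>u x\<bar> \<le> C) \<longrightarrow>
        (\<integral>x. f x \<partial>(mu u)) = 2 * Ec (\<lambda>x. u x * f x) u - Ec (\<lambda>x. (u x)\<^sup>2) f) \<and>
     (\<forall>u\<in>extended_space m F E. \<forall>f. approx_seq m F E u f \<longrightarrow>
        (\<forall>A\<in>sets borel. (\<lambda>n. measure (mu (f n)) A) \<longlonglongrightarrow> measure (mu u) A)) \<and>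
     (\<forall>u\<in>extended_space m F E. \<forall>v\<in>extended_space m F E.
        Ec u v = polarized mu u v UNIV / 2)"

definition abs_cont_with_density ::
  "'a measure \<Rightarrow> ('a set \<Rightarrow> real) \<Rightarrow> ('a \<Rightarrow> real) \<Rightarrow> bool" where
  "abs_cont_with_density m \<nu> g \<longleftrightarrow>
     (\<forall>N\<in>null_sets m. \<nu> N = 0) \<and>
     integrable m g \<and> (\<forall>A\<in>sets m. \<nu> A = (\<integral>x\<in>A. g x \<partial>m))"

text \<open>Only the restriction of \<open>j x\<close> to the complement of \<open>{x}\<close> matters.\<close>

definition jump_kernel ::
  "'a::metric_space measure \<Rightarrow> ('a \<times> 'a) measure \<Rightarrow> ('a \<Rightarrow> 'a measure) \<Rightarrow> bool" where
  "jump_kernel m J j \<longleftrightarrow>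
     (\<forall>x. sets (j x) = sets borel) \<and>
     (\<forall>A\<in>sets borel. (\<lambda>x. emeasure (j x) A) \<in> borel_measurable borel) \<and>
     (\<forall>A\<in>sets borel.
        emeasure J A = (\<integral>\<^sup>+x. emeasure (j x) {y. y \<noteq> x \<and> (x, y) \<in> A} \<partial>m) \<and>
        emeasure J A = (\<integral>\<^sup>+y. emeasure (j y) {x. x \<noteq> y \<and> (x, y) \<in> A} \<partial>m))"

section \<open>Local domain and the sets carrying the diffusion and the jumps\<close>

definition relatively_compact_open :: "'a::metric_space set \<Rightarrow> bool" where
  "relatively_compact_open G \<longleftrightarrow> open G \<and> compact (closure G)"

definition F_loc :: "'a::metric_space measure \<Rightarrow> ('a \<Rightarrow> real) set \<Rightarrow> ('a \<Rightarrow> real) set" where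
  "F_loc m F = {u \<in> borel_measurable m.
     \<forall>G. relatively_compact_open G \<longrightarrow> (\<exists>w\<in>F. AE x in m. x \<in> G \<longrightarrow> u x = w x)}"

text \<open>\<open>Gl\<close> is the extension of \<open>Gc\<close> to the local domain; strong locality makes it well defined
  up to null sets.\<close>

definition local_extension ::
  "'a::metric_space measure \<Rightarrow> ('a \<Rightarrow> real) set \<Rightarrow> (('a \<Rightarrow> real) \<Rightarrow> ('a \<Rightarrow> real) \<Rightarrow> 'a \<Rightarrow> real) \<Rightarrow>
    (('a \<Rightarrow> real) \<Rightarrow> ('a \<Rightarrow> real) \<Rightarrow> 'a \<Rightarrow> real) \<Rightarrow> bool" where
  "local_extension m F Gc Gl \<longleftrightarrow>
     (\<forall>u\<in>F_loc m F. \<forall>v\<in>F_loc m F.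
        Gl u v \<in> borel_measurable m \<and>
        (\<forall>G. \<forall>u'\<in>F. \<forall>v'\<in>F. relatively_compact_open G \<and>
           (AE x in m. x \<in> G \<longrightarrow> u x = u' x) \<and> (AE x in m. x \<in> G \<longrightarrow> v x = v' x) \<longrightarrow>
           (AE x in m. x \<in> G \<longrightarrow> Gl u v x = Gc u' v' x)))"

definition diffusion_set ::
  "'a measure \<Rightarrow> ('a \<Rightarrow> real) set \<Rightarrow> (('a \<Rightarrow> real) \<Rightarrow> ('a \<Rightarrow> real) \<Rightarrow> 'a \<Rightarrow> real) \<Rightarrow> 'a set \<Rightarrow> bool" where
  "diffusion_set m F Gc Xc \<longleftrightarrow>
     Xc \<in> sets m \<and>
     (\<forall>u\<in>F. AE x in m. x \<notin> Xc \<longrightarrow> Gc u u x = 0) \<and>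
     (\<forall>B\<in>sets m. (\<forall>u\<in>F. AE x in m. x \<notin> B \<longrightarrow> Gc u u x = 0) \<longrightarrow> (AE x in m. x \<in> Xc \<longrightarrow> x \<in> B))"

definition jump_set :: "('a \<Rightarrow> 'a measure) \<Rightarrow> 'a set" where
  "jump_set j = {x. 0 < emeasure (j x) (- {x})}"

definition volume :: "'a::metric_space measure \<Rightarrow> 'a set \<Rightarrow> 'a \<Rightarrow> real \<Rightarrow> ennreal" where
  "volume m S x r = emeasure m (cball x r \<inter> S)"

definition omega :: "('a::metric_space \<Rightarrow> 'a measure) \<Rightarrow> real \<Rightarrow> ennreal" where
  "omega j r = (SUP x\<in>jump_set j. \<integral>\<^sup>+y\<in>- {x}. ennreal ((min (dist x y) r)\<^sup>2) \<partial>(j x))"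

section \<open>Semigroup and recurrence\<close>

text \<open>
  \<open>T\<close> is a strongly continuous symmetric contraction semigroup on \<open>L\<^sup>2\<close>, and \<open>(E, F)\<close> is its form:
  the limit of \<open>(u - T\<^sub>t u, v) / t\<close> as \<open>t\<close> decreases to 0.
\<close>

definition associated_semigroup ::
  "'a measure \<Rightarrow> ('a \<Rightarrow> real) set \<Rightarrow> (('a \<Rightarrow> real) \<Rightarrow> ('a \<Rightarrow> real) \<Rightarrow> real) \<Rightarrow>
    (real \<Rightarrow> ('a \<Rightarrow> real) \<Rightarrow> 'a \<Rightarrow> real) \<Rightarrow> bool" where
  "associated_semigroup m F E T \<longleftrightarrow>
     (\<forall>t\<ge>0. \<forall>u\<in>L2 m.
        T t u \<in> L2 m \<and>
        inner2 m (T t u) (T t u) \<le> inner2 m u u \<and>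
        (\<forall>c. AE x in m. T t (\<lambda>z. c * u z) x = c * T t u x) \<and>
        (\<forall>v\<in>L2 m.
           ((AE x in m. u x = v x) \<longrightarrow> (AE x in m. T t u x = T t v x)) \<and>
           (AE x in m. T t (\<lambda>z. u z + v z) x = T t u x + T t v x) \<and>
           inner2 m (T t u) v = inner2 m u (T t v)) \<and>
        (\<forall>s\<ge>0. AE x in m. T (s + t) u x = T s (T t u) x)) \<and>
     (\<forall>u\<in>L2 m. AE x in m. T 0 u x = u x) \<and>
     (\<forall>u\<in>L2 m.
        ((\<lambda>t. inner2 m (\<lambda>x. T t u x - u x) (\<lambda>x. T t u x - u x)) \<longlongrightarrow> 0) (at_right 0)) \<and>
     F = {u \<in> L2 m. \<exists>l. ((\<lambda>t. inner2 m (\<lambda>x. u x - T t u x) u / t) \<longlongrightarrow> l) (at_right 0)} \<and>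
     (\<forall>u\<in>F. \<forall>v\<in>F. ((\<lambda>t. inner2 m (\<lambda>x. u x - T t u x) v / t) \<longlongrightarrow> E u v) (at_right 0))"

text \<open>\<open>g\<close> is the value at \<open>f\<close> of the extension of \<open>T\<^sub>t\<close> from the intersection of \<open>L\<^sup>1\<close> and \<open>L\<^sup>2\<close>
  to \<open>L\<^sup>1\<close> by \<open>L\<^sup>1\<close>-continuity.\<close>

definition L1_semigroup_value ::
  "'a measure \<Rightarrow> (real \<Rightarrow> ('a \<Rightarrow> real) \<Rightarrow> 'a \<Rightarrow> real) \<Rightarrow> real \<Rightarrow> ('a \<Rightarrow> real) \<Rightarrow> ('a \<Rightarrow> real) \<Rightarrow> bool" where
  "L1_semigroup_value m T t f g \<longleftrightarrow>
     integrable m g \<and>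
     (\<exists>h. (\<forall>n. h n \<in> L2 m \<and> integrable m (h n) \<and> integrable m (T t (h n))) \<and>
        (\<lambda>n. \<integral>x. \<bar>h n x - f x\<bar> \<partial>m) \<longlonglongrightarrow> 0 \<and>
        (\<lambda>n. \<integral>x. \<bar>T t (h n) x - g x\<bar> \<partial>m) \<longlonglongrightarrow> 0)"

text \<open>
  \<open>g\<close> is a version of \<open>G f\<close>, the integral of \<open>T\<^sub>t f\<close> over \<open>t \<ge> 0\<close>, with values in \<open>[0, \<infinity>]\<close>. It is
  computed pointwise from a version \<open>p\<close> of \<open>(t, x) \<mapsto> T\<^sub>t f x\<close> that is jointly measurable; by
  Fubini's theorem the result does not depend on \<open>p\<close> up to null sets.
\<close>

definition green_version ::
  "'a measure \<Rightarrow> (real \<Rightarrow> ('a \<Rightarrow> real) \<Rightarrow> 'a \<Rightarrow> real) \<Rightarrow> ('a \<Rightarrow> real) \<Rightarrow> ('a \<Rightarrow> ennreal) \<Rightarrow> bool" where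
  "green_version m T f g \<longleftrightarrow>
     (\<exists>p. (\<lambda>(t, x). p t x) \<in> borel_measurable (lborel \<Otimes>\<^sub>M m) \<and>
        (\<forall>t\<ge>0. L1_semigroup_value m T t f (p t)) \<and>
        (\<forall>x. g x = (\<integral>\<^sup>+t\<in>{0..}. ennreal (p t x) \<partial>lborel)))"

definition recurrent :: "'a measure \<Rightarrow> (real \<Rightarrow> ('a \<Rightarrow> real) \<Rightarrow> 'a \<Rightarrow> real) \<Rightarrow> bool" where
  "recurrent m T \<longleftrightarrow>
     (\<forall>f g. integrable m f \<and> (AE x in m. 0 \<le> f x) \<and> green_version m T f g \<longrightarrow>
        (AE x in m. g x = 0 \<or> g x = \<infinity>))"

end

theory Submission
  imports Defs
begin

text \<open>
  Recurrence follows from functions \<open>g n\<close> in the domain with \<open>0 \<le> g n \<le> 1\<close>, \<open>g n \<rightarrow> 1\<close> pointwise and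
  \<open>E (g n) (g n) \<rightarrow> 0\<close>, and the volume growth condition provides them.

  \<^bold>\<open>The test functions.\<close> Along radii \<open>r\<close> that realize the finite lower limit, let \<open>u\<close> be the cutoff
  that is 1 on the ball of radius \<open>r / 2\<close> about \<open>x0\<close> and falls to 0 with slope \<open>1 / b\<close>, where \<open>b\<close> lies
  between \<open>r / 4\<close> and \<open>r / 2\<close>. Where \<open>u\<close> is neither 1 nor 0 it is an affine function of a distance,
  so locality bounds its strongly local energy by a multiple of \<open>V\<^sup>c(r) / r\<^sup>2\<close>
  (\<open>cutoff_local_energy\<close>). A jump changes \<open>u\<close> by at most \<open>min (d(x, y) / b) 1\<close>, and only if it starts
  or ends in the ball of radius \<open>r\<close>; this gives the bound \<open>V\<^sup>j(r) \<omega>(r) / r\<^sup>2\<close> up to a constant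
  (\<open>cutoff_jump_energy\<close>). Thus the energies of the cutoffs are bounded, but need not tend to 0. By
  convexity, convex combinations of them form a Cauchy sequence in energy (\<open>tail_hull_cauchy\<close>), and since
  the increments of such combinations tend to those of the constant 1, their energies do tend to 0
  (\<open>energy_vanishing_plateaus\<close>).

  \<^bold>\<open>The energy measures.\<close> They are only known through their defining formula on bounded functions, which
  involves the products \<open>u f\<close> and \<open>u\<^sup>2\<close>. That these lie in the domain is the closedness of bounded
  functions of finite energy under multiplication (\<open>product_F\<close>). The formula then makes the measures
  quadratic (\<open>energy_parallelogram\<close>) and zero on a ball where the function is 1 (\<open>energy_plateau\<close>).

  \<^bold>\<open>The semigroup.\<close> The recurrence criterion needs \<open>T\<^sub>t\<close> to preserve the set of functions with values in
  \<open>[0, 1]\<close>, although only the form is known to be Markovian. The squared \<open>L\<^sup>2\<close>-distance of \<open>T\<^sub>t f\<close> from that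
  set is shown to be nonincreasing in \<open>t\<close>, without resolvents or spectral theory (\<open>T_markov\<close>).

  \<^bold>\<open>The criterion.\<close> If \<open>(\<eta>, G\<eta>) < \<infinity>\<close>, then \<open>(\<eta>, w)\<^sup>2 \<le> (\<eta>, G\<eta>) E(w, w)\<close> for all \<open>w\<close> in the domain
  (\<open>pairing_le_green_energy\<close>). With \<open>w = g n\<close> this forces \<open>\<integral> \<eta> = 0\<close> for integrable \<open>\<eta>\<close>. Truncations \<open>\<eta>\<close> of
  \<open>T\<^sub>s f\<close> to the sets where \<open>Gf\<close> is bounded are of this kind, so each \<open>T\<^sub>s f\<close> vanishes where \<open>Gf\<close> is
  finite, and there \<open>Gf = 0\<close> (\<open>recurrent_if_energy_vanishes\<close>).
\<close>

section \<open>Nonnegative symmetric forms\<close>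

context
  fixes m :: "'a measure" and D B
  assumes form: "nonneg_symmetric_form m D B"
begin

lemma form_zero: "(\<lambda>x. 0) \<in> D"
  and form_add: "u \<in> D \<Longrightarrow> v \<in> D \<Longrightarrow> (\<lambda>x. u x + v x) \<in> D"
  and form_scale: "u \<in> D \<Longrightarrow> (\<lambda>x. c * u x) \<in> D"
  and form_AE_mem: "u \<in> D \<Longrightarrow> v \<in> borel_measurable m \<Longrightarrow> AE x in m. u x = v x \<Longrightarrow> v \<in> D"
  and form_AE_eq: "u \<in> D \<Longrightarrow> v \<in> borel_measurable m \<Longrightarrow> AE x in m. u x = v x \<Longrightarrow> w \<in> D \<Longrightarrow> B v w = B u w"
  and form_commute: "u \<in> D \<Longrightarrow> v \<in> D \<Longrightarrow> B u v = B v u"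
  and form_add_left: "u \<in> D \<Longrightarrow> v \<in> D \<Longrightarrow> w \<in> D \<Longrightarrow> B (\<lambda>x. u x + v x) w = B u w + B v w"
  and form_scale_left: "u \<in> D \<Longrightarrow> v \<in> D \<Longrightarrow> B (\<lambda>x. c * u x) v = c * B u v"
  and form_nonneg: "u \<in> D \<Longrightarrow> 0 \<le> B u u"
  using form unfolding nonneg_symmetric_form_def by (elim conjE; metis)+

lemma form_diff: "u \<in> D \<Longrightarrow> v \<in> D \<Longrightarrow> (\<lambda>x. u x - v x) \<in> D"
  using form_add[of u "\<lambda>x. (-1) * v x"] form_scale[of v "-1"] by simp

lemma form_add_right: "u \<in> D \<Longrightarrow> v \<in> D \<Longrightarrow> w \<in> D \<Longrightarrow> B w (\<lambda>x. u x + v x) = B w u + B w v"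
  by (simp add: form_commute[of w] form_add form_add_left)

lemma form_scale_right: "u \<in> D \<Longrightarrow> v \<in> D \<Longrightarrow> B v (\<lambda>x. c * u x) = c * B v u"
  by (simp add: form_commute[of v] form_scale form_scale_left)

lemma form_diff_left: "u \<in> D \<Longrightarrow> v \<in> D \<Longrightarrow> w \<in> D \<Longrightarrow> B (\<lambda>x. u x - v x) w = B u w - B v w"
  using form_add_left[of u "\<lambda>x. (-1) * v x" w] form_scale_left[of v w "-1"] form_scale[of v "-1"]
  by simp

lemma form_diff_right: "u \<in> D \<Longrightarrow> v \<in> D \<Longrightarrow> w \<in> D \<Longrightarrow> B w (\<lambda>x. u x - v x) = B w u - B w v"
  by (simp add: form_commute[of w] form_diff form_diff_left)

lemma form_zero_left: "u \<in> D \<Longrightarrow> B (\<lambda>x. 0) u = 0"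
  using form_scale_left[of u u 0] by simp

lemma form_square_add: "u \<in> D \<Longrightarrow> v \<in> D \<Longrightarrow>
    B (\<lambda>x. u x + v x) (\<lambda>x. u x + v x) = B u u + 2 * B u v + B v v"
  by (simp add: form_add_left form_add_right form_add form_commute[of v u])

lemma form_square_diff: "u \<in> D \<Longrightarrow> v \<in> D \<Longrightarrow>
    B (\<lambda>x. u x - v x) (\<lambda>x. u x - v x) = B u u - 2 * B u v + B v v"
  by (simp add: form_diff_left form_diff_right form_diff form_commute[of v u])

lemma form_square_scale: "u \<in> D \<Longrightarrow> B (\<lambda>x. c * u x) (\<lambda>x. c * u x) = c\<^sup>2 * B u u"
  by (simp add: form_scale_left form_scale_right form_scale power2_eq_square)

lemma form_cauchy_schwarz:
  assumes "u \<in> D" "v \<in> D"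
  shows "(B u v)\<^sup>2 \<le> B u u * B v v"
proof -
  have *: "0 \<le> s\<^sup>2 * B u u - 2 * s * t * B u v + t\<^sup>2 * B v v" for s t
    using form_nonneg[of "\<lambda>x. s * u x - t * v x"] assms
    by (simp add: form_diff form_scale form_square_diff form_square_scale form_scale_left
        form_scale_right mult_ac)
  show ?thesis
  proof (cases "B v v = 0")
    case False
    then have pos: "B v v > 0" using form_nonneg[OF assms(2)] by simp
    have "0 \<le> B v v * (B u u * B v v - (B u v)\<^sup>2)"
      using *[of "B v v" "B u v"] by (simp add: power2_eq_square algebra_simps)
    with pos show ?thesis by (simp add: zero_le_mult_iff)
  next
    case True
    have "B u v = 0"
    proof (rule ccontr)
      assume ne: "B u v \<noteq> 0"
      have "0 \<le> B u u - 2 * ((B u u + 1) / (2 * B u v)) * B u v"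
        using *[of 1 "(B u u + 1) / (2 * B u v)"] True by simp
      then show False using ne by (simp add: field_simps)
    qed
    then show ?thesis using True by simp
  qed
qed

lemma form_square_add_le:
  "u \<in> D \<Longrightarrow> v \<in> D \<Longrightarrow> B (\<lambda>x. u x + v x) (\<lambda>x. u x + v x) \<le> 2 * B u u + 2 * B v v"
  using form_nonneg[of "\<lambda>x. u x - v x"] by (simp add: form_diff form_square_add form_square_diff)

lemma form_square_diff_le:
  "u \<in> D \<Longrightarrow> v \<in> D \<Longrightarrow> B (\<lambda>x. u x - v x) (\<lambda>x. u x - v x) \<le> 2 * B u u + 2 * B v v"
  using form_nonneg[of "\<lambda>x. u x + v x"] by (simp add: form_add form_square_add form_square_diff)

lemma form_combination: "u \<in> D \<Longrightarrow> v \<in> D \<Longrightarrow> (\<lambda>x. s * u x + t * v x) \<in> D"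
  by (simp add: form_add form_scale)

lemma form_square_combination: "u \<in> D \<Longrightarrow> v \<in> D \<Longrightarrow>
    B (\<lambda>x. s * u x + t * v x) (\<lambda>x. s * u x + t * v x)
      = s\<^sup>2 * B u u + 2 * s * t * B u v + t\<^sup>2 * B v v"
  by (simp add: form_scale form_square_add form_square_scale form_scale_left form_scale_right)

lemma form_convex:
  assumes "u \<in> D" "v \<in> D" "0 \<le> t" "t \<le> 1" "B u u \<le> C" "B v v \<le> C"
  shows "B (\<lambda>x. t * u x + (1 - t) * v x) (\<lambda>x. t * u x + (1 - t) * v x) \<le> C"
proof -
  have "B (\<lambda>x. t * u x + (1 - t) * v x) (\<lambda>x. t * u x + (1 - t) * v x)
      = t\<^sup>2 * B u u + 2 * t * (1 - t) * B u v + (1 - t)\<^sup>2 * B v v"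
    using assms(1,2) by (rule form_square_combination)
  also have "\<dots> = t * B u u + (1 - t) * B v v - t * (1 - t) * B (\<lambda>x. u x - v x) (\<lambda>x. u x - v x)"
    using assms by (simp add: form_square_diff power2_eq_square algebra_simps)
  also have "\<dots> \<le> t * B u u + (1 - t) * B v v"
    using assms form_nonneg[of "\<lambda>x. u x - v x"] by (simp add: form_diff)
  also have "\<dots> \<le> t * C + (1 - t) * C"
    using assms by (intro add_mono mult_left_mono) auto
  also have "\<dots> = C" by (simp add: algebra_simps)
  finally show ?thesis .
qed

end

text \<open>An inductive set rather than a set of finite sums, so that a property that holds on a tail and is
  stable under convex combinations passes to the hull by induction.\<close>

inductive_set tail_hull :: "(nat \<Rightarrow> 'a \<Rightarrow> real) \<Rightarrow> nat \<Rightarrow> ('a \<Rightarrow> real) set"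
  for f :: "nat \<Rightarrow> 'a \<Rightarrow> real" and n :: nat where
  base: "n \<le> k \<Longrightarrow> f k \<in> tail_hull f n"
| combine: "u \<in> tail_hull f n \<Longrightarrow> v \<in> tail_hull f n \<Longrightarrow> 0 \<le> t \<Longrightarrow> t \<le> 1 \<Longrightarrow>
    (\<lambda>x. t * u x + (1 - t) * v x) \<in> tail_hull f n"

lemma tail_hull_antimono: "n \<le> k \<Longrightarrow> u \<in> tail_hull f k \<Longrightarrow> u \<in> tail_hull f n"
  by (rotate_tac 1, induction rule: tail_hull.induct) (auto intro: tail_hull.intros)

text \<open>A sequence bounded in the seminorm of \<open>B\<close> has convex combinations of its tails that form a
  Cauchy sequence: take near-minimizers of \<open>B\<close> over the hulls. Their midpoints lie in the
  hulls as well, so by the parallelogram identity two near-minimizers are close to each other.\<close>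

lemma tail_hull_cauchy:
  assumes form: "nonneg_symmetric_form m D B"
    and mem: "\<And>n. f n \<in> D" and bound: "\<And>n. B (f n) (f n) \<le> C"
  obtains g where "\<And>n. g n \<in> tail_hull f n" "form_cauchy B g"
proof -
  have hull: "u \<in> D \<and> B u u \<le> C" if "u \<in> tail_hull f n" for u n
    using that
    by (induction rule: tail_hull.induct)
       (auto simp: mem bound form_combination[OF form] form_convex[OF form])
  define d where "d n = (INF u\<in>tail_hull f n. B u u)" for n
  have bdd: "bdd_below ((\<lambda>u. B u u) ` tail_hull f n)" for n
    using hull form_nonneg[OF form] by (auto intro!: bdd_belowI[of _ 0])
  have ne: "tail_hull f n \<noteq> {}" for n
    using tail_hull.base[of n n f] by auto
  have d_le: "d n \<le> B u u" if "u \<in> tail_hull f n" for u n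
    unfolding d_def using bdd that by (rule cINF_lower)
  have "d n \<le> C" for n
    using d_le[OF tail_hull.base[of n n f]] bound[of n] by simp
  moreover have inc: "d n \<le> d k" if "n \<le> k" for n k
    unfolding d_def[of k]
    by (rule cINF_greatest[OF ne]) (rule d_le[OF tail_hull_antimono[OF that]])
  ultimately have "convergent d"
    by (intro Bseq_mono_convergent BseqI'[of _ "\<bar>C\<bar> + \<bar>d 0\<bar>"])
      (smt (verit) real_norm_def zero_le)+
  then obtain L where L: "d \<longlonglongrightarrow> L" by (auto simp: convergent_def)
  have d_L: "d n \<le> L" for n
    using L inc by (intro LIMSEQ_le_const[of d]) auto
  have "\<exists>u\<in>tail_hull f n. B u u < d n + 1 / Suc n" for n
    using cINF_less_iff[OF ne[of n] bdd[of n], of "d n + 1 / Suc n"] by (auto simp: d_def)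
  then obtain g where g: "\<And>n. g n \<in> tail_hull f n" "\<And>n. B (g n) (g n) < d n + 1 / Suc n"
    by metis
  have "form_cauchy B g"
    unfolding form_cauchy_def
  proof (intro allI impI)
    fix e :: real assume "e > 0"
    have "\<forall>\<^sub>F n in sequentially. L - e / 8 < d n"
      using \<open>e > 0\<close> by (intro order_tendstoD(1)[OF L]) simp
    then obtain N1 where N1: "L - d n < e / 8" if "n \<ge> N1" for n
      by (force simp: eventually_sequentially)
    obtain N2 where N2: "1 / Suc N2 < e / 8" 
      using \<open>e > 0\<close> nat_approx_posE[of "e/8"] by auto
    define N where "N = max N1 N2"
    have N: "L - d n < e / 8" "1 / Suc n < e / 8" if "n \<ge> N" for n
    proof -
      show "L - d n < e / 8" using N1 that by (simp add: N_def)
      have "1 / Suc n \<le> 1 / Suc N2" using that by (simp add: N_def frac_le)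
      then show "1 / Suc n < e / 8" using N2 by simp
    qed
    have "B (\<lambda>x. g i x - g k x) (\<lambda>x. g i x - g k x) < e" if "i \<ge> N" "k \<ge> N" for i k
    proof -
      have gi: "g i \<in> tail_hull f N" "g k \<in> tail_hull f N"
        using g that tail_hull_antimono by blast+
      then have D: "g i \<in> D" "g k \<in> D" using hull by blast+
      have "d N \<le> B (\<lambda>x. (1/2) * g i x + (1 - 1/2) * g k x) (\<lambda>x. (1/2) * g i x + (1 - 1/2) * g k x)"
        using gi by (intro d_le tail_hull.combine) auto
      also have "\<dots> = (B (g i) (g i) + 2 * B (g i) (g k) + B (g k) (g k)) / 4"
        by (subst form_square_combination[OF form D]) (simp add: power2_eq_square field_simps)
      finally have "4 * d N \<le> B (g i) (g i) + 2 * B (g i) (g k) + B (g k) (g k)" by simp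
      then show ?thesis
        using D g(2)[of i] g(2)[of k] d_L[of i] d_L[of k] N[of N] N[of i] N[of k] that
        by (simp add: form_square_diff[OF form] )
    qed
    then show "\<exists>N. \<forall>i\<ge>N. \<forall>k\<ge>N. B (\<lambda>x. g i x - g k x) (\<lambda>x. g i x - g k x) < e"
      by blast
  qed
  with g(1) show ?thesis by (rule that)
qed

section \<open>Square integrable functions\<close>

lemma L2_mult_integrable:
  assumes "u \<in> L2 m" "v \<in> L2 m"
  shows "integrable m (\<lambda>x. u x * v x)"
proof (rule Bochner_Integration.integrable_bound)
  show "integrable m (\<lambda>x. (u x)\<^sup>2 + (v x)\<^sup>2)" using assms by (auto simp: L2_def)
  show "(\<lambda>x. u x * v x) \<in> borel_measurable m" using assms by (auto simp: L2_def)
  have "\<bar>u x * v x\<bar> \<le> (u x)\<^sup>2 + (v x)\<^sup>2" for x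
    using sum_squares_bound[of "\<bar>u x\<bar>" "\<bar>v x\<bar>"] mult_nonneg_nonneg[of "\<bar>u x\<bar>" "\<bar>v x\<bar>"]
    unfolding abs_mult power2_abs by linarith
  then show "AE x in m. norm (u x * v x) \<le> norm ((u x)\<^sup>2 + (v x)\<^sup>2)" by auto
qed

lemma L2_bound:
  assumes "u \<in> L2 m" "v \<in> borel_measurable m" "AE x in m. \<bar>v x\<bar> \<le> c * \<bar>u x\<bar>"
  shows "v \<in> L2 m"
proof -
  have "integrable m (\<lambda>x. (v x)\<^sup>2)"
  proof (rule Bochner_Integration.integrable_bound)
    show "integrable m (\<lambda>x. c\<^sup>2 * (u x)\<^sup>2)" using assms by (auto simp: L2_def)
    show "(\<lambda>x. (v x)\<^sup>2) \<in> borel_measurable m" using assms by auto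
    show "AE x in m. norm ((v x)\<^sup>2) \<le> norm (c\<^sup>2 * (u x)\<^sup>2)"
      using assms(3)
    proof eventually_elim
      case (elim x)
      then have "\<bar>v x\<bar>\<^sup>2 \<le> (c * \<bar>u x\<bar>)\<^sup>2" by (intro power_mono) auto
      then show ?case by (simp add: power_mult_distrib abs_mult)
    qed
  qed
  with assms(2) show ?thesis by (simp add: L2_def)
qed

lemma inner2_form: "nonneg_symmetric_form m (L2 m) (inner2 m)"
proof -
  have add: "(\<lambda>x. u x + v x) \<in> L2 m" if "u \<in> L2 m" "v \<in> L2 m" for u v
    using that L2_mult_integrable[OF that]
    by (auto simp: L2_def power2_sum mult.assoc)
  have AE: "v \<in> L2 m \<and> (\<forall>w\<in>L2 m. inner2 m v w = inner2 m u w)"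
    if "u \<in> L2 m" "v \<in> borel_measurable m" "AE x in m. u x = v x" for u v
  proof (intro conjI ballI)
    show "v \<in> L2 m" by (rule L2_bound[OF that(1,2), of 1]) (use that(3) in auto)
    show "inner2 m v w = inner2 m u w" if "w \<in> L2 m" for w
      unfolding inner2_def using \<open>u \<in> L2 m\<close> \<open>v \<in> L2 m\<close> that \<open>AE x in m. u x = v x\<close>
      by (intro integral_cong_AE) (auto simp: L2_def)
  qed
  show ?thesis
    unfolding nonneg_symmetric_form_def
  proof (intro conjI ballI allI impI)
    show "(\<lambda>x. 0) \<in> L2 m" by (simp add: L2_def)
    show "(\<lambda>x. c * u x) \<in> L2 m" if "u \<in> L2 m" for u c
      using that by (auto simp: L2_def power_mult_distrib)
    show "inner2 m (\<lambda>x. u x + v x) w = inner2 m u w + inner2 m v w"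
      if "u \<in> L2 m" "v \<in> L2 m" "w \<in> L2 m" for u v w
      using that by (simp add: inner2_def distrib_right L2_mult_integrable)
    show "inner2 m (\<lambda>x. c * u x) v = c * inner2 m u v" for u v c
      by (simp add: inner2_def mult.assoc)
    show "inner2 m u v = inner2 m v u" for u v
      by (simp add: inner2_def mult.commute)
    show "0 \<le> inner2 m u u" for u
      by (simp add: inner2_def)
  qed (use add AE in auto)
qed

lemmas L2_zero = form_zero[OF inner2_form]
  and L2_add = form_add[OF inner2_form]
  and L2_scale = form_scale[OF inner2_form]
  and L2_diff = form_diff[OF inner2_form]
  and inner2_commute = form_commute[OF inner2_form]
  and inner2_add_left = form_add_left[OF inner2_form]
  and inner2_add_right = form_add_right[OF inner2_form]
  and inner2_scale_left = form_scale_left[OF inner2_form]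
  and inner2_diff_left = form_diff_left[OF inner2_form]
  and inner2_cauchy_schwarz = form_cauchy_schwarz[OF inner2_form]

lemma inner2_self_nonneg: "0 \<le> inner2 m u u"
  by (simp add: inner2_def)

lemma L2_measurable: "u \<in> L2 m \<Longrightarrow> u \<in> borel_measurable m"
  by (simp add: L2_def)

lemma inner2_mono:
  assumes "u \<in> L2 m" "v \<in> L2 m" "AE x in m. \<bar>u x\<bar> \<le> \<bar>v x\<bar>"
  shows "inner2 m u u \<le> inner2 m v v"
  unfolding inner2_def
proof (rule integral_mono_AE)
  show "AE x in m. u x * u x \<le> v x * v x"
    using assms(3) by eventually_elim (metis abs_le_square_iff power2_eq_square)
qed (use assms in \<open>auto intro: L2_mult_integrable\<close>)

lemma inner2_eq_0_AE:
  assumes "u \<in> L2 m" "inner2 m u u = 0"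
  shows "AE x in m. u x = 0"
  using assms(2) integral_nonneg_eq_0_iff_AE[OF L2_mult_integrable[OF assms(1) assms(1)]]
  by (simp add: inner2_def)

section \<open>Monotonicity and convexity on the real line\<close>

text \<open>Compare \<open>\<phi>\<close> with a line of small slope \<open>e\<close> starting at a point \<open>s > a\<close>: from the last point at which
  \<open>\<phi>\<close> is not above the line, the growth condition leads to a later such point. Then \<open>e\<close> tends to 0 and \<open>s\<close>
  to \<open>a\<close>.\<close>

lemma antimono_if_right_growth:
  fixes \<phi> :: "real \<Rightarrow> real"
  assumes ab: "a < b" and cont: "continuous_on {a..b} \<phi>"
    and growth: "\<And>t e. a < t \<Longrightarrow> t < b \<Longrightarrow> e > 0 \<Longrightarrow> \<forall>\<^sub>F h in at_right 0. \<phi> (t + h) \<le> \<phi> t + e * h"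
  shows "\<phi> b \<le> \<phi> a"
proof -
  have step: "\<phi> b \<le> \<phi> s + e * (b - s)" if s: "a < s" "s < b" and e: "e > 0" for s e
  proof (rule ccontr)
    assume contra: "\<not> ?thesis"
    define \<psi> where "\<psi> t = \<phi> t - e * t" for t
    define S where "S = {s..b} \<inter> \<psi> -` {..\<psi> s}"
    have "continuous_on {s..b} \<psi>"
      unfolding \<psi>_def using s by (intro continuous_intros continuous_on_subset[OF cont]) auto
    then have "closed S"
      unfolding S_def by (rule continuous_closed_preimage) auto
    then have "compact ({s..b} \<inter> S)" by (intro compact_Int_closed) auto
    then have "compact S" by (simp add: S_def Int_absorb1)
    moreover have "s \<in> S" using s by (simp add: S_def)
    ultimately obtain c where c: "c \<in> S" "\<And>x. x \<in> S \<Longrightarrow> x \<le> c"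
      using compact_attains_sup[of S] by blast
    have "\<psi> b > \<psi> s" using contra by (simp add: \<psi>_def algebra_simps)
    with c have "c < b" by (auto simp: S_def order.strict_iff_order)
    have "a < c" using c(1) s by (auto simp: S_def)
    have "\<forall>\<^sub>F h in at_right 0. h < b - c"
      using \<open>c < b\<close> by (intro eventually_at_right_less order_tendstoD(2)[of "\<lambda>x. x" 0]) auto
    moreover have "\<forall>\<^sub>F h in at_right (0::real). h > 0"
      by (rule eventually_at_right_less)
    moreover note growth[OF \<open>a < c\<close> \<open>c < b\<close> e]
    ultimately have "\<forall>\<^sub>F h in at_right 0. h > 0 \<and> h < b - c \<and> \<phi> (c + h) \<le> \<phi> c + e * h"
      by eventually_elim auto
    then obtain h where h: "h > 0" "h < b - c" "\<phi> (c + h) \<le> \<phi> c + e * h"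
      using eventually_happens'[OF trivial_limit_at_right_real] by blast
    then have "c + h \<in> S"
      using c(1) by (auto simp: S_def \<psi>_def algebra_simps)
    with c(2) h(1) show False by force
  qed
  have le: "\<phi> b \<le> \<phi> s" if s: "a < s" "s < b" for s
  proof (rule field_le_epsilon)
    fix e :: real assume "e > 0"
    then show "\<phi> b \<le> \<phi> s + e" using step[OF s, of "e / (b - s)"] s by simp
  qed
  have "(\<phi> \<longlongrightarrow> \<phi> a) (at a within {a..b})"
    using cont ab by (simp add: continuous_on_def)
  then have lim: "(\<phi> \<longlongrightarrow> \<phi> a) (at_right a)"
    using ab by (simp add: at_within_Icc_at_right)
  show ?thesis
  proof (rule tendsto_lowerbound[OF lim])
    show "\<forall>\<^sub>F s in at_right a. \<phi> b \<le> \<phi> s"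
      using eventually_at_right[OF ab] le ab by blast
  qed simp
qed

text \<open>If a chord were exceeded, consider the first point where the excess is maximal: its neighbours
  at equal distances cannot both have maximal excess.\<close>

lemma midpoint_convex_imp_convex:
  fixes b :: "real \<Rightarrow> real"
  assumes cont: "continuous_on {0..} b"
    and mid: "\<And>r h. 0 \<le> r \<Longrightarrow> 0 \<le> h \<Longrightarrow> 2 * b (r + h) \<le> b r + b (r + 2 * h)"
  shows "convex_on {0..} b"
proof (rule convex_onI)
  fix t x y :: real
  assume t: "0 < t" "t < 1" and xy: "x \<in> {0..}" "y \<in> {0..}"
  have main: "b ((1 - t) * x + t * y) \<le> (1 - t) * b x + t * b y"
    if t: "0 < t" "t < 1" and xy: "0 \<le> x" "x < y" for t x y
  proof (rule ccontr)
    assume contra: "\<not> ?thesis"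
    define k where "k = (b y - b x) / (y - x)"
    define g where "g z = b z - b x - k * (z - x)" for z
    have gx: "g x = 0" by (simp add: g_def)
    have gy: "g y = 0" using xy by (simp add: g_def k_def)
    define z where "z = (1 - t) * x + t * y"
    have z_diff: "z - x = t * (y - x)" by (simp add: z_def algebra_simps)
    have "g z = b z - b x - t * (b y - b x)"
      using xy by (simp add: g_def z_diff k_def)
    then have gz: "g z > 0" using contra by (simp add: z_def algebra_simps)
    have "0 \<le> t * (y - x)" "t * (y - x) \<le> 1 * (y - x)" using t xy by (auto intro: mult_right_mono)
    then have z: "z \<in> {x..y}" using z_diff by auto
    have gcont: "continuous_on {x..y} g"
      unfolding g_def using xy by (intro continuous_intros continuous_on_subset[OF cont]) auto
    obtain p where p: "p \<in> {x..y}" "\<And>w. w \<in> {x..y} \<Longrightarrow> g w \<le> g p"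
      using continuous_attains_sup[OF _ _ gcont] z by auto
    have "closed ({x..y} \<inter> g -` {g p})"
      by (rule continuous_closed_preimage[OF gcont]) auto
    then have "compact ({x..y} \<inter> ({x..y} \<inter> g -` {g p}))" by (intro compact_Int_closed) auto
    then have "compact ({x..y} \<inter> g -` {g p})" by (simp flip: Int_assoc)
 moreover have "{x..y} \<inter> g -` {g p} \<noteq> {}" using p(1) by blast
    ultimately obtain c where "c \<in> {x..y} \<inter> g -` {g p}" "\<forall>w\<in>{x..y} \<inter> g -` {g p}. c \<le> w"
      using compact_attains_inf[of "{x..y} \<inter> g -` {g p}"] by metis
    then have c: "c \<in> {x..y}" "g c = g p" "\<And>w. w \<in> {x..y} \<Longrightarrow> g w = g p \<Longrightarrow> c \<le> w"
      by auto
    have "g c > 0" using gz p(2)[OF z] c by simp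
    then have "c \<noteq> x" "c \<noteq> y" using gx gy by auto
    then have "x < c" "c < y" using c(1) by auto
    define d where "d = min (c - x) (y - c)"
    have d: "d > 0" "c - d \<in> {x..y}" "c + d \<in> {x..y}"
      using \<open>x < c\<close> \<open>c < y\<close> by (auto simp: d_def)
    have "2 * b ((c - d) + d) \<le> b (c - d) + b ((c - d) + 2 * d)"
      using d xy by (intro mid) auto
    then have "2 * g c \<le> g (c - d) + g (c + d)"
      by (simp add: g_def algebra_simps)
    moreover have "g (c - d) < g c" using c(2) c(3)[OF d(2)] p(2)[OF d(2)] d(1) by force
    moreover have "g (c + d) \<le> g c" using c(2) p(2)[OF d(3)] by simp
    ultimately show False by simp
  qed
  consider "x < y" | "x = y" | "y < x" by linarith
  then show "b ((1 - t) *\<^sub>R x + t *\<^sub>R y) \<le> (1 - t) * b x + t * b y"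
  proof cases
    case 1
    then show ?thesis using main[of t x y] t xy by simp
  next
    case 2
    then show ?thesis by (simp add: algebra_simps)
  next
    case 3
    then show ?thesis using main[of "1 - t" y x] t xy by (simp add: algebra_simps)
  qed
qed simp

text \<open>The slopes to the right of \<open>r\<close> are monotone in the step, and bounded because \<open>r\<close> is an interior point.\<close>

lemma convex_right_slope_limit:
  fixes b :: "real \<Rightarrow> real"
  assumes conv: "convex_on {0..} b" and r: "r > 0"
  shows "\<exists>l. ((\<lambda>s. (b r - b (r + s)) / s) \<longlongrightarrow> l) (at_right 0)"
proof -
  define g where "g s = (b r - b (r + s)) / s" for s
  have anti: "g s' \<le> g s" if s: "0 < s" "s \<le> s'" for s s'
  proof -
    have "b ((1 - s / s') *\<^sub>R r + (s / s') *\<^sub>R (r + s')) \<le> (1 - s / s') * b r + (s / s') * b (r + s')"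
      using s r by (intro convex_onD[OF conv]) auto
    moreover have "(1 - s / s') *\<^sub>R r + (s / s') *\<^sub>R (r + s') = r + s"
      using s by (simp add: field_simps)
    ultimately have "b (r + s) \<le> (1 - s / s') * b r + (s / s') * b (r + s')" by simp
    then show ?thesis using s by (simp add: g_def field_simps)
  qed
  have bound: "g s \<le> (b 0 - b r) / r" if s: "0 < s" for s
  proof -
    have "b ((1 - r / (r + s)) *\<^sub>R 0 + (r / (r + s)) *\<^sub>R (r + s))
        \<le> (1 - r / (r + s)) * b 0 + (r / (r + s)) * b (r + s)"
      using s r by (intro convex_onD[OF conv]) auto
    moreover have "1 - r / (r + s) = s / (r + s)" using s r by (simp add: field_simps)
    ultimately have "b r \<le> (s * b 0 + r * b (r + s)) / (r + s)"
      using s r by (simp add: add_divide_distrib)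
    then have "b r * (r + s) \<le> s * b 0 + r * b (r + s)" using s r by (simp add: pos_le_divide_eq)
    then show ?thesis using s r by (simp add: g_def field_simps)
  qed
  define L where "L = Sup (g ` {0<..})"
  have bdd: "bdd_above (g ` {0<..})" using bound by (auto intro!: bdd_aboveI[where M = "(b 0 - b r) / r"])
  have "(g \<longlongrightarrow> L) (at_right 0)"
  proof (rule order_tendstoI)
    fix a assume "a < L"
    then obtain s0 where s0: "s0 > 0" "a < g s0"
      unfolding L_def by (subst (asm) less_cSup_iff[OF _ bdd]) auto
    have "a < g s" if "0 < s" "s < s0" for s using anti[of s s0] that s0 by simp
    then show "\<forall>\<^sub>F s in at_right 0. a < g s"
      using eventually_at_right[OF s0(1)] s0(1) by blast
  next
    fix a assume "L < a"
    have "g s \<le> L" if "0 < s" for s unfolding L_def using bdd that by (intro cSup_upper) auto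
    with \<open>L < a\<close> have "g s < a" if "0 < s" for s using that by (meson le_less_trans)
    then show "\<forall>\<^sub>F s in at_right 0. g s < a"
      using eventually_at_right_less[of 0] by (auto elim: eventually_mono)
  qed
  then show ?thesis unfolding g_def by blast
qed


section \<open>The semigroup is Markovian\<close>

text \<open>The unit contraction. Composition with it is the projection of \<open>L\<^sup>2\<close> onto the functions with values
  in \<open>[0, 1]\<close>.\<close>

definition clip :: "real \<Rightarrow> real" where "clip r = min 1 (max 0 r)"

lemma clip_bounds: "0 \<le> clip r" "clip r \<le> 1" "\<bar>clip r\<bar> \<le> \<bar>r\<bar>"
  and clip_id: "0 \<le> r \<Longrightarrow> r \<le> 1 \<Longrightarrow> clip r = r"
  and clip_excess_lipschitz: "\<bar>(r - clip r) - (s - clip s)\<bar> \<le> \<bar>r - s\<bar>"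
  and clip_nearest: "0 \<le> s \<Longrightarrow> s \<le> 1 \<Longrightarrow> \<bar>r - clip r\<bar> \<le> \<bar>r - s\<bar>"
  unfolding clip_def by linarith+

lemma clip_measurable [measurable]: "clip \<in> borel_measurable borel"
  unfolding clip_def[abs_def] by measurable

lemma L2_clip:
  assumes "u \<in> L2 m"
  shows "(\<lambda>x. clip (u x)) \<in> L2 m"
proof (rule L2_bound[OF assms])
  show "(\<lambda>x. clip (u x)) \<in> borel_measurable m" using assms by (auto simp: L2_def)
  show "AE x in m. \<bar>clip (u x)\<bar> \<le> 1 * \<bar>u x\<bar>"
    by (rule AE_I2) (simp only: mult_1 clip_bounds(3))
qed

locale dirichlet_space =
  fixes m :: "'a measure" and F :: "('a \<Rightarrow> real) set"
    and E :: "('a \<Rightarrow> real) \<Rightarrow> ('a \<Rightarrow> real) \<Rightarrow> real"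
  assumes dirichlet: "dirichlet_form m F E"
begin

lemma F_subset_L2: "F \<subseteq> L2 m"
  and E_form: "nonneg_symmetric_form m F E"
  and clip_F: "u \<in> F \<Longrightarrow> (\<lambda>x. clip (u x)) \<in> F"
  and E_clip: "u \<in> F \<Longrightarrow> E (\<lambda>x. clip (u x)) (\<lambda>x. clip (u x)) \<le> E u u"
  using dirichlet unfolding dirichlet_form_def clip_def by (elim conjE; metis)+

lemma F_complete: "(\<And>n. k n \<in> F) \<Longrightarrow> form_cauchy (form1 m E) k \<Longrightarrow>
    \<exists>u\<in>F. (\<lambda>n. form1 m E (\<lambda>x. k n x - u x) (\<lambda>x. k n x - u x)) \<longlonglongrightarrow> 0"
  by (rule dirichlet[unfolded dirichlet_form_def, THEN conjunct2, THEN conjunct2, THEN conjunct2,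
        THEN conjunct1, rule_format]) simp

lemma F_L2: "u \<in> F \<Longrightarrow> u \<in> L2 m"
  using F_subset_L2 by blast

end

locale dirichlet_semigroup = dirichlet_space +
  fixes T :: "real \<Rightarrow> ('a \<Rightarrow> real) \<Rightarrow> 'a \<Rightarrow> real"
  assumes semigroup: "associated_semigroup m F E T"
begin

lemma
  assumes "t \<ge> 0" "u \<in> L2 m"
  shows T_L2: "T t u \<in> L2 m"
    and T_contraction: "inner2 m (T t u) (T t u) \<le> inner2 m u u"
    and T_scale: "AE x in m. T t (\<lambda>z. c * u z) x = c * T t u x"
    and T_cong: "v \<in> L2 m \<Longrightarrow> AE x in m. u x = v x \<Longrightarrow> AE x in m. T t u x = T t v x"
    and T_add: "v \<in> L2 m \<Longrightarrow> AE x in m. T t (\<lambda>z. u z + v z) x = T t u x + T t v x"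
    and T_symmetric: "v \<in> L2 m \<Longrightarrow> inner2 m (T t u) v = inner2 m u (T t v)"
    and T_semigroup: "s \<ge> 0 \<Longrightarrow> AE x in m. T (s + t) u x = T s (T t u) x"
  using conjunct1[OF semigroup[unfolded associated_semigroup_def], rule_format, OF assms] by blast+

lemma T_zero: "u \<in> L2 m \<Longrightarrow> AE x in m. T 0 u x = u x"
  and T_continuous_0: "u \<in> L2 m \<Longrightarrow>
    ((\<lambda>t. inner2 m (\<lambda>x. T t u x - u x) (\<lambda>x. T t u x - u x)) \<longlongrightarrow> 0) (at_right 0)"
  and F_iff: "u \<in> F \<longleftrightarrow> u \<in> L2 m \<and> (\<exists>l. ((\<lambda>t. inner2 m (\<lambda>x. u x - T t u x) u / t) \<longlongrightarrow> l) (at_right 0))"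
  and E_limit: "u \<in> F \<Longrightarrow> v \<in> F \<Longrightarrow>
    ((\<lambda>t. inner2 m (\<lambda>x. u x - T t u x) v / t) \<longlongrightarrow> E u v) (at_right 0)"
  using conjunct2[OF semigroup[unfolded associated_semigroup_def]] by (elim conjE; simp)+

lemma T_diff:
  assumes "t \<ge> 0" "u \<in> L2 m" "v \<in> L2 m"
  shows "AE x in m. T t (\<lambda>z. u z - v z) x = T t u x - T t v x"
  using T_add[OF assms(1,2) L2_scale[OF assms(3)], of "-1"] T_scale[OF assms(1,3), of "-1"]
  by (simp, eventually_elim) auto

lemma inner2_T_semigroup:
  assumes "s \<ge> 0" "t \<ge> 0" "u \<in> L2 m" "v \<in> L2 m"
  shows "inner2 m (T (s + t) u) v = inner2 m (T t u) (T s v)"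
proof -
  have "inner2 m (T (s + t) u) v = inner2 m (T s (T t u)) v"
    using assms T_semigroup[of t u s]
    by (intro form_AE_eq[OF inner2_form]) (auto intro!: T_L2 L2_measurable)
  then show ?thesis using assms by (simp add: T_symmetric T_L2)
qed

lemma inner2_T_square:
  assumes "t \<ge> 0" "u \<in> L2 m"
  shows "inner2 m (T t u) u = inner2 m (T (t / 2) u) (T (t / 2) u)"
  using inner2_T_semigroup[of "t / 2" "t / 2" u u] assms by simp

lemma inner2_T_0: "u \<in> L2 m \<Longrightarrow> v \<in> L2 m \<Longrightarrow> inner2 m (T 0 u) v = inner2 m u v"
  using T_zero[of u] T_L2[of 0 u]
  by (intro form_AE_eq[OF inner2_form]) (auto intro: L2_measurable)

lemma T_diff_norm:
  assumes "0 \<le> s" "s \<le> t" "u \<in> L2 m"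
  shows "inner2 m (\<lambda>x. T t u x - T s u x) (\<lambda>x. T t u x - T s u x)
       \<le> inner2 m (\<lambda>x. T (t - s) u x - u x) (\<lambda>x. T (t - s) u x - u x)"
proof -
  have "AE x in m. T s (\<lambda>z. T (t - s) u z - u z) x = T s (T (t - s) u) x - T s u x"
    using assms by (intro T_diff) (auto intro!: T_L2)
  moreover have "AE x in m. T t u x = T s (T (t - s) u) x"
    using T_semigroup[of "t - s" u s] assms by simp
  ultimately have "AE x in m. T s (\<lambda>z. T (t - s) u z - u z) x = T t u x - T s u x"
    by eventually_elim simp
  then have "inner2 m (\<lambda>x. T t u x - T s u x) (\<lambda>x. T t u x - T s u x)
     \<le> inner2 m (T s (\<lambda>z. T (t - s) u z - u z)) (T s (\<lambda>z. T (t - s) u z - u z))"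
    using assms by (intro inner2_mono) (auto intro!: T_L2 L2_diff)
  also have "\<dots> \<le> inner2 m (\<lambda>x. T (t - s) u x - u x) (\<lambda>x. T (t - s) u x - u x)"
    using assms by (intro T_contraction) (auto intro!: T_L2 L2_diff)
  finally show ?thesis .
qed

lemma T_equicontinuous:
  assumes u: "u \<in> L2 m" and e: "e > 0"
  obtains d where "d > 0"
    "\<And>s t. 0 \<le> s \<Longrightarrow> 0 \<le> t \<Longrightarrow> \<bar>s - t\<bar> < d \<Longrightarrow>
      inner2 m (\<lambda>x. T t u x - T s u x) (\<lambda>x. T t u x - T s u x) < e"
proof -
  have "\<forall>\<^sub>F t in at_right 0. inner2 m (\<lambda>x. T t u x - u x) (\<lambda>x. T t u x - u x) < e"
    using order_tendstoD(2)[OF T_continuous_0[OF u] e] .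
  then obtain d where d: "d > 0"
    "\<And>t. 0 < t \<Longrightarrow> t < d \<Longrightarrow> inner2 m (\<lambda>x. T t u x - u x) (\<lambda>x. T t u x - u x) < e"
    by (auto simp: eventually_at_right[of 0 1])
  have 1: "inner2 m (\<lambda>x. T t u x - T s u x) (\<lambda>x. T t u x - T s u x) < e"
    if "0 \<le> s" "s \<le> t" "t - s < d" for s t
  proof (cases "s = t")
    case True
    then show ?thesis using e by (simp add: inner2_def)
  next
    case False
    then show ?thesis
      using T_diff_norm[OF that(1,2) u] d(2)[of "t - s"] that by simp
  qed
  have "inner2 m (\<lambda>x. T t u x - T s u x) (\<lambda>x. T t u x - T s u x) < e"
    if "0 \<le> s" "0 \<le> t" "\<bar>s - t\<bar> < d" for s t
  proof (cases "s \<le> t")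
    case True
    then show ?thesis using 1 that by simp
  next
    case False
    then have "inner2 m (\<lambda>x. T s u x - T t u x) (\<lambda>x. T s u x - T t u x) < e"
      using 1[of t s] that by simp
    then show ?thesis by (simp add: inner2_def algebra_simps)
  qed
  with d(1) show ?thesis by (rule that)
qed

lemma inner2_T_continuous:
  assumes u: "u \<in> L2 m" and v: "v \<in> L2 m"
  shows "continuous_on {0..} (\<lambda>t. inner2 m (T t u) v)"
  unfolding continuous_on_iff
proof (intro ballI allI impI)
  fix t e :: real assume t: "t \<in> {0..}" and e: "e > 0"
  define c where "c = inner2 m v v + 1"
  have c: "c > 0" using inner2_self_nonneg[of m v] by (simp add: c_def)
  have "e\<^sup>2 / c > 0" using e c by simp
  from T_equicontinuous[OF u this] obtain d where d: "d > 0"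
    "\<And>s t. 0 \<le> s \<Longrightarrow> 0 \<le> t \<Longrightarrow> \<bar>s - t\<bar> < d \<Longrightarrow>
      inner2 m (\<lambda>x. T t u x - T s u x) (\<lambda>x. T t u x - T s u x) < e\<^sup>2 / c" by blast
  have "dist (inner2 m (T s u) v) (inner2 m (T t u) v) < e" if "s \<in> {0..}" "dist s t < d" for s
  proof -
    have *: "inner2 m (\<lambda>x. T s u x - T t u x) (\<lambda>x. T s u x - T t u x) < e\<^sup>2 / c"
      using d(2)[of t s] that t by (simp add: dist_real_def abs_minus_commute)
    have "(inner2 m (T s u) v - inner2 m (T t u) v)\<^sup>2 = (inner2 m (\<lambda>x. T s u x - T t u x) v)\<^sup>2"
      using that t u v by (simp add: inner2_diff_left T_L2)
    also have "\<dots> \<le> inner2 m (\<lambda>x. T s u x - T t u x) (\<lambda>x. T s u x - T t u x) * inner2 m v v"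
      using that t u v by (intro inner2_cauchy_schwarz) (auto intro!: L2_diff T_L2)
    also have "\<dots> \<le> inner2 m (\<lambda>x. T s u x - T t u x) (\<lambda>x. T s u x - T t u x) * c"
      by (intro mult_left_mono) (auto simp: c_def inner2_self_nonneg)
    also have "\<dots> < e\<^sup>2" using * c by (simp add: pos_less_divide_eq)
    finally show ?thesis
      using e by (simp add: dist_real_def) (metis abs_le_square_iff abs_of_pos not_le)
  qed
  with d(1) show "\<exists>d>0. \<forall>s\<in>{0..}. dist s t < d \<longrightarrow> dist (inner2 m (T s u) v) (inner2 m (T t u) v) < e"
    by blast
qed

text \<open>The function \<open>t \<mapsto> (T\<^sub>t u, u)\<close> is midpoint convex, its second differences being squared norms; hence
  it has right derivatives at positive times, which is what membership in \<open>F\<close> demands.\<close>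

lemma T_F:
  assumes t: "t > 0" and u: "u \<in> L2 m"
  shows "T t u \<in> F"
proof -
  define b where "b r = inner2 m (T r u) u" for r
  have "convex_on {0..} b"
  proof (rule midpoint_convex_imp_convex)
    show "continuous_on {0..} b" unfolding b_def by (rule inner2_T_continuous[OF u u])
    fix r h :: real assume rh: "0 \<le> r" "0 \<le> h"
    have b1: "b (r + h) = inner2 m (T (r / 2) u) (T (r / 2 + h) u)"
      using inner2_T_semigroup[of "r / 2 + h" "r / 2" u u] rh u by (simp add: b_def algebra_simps)
    have b2: "b (r + 2 * h) = inner2 m (T (r / 2 + h) u) (T (r / 2 + h) u)"
      using inner2_T_semigroup[of "r / 2 + h" "r / 2 + h" u u] rh u by (simp add: b_def algebra_simps)
    have b3: "b r = inner2 m (T (r / 2) u) (T (r / 2) u)"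
      using inner2_T_square[OF rh(1) u] by (simp add: b_def)
    show "2 * b (r + h) \<le> b r + b (r + 2 * h)"
      unfolding b1 b2 b3
      using inner2_self_nonneg[of m "\<lambda>x. T (r / 2) u x - T (r / 2 + h) u x"] rh u
      by (simp add: form_square_diff[OF inner2_form] T_L2)
  qed
  then obtain l where l: "((\<lambda>s. (b (2 * t) - b (2 * t + s)) / s) \<longlongrightarrow> l) (at_right 0)"
    using convex_right_slope_limit[of b "2 * t"] t by auto
  have "inner2 m (\<lambda>x. T t u x - T s (T t u) x) (T t u) = b (2 * t) - b (2 * t + s)" if "s > 0" for s
  proof -
    have "inner2 m (T s (T t u)) (T t u) = inner2 m (T (s + t) u) (T t u)"
      using T_semigroup[of t u s] that t u
      by (intro form_AE_eq[OF inner2_form]) (auto intro!: T_L2 L2_measurable)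
    also have "\<dots> = b (2 * t + s)"
      using inner2_T_semigroup[of t "s + t" u u] that t u by (simp add: b_def algebra_simps)
    finally show ?thesis
      using inner2_T_semigroup[of t t u u] that t u
      by (simp add: inner2_diff_left T_L2 b_def)
  qed
  then have "\<forall>\<^sub>F s in at_right 0. (b (2 * t) - b (2 * t + s)) / s
      = inner2 m (\<lambda>x. T t u x - T s (T t u) x) (T t u) / s"
    using eventually_at_right_less[of 0] by (auto elim: eventually_mono)
  with l have "((\<lambda>s. inner2 m (\<lambda>x. T t u x - T s (T t u) x) (T t u) / s) \<longlongrightarrow> l) (at_right 0)"
    by (rule Lim_transform_eventually)
  then show ?thesis using t u by (auto simp: F_iff T_L2)
qed

text \<open>By the semigroup property \<open>\<parallel>T\<^sub>h u\<parallel>\<^sup>2 = (T\<^sub>2\<^sub>h u, u)\<close>, so the quotient is the difference of two quotients,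
  with steps \<open>h\<close> and \<open>2 h\<close>, that both converge to \<open>2 E(u, u)\<close>.\<close>

lemma T_difference_quotient_energy:
  assumes u: "u \<in> F"
  shows "((\<lambda>h. inner2 m (\<lambda>x. u x - T h u x) (\<lambda>x. u x - T h u x) / h) \<longlongrightarrow> 0) (at_right 0)"
proof -
  note uL = F_L2[OF u]
  define q where "q h = inner2 m (\<lambda>x. u x - T h u x) u / h" for h
  have q: "(q \<longlongrightarrow> E u u) (at_right 0)"
    unfolding q_def by (rule E_limit[OF u u])
  have "filterlim (\<lambda>h::real. 2 * h) (at_right 0) (at_right 0)"
    unfolding filterlim_at
    using eventually_at_right_less[of "0::real"]
    by (auto intro!: tendsto_eq_intros elim: eventually_mono)
  then have "((\<lambda>h. q (2 * h)) \<longlongrightarrow> E u u) (at_right 0)"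
    by (rule filterlim_compose[OF q])
  then have "((\<lambda>h. 2 * q h - 2 * q (2 * h)) \<longlongrightarrow> 2 * E u u - 2 * E u u) (at_right 0)"
    by (intro tendsto_intros q)
  moreover have "\<forall>\<^sub>F h in at_right 0. 2 * q h - 2 * q (2 * h)
      = inner2 m (\<lambda>x. u x - T h u x) (\<lambda>x. u x - T h u x) / h"
    using eventually_at_right_less[of "0::real"]
  proof eventually_elim
    case (elim h)
    have "inner2 m (T h u) (T h u) = inner2 m (T (2 * h) u) u"
      using inner2_T_square[of "2 * h" u] elim uL by simp
    then show ?case
      using elim uL
      by (simp add: q_def form_square_diff[OF inner2_form] inner2_diff_left T_L2
          inner2_commute[of u m "T h u"] field_simps)
  qed
  ultimately show ?thesis
    by (simp add: tendsto_cong)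
qed

text \<open>The squared distance of \<open>T\<^sub>t f\<close> from the convex set of functions with values in \<open>[0, 1]\<close> cannot grow:
  its right upper derivative at \<open>u = T\<^sub>t f\<close> is at most \<open>-2 E(u, u - clip u)\<close>, and
  \<open>2 E(u, u - clip u) = E(u) - E(clip u) + E(u - clip u) \<ge> 0\<close> because the clip contracts \<open>E\<close>.\<close>

lemma T_markov:
  assumes t: "t \<ge> 0" and f: "f \<in> L2 m" and f01: "AE x in m. 0 \<le> f x \<and> f x \<le> 1"
  shows "AE x in m. 0 \<le> T t f x \<and> T t f x \<le> 1"
proof (cases "t = 0")
  case True
  with T_zero[OF f] f01 show ?thesis by (auto elim!: eventually_elim2)
next
  case False
  with t have t: "t > 0" by simp
  define ex where "ex u = (\<lambda>x. u x - clip (u x))" for u :: "'a \<Rightarrow> real"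
  have ex_L2: "ex u \<in> L2 m" if "u \<in> L2 m" for u
    unfolding ex_def using that by (intro L2_diff L2_clip)
  define \<phi> where "\<phi> s = inner2 m (ex (T s f)) (ex (T s f))" for s
  have cont: "continuous_on {0..t} \<phi>"
    unfolding continuous_on_iff
  proof (intro ballI allI impI)
    fix r e :: real assume r: "r \<in> {0..t}" and e: "e > 0"
    define c where "c = 4 * inner2 m f f + 1"
    have c: "c > 0" using inner2_self_nonneg[of m f] by (simp add: c_def)
    have "e\<^sup>2 / c > 0" using e c by simp
    from T_equicontinuous[OF f this] obtain d where d: "d > 0"
      "\<And>s t. 0 \<le> s \<Longrightarrow> 0 \<le> t \<Longrightarrow> \<bar>s - t\<bar> < d \<Longrightarrow>
        inner2 m (\<lambda>x. T t f x - T s f x) (\<lambda>x. T t f x - T s f x) < e\<^sup>2 / c" by blast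
    have "dist (\<phi> s) (\<phi> r) < e" if s: "s \<in> {0..t}" and sr: "dist s r < d" for s
    proof -
      let ?a = "ex (T s f)" and ?b = "ex (T r f)"
      have TL: "T s f \<in> L2 m" "T r f \<in> L2 m" using s r f by (auto intro: T_L2)
      then have aL: "?a \<in> L2 m" "?b \<in> L2 m" by (auto intro: ex_L2)
      have bound: "inner2 m (ex (T p f)) (ex (T p f)) \<le> inner2 m f f" if "p \<ge> 0" for p
      proof -
        have "inner2 m (ex (T p f)) (ex (T p f)) \<le> inner2 m (T p f) (T p f)"
          using T_L2[OF that f] clip_nearest[of 0]
          by (intro inner2_mono ex_L2 AE_I2) (auto simp: ex_def)
        also have "\<dots> \<le> inner2 m f f" using that f by (rule T_contraction)
        finally show ?thesis .
      qed
      have "(\<phi> s - \<phi> r)\<^sup>2 = (inner2 m (\<lambda>x. ?a x - ?b x) (\<lambda>x. ?a x + ?b x))\<^sup>2"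
        using aL by (simp add: \<phi>_def inner2_diff_left inner2_add_right L2_add inner2_commute[of ?b m ?a])
      also have "\<dots> \<le> inner2 m (\<lambda>x. ?a x - ?b x) (\<lambda>x. ?a x - ?b x) * inner2 m (\<lambda>x. ?a x + ?b x) (\<lambda>x. ?a x + ?b x)"
        using aL by (intro inner2_cauchy_schwarz L2_add L2_diff)
      also have "\<dots> \<le> inner2 m (\<lambda>x. T s f x - T r f x) (\<lambda>x. T s f x - T r f x) * c"
      proof (rule mult_mono)
        show "inner2 m (\<lambda>x. ?a x - ?b x) (\<lambda>x. ?a x - ?b x) \<le> inner2 m (\<lambda>x. T s f x - T r f x) (\<lambda>x. T s f x - T r f x)"
          using TL aL clip_excess_lipschitz by (intro inner2_mono L2_diff AE_I2) (auto simp: ex_def)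
        have "inner2 m (\<lambda>x. ?a x + ?b x) (\<lambda>x. ?a x + ?b x) \<le> 2 * inner2 m ?a ?a + 2 * inner2 m ?b ?b"
          using aL by (rule form_square_add_le[OF inner2_form])
        then show "inner2 m (\<lambda>x. ?a x + ?b x) (\<lambda>x. ?a x + ?b x) \<le> c"
          using bound[of s] bound[of r] s r by (simp add: c_def)
      qed (auto simp: inner2_self_nonneg)
      also have "\<dots> < e\<^sup>2"
        using d(2)[of r s] s r sr c by (simp add: pos_less_divide_eq dist_real_def abs_minus_commute)
      finally show ?thesis
        using e by (simp add: dist_real_def) (metis abs_le_square_iff abs_of_pos not_le)
    qed
    with d(1) show "\<exists>d>0. \<forall>s\<in>{0..t}. dist s r < d \<longrightarrow> dist (\<phi> s) (\<phi> r) < e" by blast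
  qed
  have "\<phi> t \<le> \<phi> 0"
  proof (rule antimono_if_right_growth[OF t cont])
    fix s e :: real assume s: "0 < s" "s < t" and e: "e > 0"
    define u where "u = T s f"
    have u: "u \<in> F" unfolding u_def by (rule T_F[OF s(1) f])
    note uL = F_L2[OF u]
    have exF: "ex u \<in> F"
      unfolding ex_def by (rule form_diff[OF E_form u clip_F[OF u]])
    have "E (ex u) (ex u) = E u u - 2 * E u (\<lambda>x. clip (u x)) + E (\<lambda>x. clip (u x)) (\<lambda>x. clip (u x))"
      unfolding ex_def by (rule form_square_diff[OF E_form u clip_F[OF u]])
    moreover have "E u (ex u) = E u u - E u (\<lambda>x. clip (u x))"
      unfolding ex_def by (rule form_diff_right[OF E_form u clip_F[OF u] u])
    ultimately have E_ex: "E u (ex u) \<ge> 0"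
      using E_clip[OF u] form_nonneg[OF E_form exF] by simp
    define q where "q h = inner2 m (\<lambda>x. u x - T h u x) (\<lambda>x. u x - T h u x) / h
      - 2 * (inner2 m (\<lambda>x. u x - T h u x) (ex u) / h)" for h
    have "(q \<longlongrightarrow> 0 - 2 * E u (ex u)) (at_right 0)"
      unfolding q_def by (intro tendsto_intros T_difference_quotient_energy E_limit u exF)
    then have "\<forall>\<^sub>F h in at_right 0. q h < e"
      by (rule order_tendstoD(2)) (use E_ex e in linarith)
    then show "\<forall>\<^sub>F h in at_right 0. \<phi> (s + h) \<le> \<phi> s + e * h"
      using eventually_at_right_less[of "0::real"]
    proof eventually_elim
      case (elim h)
      have ThL: "T h u \<in> L2 m" using elim uL by (intro T_L2) auto
      have Tsh: "AE x in m. T (h + s) f x = T h u x"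
        using T_semigroup[of s f h] elim s f by (simp add: u_def)
      have "\<phi> (s + h) \<le> inner2 m (\<lambda>x. T h u x - clip (u x)) (\<lambda>x. T h u x - clip (u x))"
        unfolding \<phi>_def add.commute[of s h]
      proof (rule inner2_mono)
        show "ex (T (h + s) f) \<in> L2 m" using elim s f by (intro ex_L2 T_L2) auto
        show "(\<lambda>x. T h u x - clip (u x)) \<in> L2 m" using ThL uL by (intro L2_diff L2_clip)
        show "AE x in m. \<bar>ex (T (h + s) f) x\<bar> \<le> \<bar>T h u x - clip (u x)\<bar>"
          using Tsh by eventually_elim (simp add: ex_def clip_nearest clip_bounds)
      qed
      also have "(\<lambda>x. T h u x - clip (u x)) = (\<lambda>x. ex u x - (u x - T h u x))"
        by (simp add: ex_def fun_eq_iff)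
      also have "inner2 m \<dots> \<dots> = \<phi> s + h * q h"
        unfolding form_square_diff[OF inner2_form ex_L2[OF uL] L2_diff[OF uL ThL]]
          inner2_commute[OF ex_L2[OF uL] L2_diff[OF uL ThL]]
        using elim by (simp add: \<phi>_def u_def q_def right_diff_distrib)
      also have "\<dots> \<le> \<phi> s + h * e" using elim by (intro add_left_mono mult_left_mono) auto
      finally show ?case by (simp add: mult.commute)
    qed
  qed
  moreover have "\<phi> 0 = 0"
  proof -
    have "AE x in m. ex (T 0 f) x = 0"
      using T_zero[OF f] f01 by eventually_elim (simp add: ex_def clip_id)
    then have "inner2 m (ex (T 0 f)) (ex (T 0 f)) \<le> inner2 m (\<lambda>x. 0) (\<lambda>x. 0)"
      using f by (intro inner2_mono ex_L2 T_L2 L2_zero) auto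
    then show ?thesis
      using inner2_self_nonneg[of m "ex (T 0 f)"] by (simp add: \<phi>_def inner2_def[of m "\<lambda>x. 0"])
  qed
  ultimately have "inner2 m (ex (T t f)) (ex (T t f)) = 0"
    using inner2_self_nonneg[of m "ex (T t f)"] by (simp add: \<phi>_def)
  then have "AE x in m. ex (T t f) x = 0"
    using t f by (intro inner2_eq_0_AE ex_L2 T_L2) auto
  then show ?thesis
    by eventually_elim (auto simp: ex_def clip_def min_def max_def split: if_splits)
qed

text \<open>For \<open>v = clip (- T\<^sub>t u)\<close> the integral of \<open>T\<^sub>t u \<cdot> v\<close> is at most 0, but by symmetry it equals the
  integral of \<open>u \<cdot> T\<^sub>t v\<close>, which is at least 0.\<close>

lemma T_nonneg:
  assumes t: "t \<ge> 0" and u: "u \<in> L2 m" and u0: "AE x in m. 0 \<le> u x"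
  shows "AE x in m. 0 \<le> T t u x"
proof -
  note TL = T_L2[OF t u]
  define v where "v = (\<lambda>x. clip (- T t u x))"
  have v: "v \<in> L2 m"
    unfolding v_def using L2_scale[OF TL, of "-1"] by (intro L2_clip) simp
  have v01: "AE x in m. 0 \<le> v x \<and> v x \<le> 1" by (simp add: v_def clip_bounds)
  have "0 \<le> inner2 m u (T t v)"
    unfolding inner2_def using u0 T_markov[OF t v v01]
    by (intro integral_nonneg_AE) (auto elim!: eventually_elim2)
  then have 1: "0 \<le> inner2 m (T t u) v" using T_symmetric[OF t u v] by simp
  have neg: "0 \<le> - (T t u x * v x)" for x
    by (auto simp: v_def clip_def min_def max_def mult_le_0_iff)
  have int: "integrable m (\<lambda>x. - (T t u x * v x))" using L2_mult_integrable[OF TL v] by simp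
  have "(\<integral>x. - (T t u x * v x) \<partial>m) = - inner2 m (T t u) v" by (simp add: inner2_def)
  moreover have "0 \<le> (\<integral>x. - (T t u x * v x) \<partial>m)" using neg by (intro integral_nonneg_AE AE_I2)
  ultimately have "(\<integral>x. - (T t u x * v x) \<partial>m) = 0" using 1 by linarith
  then have "AE x in m. - (T t u x * v x) = 0"
    using integral_nonneg_eq_0_iff_AE[OF int] neg by auto
  then show ?thesis
    by eventually_elim (auto simp: v_def clip_def min_def max_def split: if_splits)
qed

text \<open>By symmetry, \<open>\<integral> T\<^sub>t u \<cdot> v = \<integral> u \<cdot> T\<^sub>t v\<close> for square integrable \<open>v\<close> with values in \<open>[-1, 1]\<close>. The functions \<open>v\<close>
  used below, clips of multiples of \<open>T\<^sub>t u\<close>, increase \<open>T\<^sub>t u \<cdot> v\<close> to its absolute value.\<close>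

lemma T_L1_contraction:
  assumes t: "t \<ge> 0" and u: "u \<in> L2 m" and int: "integrable m u"
  shows "integrable m (T t u)" and "(\<integral>x. \<bar>T t u x\<bar> \<partial>m) \<le> (\<integral>x. \<bar>u x\<bar> \<partial>m)"
proof -
  define w where "w = T t u"
  have w: "w \<in> L2 m" unfolding w_def by (rule T_L2[OF t u])
  define v where "v n x = clip (real n * w x) - clip (- real n * w x)" for n x
  have pm: "(\<lambda>x. clip (real n * w x)) \<in> L2 m" "(\<lambda>x. clip (- real n * w x)) \<in> L2 m" for n
    by (intro L2_clip L2_scale w)+
  have v: "v n \<in> L2 m" for n unfolding v_def by (intro L2_diff pm)
  have bound: "inner2 m w (v n) \<le> (\<integral>x. \<bar>u x\<bar> \<partial>m)" for n
  proof -
    have "AE x in m. T t (v n) x = T t (\<lambda>x. clip (real n * w x)) x - T t (\<lambda>x. clip (- real n * w x)) x"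
      unfolding v_def by (rule T_diff[OF t pm])
    moreover have "AE x in m. 0 \<le> T t (\<lambda>x. clip (real n * w x)) x \<and> T t (\<lambda>x. clip (real n * w x)) x \<le> 1"
      by (rule T_markov[OF t pm(1)]) (simp add: clip_bounds)
    moreover have "AE x in m. 0 \<le> T t (\<lambda>x. clip (- real n * w x)) x \<and> T t (\<lambda>x. clip (- real n * w x)) x \<le> 1"
      by (rule T_markov[OF t pm(2)]) (simp add: clip_bounds)
    ultimately have Tv: "AE x in m. \<bar>T t (v n) x\<bar> \<le> 1" by eventually_elim auto
    have "inner2 m w (v n) = inner2 m u (T t (v n))"
      unfolding w_def using t u v by (rule T_symmetric)
    also have "\<dots> \<le> (\<integral>x. \<bar>u x\<bar> \<partial>m)"
      unfolding inner2_def
    proof (rule integral_mono_AE)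
      show "AE x in m. u x * T t (v n) x \<le> \<bar>u x\<bar>"
        using Tv
      proof eventually_elim
        case (elim x)
        have "u x * T t (v n) x \<le> \<bar>u x\<bar> * \<bar>T t (v n) x\<bar>" by (simp flip: abs_mult)
        also have "\<dots> \<le> \<bar>u x\<bar> * 1" using elim by (intro mult_left_mono) auto
        finally show ?case by simp
      qed
    qed (use int u v t in \<open>auto intro!: L2_mult_integrable T_L2\<close>)
    finally show ?thesis .
  qed
  have wv: "0 \<le> w x * v n x" "w x * v n x \<le> w x * v (Suc n) x" for n x
  proof -
    have eq: "w x * v n x = \<bar>w x\<bar> * min 1 (real n * \<bar>w x\<bar>)" for n
      by (cases "w x \<ge> 0") (auto simp: v_def clip_def min_def max_def mult_nonneg_nonneg mult_le_0_iff zero_le_mult_iff)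
    show "0 \<le> w x * v n x" unfolding eq by (intro mult_nonneg_nonneg) auto
    show "w x * v n x \<le> w x * v (Suc n) x"
      unfolding eq by (intro mult_left_mono min.mono mult_right_mono) auto
  qed
  have lim: "(\<lambda>n. w x * v n x) \<longlonglongrightarrow> \<bar>w x\<bar>" for x
  proof -
    obtain N where N: "1 \<le> real n * \<bar>w x\<bar>" if "n \<ge> N" "w x \<noteq> 0" for n
    proof (cases "w x = 0")
      case False
      obtain N where "1 / \<bar>w x\<bar> < real N" using reals_Archimedean2 by blast
      then have "1 < real N * \<bar>w x\<bar>" using False by (simp add: divide_less_eq)
      moreover have "real N * \<bar>w x\<bar> \<le> real n * \<bar>w x\<bar>" if "n \<ge> N" for n
        using that by (intro mult_right_mono) auto
      ultimately have "1 \<le> real n * \<bar>w x\<bar>" if "n \<ge> N" for n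
        using that by fastforce
      then show ?thesis using that by blast
    qed (use that in blast)
    have "w x * v n x = \<bar>w x\<bar>" if "n \<ge> N" for n
      using N[OF that]
      by (cases "w x" "0::real" rule: linorder_cases) (auto simp: v_def clip_def min_def max_def)
    then show ?thesis by (intro tendsto_eventually) (auto simp: eventually_sequentially)
  qed
  have meas: "w \<in> borel_measurable m" "\<And>n. v n \<in> borel_measurable m"
    using w v by (auto intro: L2_measurable)
  have "(\<integral>\<^sup>+x. ennreal \<bar>w x\<bar> \<partial>m) \<le> ennreal (\<integral>x. \<bar>u x\<bar> \<partial>m)"
  proof (rule LIMSEQ_le_const2)
    show "(\<lambda>n. \<integral>\<^sup>+x. ennreal (w x * v n x) \<partial>m) \<longlonglongrightarrow> (\<integral>\<^sup>+x. ennreal \<bar>w x\<bar> \<partial>m)"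
    proof (rule nn_integral_LIMSEQ)
      show "incseq (\<lambda>n x. ennreal (w x * v n x))"
        using wv by (intro incseq_SucI) (auto simp: le_fun_def intro: ennreal_leI)
    qed (use meas lim in auto)
    show "\<exists>N. \<forall>n\<ge>N. (\<integral>\<^sup>+x. ennreal (w x * v n x) \<partial>m) \<le> ennreal (\<integral>x. \<bar>u x\<bar> \<partial>m)"
      using bound wv by (subst nn_integral_eq_integral[OF L2_mult_integrable[OF w v]])
        (auto simp: inner2_def intro!: ennreal_leI)
  qed
  then have fin: "(\<integral>\<^sup>+x. ennreal \<bar>w x\<bar> \<partial>m) \<le> ennreal (\<integral>x. \<bar>u x\<bar> \<partial>m)" .
  then show 1: "integrable m (T t u)"
    unfolding w_def[symmetric] using meas by (intro integrableI_bounded) (auto simp: le_less_trans)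
  show "(\<integral>x. \<bar>T t u x\<bar> \<partial>m) \<le> (\<integral>x. \<bar>u x\<bar> \<partial>m)"
    using fin 1 by (subst (asm) nn_integral_eq_integral) (auto simp: w_def ennreal_le_iff)
qed

end

section \<open>A criterion for recurrence\<close>

lemma inner2_sum_right:
  fixes a :: "nat \<Rightarrow> 'a \<Rightarrow> real"
  assumes "v \<in> L2 m" "\<And>k. a k \<in> L2 m"
  shows "(\<lambda>x. \<Sum>k<n. a k x) \<in> L2 m \<and> inner2 m v (\<lambda>x. \<Sum>k<n. a k x) = (\<Sum>k<n. inner2 m v (a k))"
proof (induction n)
  case 0
  then show ?case by (simp add: L2_zero inner2_def)
next
  case (Suc n)
  then show ?case using assms by (simp add: L2_add inner2_add_right)
qed

lemma integral_abs_triangle: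
  fixes a b :: "'a \<Rightarrow> real"
  assumes "integrable m a" "integrable m b"
  shows "(\<integral>x. \<bar>a x + b x\<bar> \<partial>m) \<le> (\<integral>x. \<bar>a x\<bar> \<partial>m) + (\<integral>x. \<bar>b x\<bar> \<partial>m)"
proof -
  have "(\<integral>x. \<bar>a x + b x\<bar> \<partial>m) \<le> (\<integral>x. \<bar>a x\<bar> + \<bar>b x\<bar> \<partial>m)"
    using assms by (intro integral_mono) auto
  also have "\<dots> = (\<integral>x. \<bar>a x\<bar> \<partial>m) + (\<integral>x. \<bar>b x\<bar> \<partial>m)" using assms by simp
  finally show ?thesis .
qed

lemma L1_limit_bounded_multiplier:
  fixes a :: "nat \<Rightarrow> 'a \<Rightarrow> real"
  assumes a: "\<And>n. integrable m (a n)" and b: "integrable m b"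
    and lim: "(\<lambda>n. \<integral>x. \<bar>a n x - b x\<bar> \<partial>m) \<longlonglongrightarrow> 0"
    and v: "v \<in> borel_measurable m" "AE x in m. \<bar>v x\<bar> \<le> 1"
  shows "(\<lambda>n. \<integral>x. a n x * v x \<partial>m) \<longlonglongrightarrow> (\<integral>x. b x * v x \<partial>m)"
proof (rule LIM_zero_cancel, rule Lim_null_comparison[OF _ lim], intro always_eventually allI)
  fix n
  have mult: "integrable m (\<lambda>x. c x * v x)" if c: "integrable m c" for c :: "'a \<Rightarrow> real"
  proof (rule Bochner_Integration.integrable_bound[OF c])
    show "AE x in m. norm (c x * v x) \<le> norm (c x)"
      using v(2) by eventually_elim (simp add: abs_mult mult_left_le)
  qed (use c v in auto)
  have "norm ((\<integral>x. a n x * v x \<partial>m) - (\<integral>x. b x * v x \<partial>m)) = \<bar>\<integral>x. (a n x - b x) * v x \<partial>m\<bar>"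
    using mult[OF a] mult[OF b] by (simp add: left_diff_distrib)
  also have "\<dots> \<le> (\<integral>x. \<bar>(a n x - b x) * v x\<bar> \<partial>m)" by (rule integral_abs_bound)
  also have "\<dots> \<le> (\<integral>x. \<bar>a n x - b x\<bar> \<partial>m)"
  proof (rule integral_mono_AE)
    show "integrable m (\<lambda>x. \<bar>(a n x - b x) * v x\<bar>)" using a b by (intro integrable_abs mult) auto
    show "AE x in m. \<bar>(a n x - b x) * v x\<bar> \<le> \<bar>a n x - b x\<bar>"
      using v(2) by eventually_elim (simp add: abs_mult mult_left_le)
  qed (use a b in auto)
  finally show "norm ((\<integral>x. a n x * v x \<partial>m) - (\<integral>x. b x * v x \<partial>m)) \<le> (\<integral>x. \<bar>a n x - b x\<bar> \<partial>m)" .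
qed

context dirichlet_semigroup
begin

lemma T_form:
  assumes h: "h \<ge> 0"
  shows "nonneg_symmetric_form m (L2 m) (\<lambda>u v. inner2 m (\<lambda>x. u x - T h u x) v)"
proof -
  note [simp] = T_L2[OF h] L2_add L2_diff L2_scale
  have B: "inner2 m (\<lambda>x. u x - T h u x) v = inner2 m u v - inner2 m (T h u) v"
    if "u \<in> L2 m" "v \<in> L2 m" for u v
    using that by (intro inner2_diff_left) auto
  have congr: "inner2 m v w = inner2 m u w"
    if "u \<in> L2 m" "v \<in> L2 m" "w \<in> L2 m" "AE x in m. u x = v x" for u v w
    using that by (intro form_AE_eq[OF inner2_form]) (auto intro: L2_measurable)
  show ?thesis
    unfolding nonneg_symmetric_form_def
  proof (intro conjI ballI allI impI)
    fix u v w and c :: real assume u: "u \<in> L2 m"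
    show "(\<lambda>x. c * u x) \<in> L2 m" using u by simp
    show "0 \<le> inner2 m (\<lambda>x. u x - T h u x) u"
      using u h inner2_T_square[OF h u] T_contraction[of "h / 2" u] by (simp add: B)
    {
      assume v: "v \<in> borel_measurable m" and eq: "AE x in m. u x = v x"
      show vL: "v \<in> L2 m" using form_AE_mem[OF inner2_form u v eq] .
      show "inner2 m (\<lambda>x. v x - T h v x) w = inner2 m (\<lambda>x. u x - T h u x) w" if "w \<in> L2 m"
        using congr[OF u vL that eq] congr[OF _ _ that T_cong[OF h u vL eq]] u vL that by (simp add: B)
    }
    assume v: "v \<in> L2 m"
    show "(\<lambda>x. u x + v x) \<in> L2 m" using u v by simp
    show "inner2 m (\<lambda>x. u x - T h u x) v = inner2 m (\<lambda>x. v x - T h v x) u"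
      using u v h by (simp add: B inner2_commute[OF u v] T_symmetric inner2_commute[of u m "T h v"])
    show "inner2 m (\<lambda>x. c * u x - T h (\<lambda>x. c * u x) x) v = c * inner2 m (\<lambda>x. u x - T h u x) v"
    proof -
      have "inner2 m (T h (\<lambda>x. c * u x)) v = inner2 m (\<lambda>x. c * T h u x) v"
        using T_scale[OF h u, of c] u v by (intro congr[symmetric]) auto
      then show ?thesis using u v by (simp add: B inner2_scale_left algebra_simps)
    qed
    assume w: "w \<in> L2 m"
    show "inner2 m (\<lambda>x. u x + v x - T h (\<lambda>x. u x + v x) x) w
      = inner2 m (\<lambda>x. u x - T h u x) w + inner2 m (\<lambda>x. v x - T h v x) w"
    proof -
      have "inner2 m (T h (\<lambda>x. u x + v x)) w = inner2 m (\<lambda>x. T h u x + T h v x) w"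
        using T_add[OF h u v] u v w by (intro congr[symmetric]) auto
      then show ?thesis using u v w by (simp add: B inner2_add_left algebra_simps)
    qed
  qed (rule L2_zero)
qed

lemma inner2_T_antimono:
  assumes "0 \<le> s" "s \<le> t" "u \<in> L2 m"
  shows "inner2 m (T t u) u \<le> inner2 m (T s u) u"
proof -
  have "inner2 m (T t u) u = inner2 m (T (t / 2) u) (T (t / 2) u)"
    using assms by (intro inner2_T_square) auto
  also have "\<dots> \<le> inner2 m (T ((t - s) / 2) (T (s / 2) u)) (T ((t - s) / 2) (T (s / 2) u))"
  proof (rule inner2_mono)
    have "AE x in m. T ((t - s) / 2 + s / 2) u x = T ((t - s) / 2) (T (s / 2) u) x"
      using assms by (intro T_semigroup) auto
    moreover have "(t - s) / 2 + s / 2 = t / 2" by (simp add: field_simps)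
    ultimately show "AE x in m. \<bar>T (t / 2) u x\<bar> \<le> \<bar>T ((t - s) / 2) (T (s / 2) u) x\<bar>"
      by (auto elim: eventually_mono)
  qed (use assms in \<open>auto intro!: T_L2\<close>)
  also have "\<dots> \<le> inner2 m (T (s / 2) u) (T (s / 2) u)"
    using assms by (intro T_contraction T_L2) auto
  also have "\<dots> = inner2 m (T s u) u"
    using assms by (intro inner2_T_square[symmetric]) auto
  finally show ?thesis .
qed

lemma inner2_T_nonneg: "t \<ge> 0 \<Longrightarrow> u \<in> L2 m \<Longrightarrow> 0 \<le> inner2 m (T t u) u"
  by (simp add: inner2_T_square inner2_self_nonneg)

text \<open>The bound expresses \<open>(\<eta>, w)\<^sup>2 \<le> (\<eta>, G\<eta>) E(w, w)\<close>. With the bounded forms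
  \<open>(u - T\<^sub>h u, v) / h\<close> in place of \<open>E\<close> and Riemann sums in place of \<open>G\<eta> = \<integral> T\<^sub>t \<eta> dt\<close>, the sum
  \<open>S\<close> of \<open>T\<^sub>k\<^sub>h \<eta>\<close> over \<open>k < n\<close> telescopes: \<open>S - T\<^sub>h S = \<eta> - T\<^sub>n\<^sub>h \<eta>\<close>; then Cauchy--Schwarz applies, and \<open>n\<close> tends
  to infinity before \<open>h\<close> tends to 0.\<close>

lemma pairing_le_green_energy:
  assumes \<eta>: "\<eta> \<in> L2 m" and w: "w \<in> F"
    and bound: "\<And>h n. h > 0 \<Longrightarrow> h * (\<Sum>k<n. inner2 m (T (h * real (Suc k)) \<eta>) \<eta>) \<le> \<Phi>"
  shows "(inner2 m \<eta> w)\<^sup>2 \<le> \<Phi> * E w w"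
proof -
  note wL = F_L2[OF w]
  have step: "(inner2 m \<eta> w)\<^sup>2 \<le> (h * inner2 m \<eta> \<eta> + \<Phi>) * (inner2 m (\<lambda>x. w x - T h w x) w / h)"
    if h: "h > 0" for h
  proof -
    have h0: "h \<ge> 0" using h by simp
    define B where "B u v = inner2 m (\<lambda>x. u x - T h u x) v" for u v
    have Bform: "nonneg_symmetric_form m (L2 m) B"
      unfolding B_def by (rule T_form[OF h0])
    define \<phi> where "\<phi> k = inner2 m (T (h * real k) \<eta>) \<eta>" for k
    have TL: "T (h * real k) \<eta> \<in> L2 m" for k using h \<eta> by (intro T_L2) auto
    define S where "S n = (\<lambda>x. \<Sum>k<n. T (h * real k) \<eta> x)" for n
    have SL: "S n \<in> L2 m" for n unfolding S_def using inner2_sum_right[OF \<eta>, of "\<lambda>k. T (h * real k) \<eta>"] TL by blast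
    have S_inner: "inner2 m v (S n) = (\<Sum>k<n. inner2 m v (T (h * real k) \<eta>))" if "v \<in> L2 m" for v n
      unfolding S_def using inner2_sum_right[OF that, of "\<lambda>k. T (h * real k) \<eta>"] TL by blast
    have telescope: "B (S n) v = inner2 m (\<lambda>x. \<eta> x - T (h * real n) \<eta> x) v" if v: "v \<in> L2 m" for n v
    proof (induction n)
      case 0
      have "B (S 0) v = 0" unfolding S_def using form_zero_left[OF Bform v] by simp
      then show ?case using \<eta> v by (simp add: inner2_diff_left T_L2 inner2_T_0)
    next
      case (Suc n)
      have "inner2 m (T h (T (h * real n) \<eta>)) v = inner2 m (T (h * real (Suc n)) \<eta>) v"
      proof (rule form_AE_eq[OF inner2_form])
        have "AE x in m. T (h + h * real n) \<eta> x = T h (T (h * real n) \<eta>) x"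
          using h \<eta> by (intro T_semigroup) auto
        then show "AE x in m. T (h * real (Suc n)) \<eta> x = T h (T (h * real n) \<eta>) x"
          by (simp add: algebra_simps)
      qed (use TL v h \<eta> in \<open>auto intro!: L2_measurable T_L2\<close>)
      then have "B (T (h * real n) \<eta>) v
          = inner2 m (T (h * real n) \<eta>) v - inner2 m (T (h * real (Suc n)) \<eta>) v"
        unfolding B_def using TL v h0 \<eta> by (subst inner2_diff_left) (auto intro!: T_L2)
      moreover have "B (S (Suc n)) v = B (S n) v + B (T (h * real n) \<eta>) v"
        using form_add_left[OF Bform SL[of n] TL[of n] v] by (simp add: S_def)
      ultimately show ?case
        using Suc \<eta> TL[of n] TL[of "Suc n"] v by (simp add: inner2_diff_left)
    qed
    have \<phi>0: "0 \<le> \<phi> k" for k unfolding \<phi>_def using h \<eta> by (intro inner2_T_nonneg) auto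
    have \<phi>_sum: "h * (\<Sum>k<n. \<phi> k) \<le> h * inner2 m \<eta> \<eta> + \<Phi>" for n
    proof -
      have "(\<Sum>k<n. \<phi> k) \<le> (\<Sum>k<Suc n. \<phi> k)" using \<phi>0 by simp
      also have "\<dots> = \<phi> 0 + (\<Sum>k<n. \<phi> (Suc k))" by (rule sum.lessThan_Suc_shift)
      finally have "h * (\<Sum>k<n. \<phi> k) \<le> h * (\<phi> 0 + (\<Sum>k<n. \<phi> (Suc k)))"
        using h0 by (intro mult_left_mono)
      also have "\<dots> \<le> h * \<phi> 0 + \<Phi>" using bound[OF h, of n] by (simp add: \<phi>_def algebra_simps)
      finally show ?thesis using \<eta> by (simp add: \<phi>_def inner2_T_0)
    qed
    have "summable \<phi>"
    proof (rule summableI_nonneg_bounded)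
      show "(\<Sum>k<n. \<phi> k) \<le> (h * inner2 m \<eta> \<eta> + \<Phi>) / h" for n
        using \<phi>_sum[of n] h by (simp add: pos_le_divide_eq mult.commute)
    qed (rule \<phi>0)
    then have "\<phi> \<longlonglongrightarrow> 0" by (rule summable_LIMSEQ_zero)
    then have "(\<lambda>n. \<phi> (2 * n)) \<longlonglongrightarrow> 0"
      by (rule filterlim_compose) (simp add: filterlim_subseq strict_mono_def)
    then have "(\<lambda>n. sqrt (\<phi> (2 * n) * inner2 m w w)) \<longlonglongrightarrow> sqrt (0 * inner2 m w w)"
      by (intro tendsto_intros)
    then have lim0: "(\<lambda>n. sqrt (\<phi> (2 * n) * inner2 m w w)) \<longlonglongrightarrow> 0" by simp
    have "(\<lambda>n. inner2 m (T (h * real n) \<eta>) w) \<longlonglongrightarrow> 0"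
    proof (rule Lim_null_comparison[OF _ lim0], intro always_eventually allI)
      fix n
      have "(inner2 m (T (h * real n) \<eta>) w)\<^sup>2
          \<le> inner2 m (T (h * real n) \<eta>) (T (h * real n) \<eta>) * inner2 m w w"
        by (rule inner2_cauchy_schwarz[OF TL wL])
      also have "inner2 m (T (h * real n) \<eta>) (T (h * real n) \<eta>) = \<phi> (2 * n)"
        using inner2_T_semigroup[of "h * real n" "h * real n" \<eta> \<eta>] h \<eta>
        by (simp add: \<phi>_def algebra_simps)
      finally show "norm (inner2 m (T (h * real n) \<eta>) w) \<le> sqrt (\<phi> (2 * n) * inner2 m w w)"
        by (simp add: real_le_rsqrt abs_le_square_iff real_sqrt_abs[symmetric] del: real_sqrt_abs)
    qed
    then have "(\<lambda>n. (inner2 m \<eta> w - inner2 m (T (h * real n) \<eta>) w)\<^sup>2) \<longlonglongrightarrow> (inner2 m \<eta> w - 0)\<^sup>2"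
      by (intro tendsto_intros)
    then have lim: "(\<lambda>n. (inner2 m \<eta> w - inner2 m (T (h * real n) \<eta>) w)\<^sup>2) \<longlonglongrightarrow> (inner2 m \<eta> w)\<^sup>2"
      by simp
    show ?thesis
    proof (rule LIMSEQ_le_const2[OF lim], intro exI[of _ 0] allI impI)
      fix n
      have BS: "B (S n) (S n) \<le> (\<Sum>k<n. \<phi> k)"
      proof -
        have "B (S n) (S n) = inner2 m \<eta> (S n) - inner2 m (T (h * real n) \<eta>) (S n)"
          using telescope[OF SL] \<eta> TL SL by (simp add: inner2_diff_left)
        moreover have "inner2 m \<eta> (S n) = (\<Sum>k<n. \<phi> k)"
          unfolding S_inner[OF \<eta>] \<phi>_def by (simp add: inner2_commute[OF \<eta> TL])
        moreover have "inner2 m (T (h * real n) \<eta>) (S n) \<ge> 0"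
          unfolding S_inner[OF TL]
        proof (rule sum_nonneg)
          fix k
          show "0 \<le> inner2 m (T (h * real n) \<eta>) (T (h * real k) \<eta>)"
            using inner2_T_semigroup[of "h * real k" "h * real n" \<eta> \<eta>] h \<eta>
              inner2_T_nonneg[of "h * real k + h * real n" \<eta>] by simp
        qed
        ultimately show ?thesis by simp
      qed
      have "(inner2 m \<eta> w - inner2 m (T (h * real n) \<eta>) w)\<^sup>2 = (B (S n) w)\<^sup>2"
        unfolding telescope[OF wL] using \<eta> TL wL by (simp add: inner2_diff_left)
      also have "\<dots> \<le> B (S n) (S n) * B w w" by (rule form_cauchy_schwarz[OF Bform SL wL])
      also have "\<dots> \<le> (\<Sum>k<n. \<phi> k) * B w w"
        using BS form_nonneg[OF Bform wL] by (rule mult_right_mono)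
      also have "\<dots> = (h * (\<Sum>k<n. \<phi> k)) * (B w w / h)" using h by simp
      also have "\<dots> \<le> (h * inner2 m \<eta> \<eta> + \<Phi>) * (B w w / h)"
        using \<phi>_sum form_nonneg[OF Bform wL] h by (intro mult_right_mono) auto
      finally show "(inner2 m \<eta> w - inner2 m (T (h * real n) \<eta>) w)\<^sup>2
          \<le> (h * inner2 m \<eta> \<eta> + \<Phi>) * (inner2 m (\<lambda>x. w x - T h w x) w / h)"
        by (simp add: B_def)
    qed
  qed
  have "((\<lambda>h. (h * inner2 m \<eta> \<eta> + \<Phi>) * (inner2 m (\<lambda>x. w x - T h w x) w / h))
      \<longlongrightarrow> (0 * inner2 m \<eta> \<eta> + \<Phi>) * E w w) (at_right 0)"
    by (intro tendsto_intros E_limit w)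
  then have "((\<lambda>h. (h * inner2 m \<eta> \<eta> + \<Phi>) * (inner2 m (\<lambda>x. w x - T h w x) w / h))
      \<longlongrightarrow> \<Phi> * E w w) (at_right 0)" by simp
  then show ?thesis
    by (rule tendsto_lowerbound) (use step eventually_at_right_less[of "0::real"] in \<open>auto elim: eventually_mono\<close>)
qed

lemma T_L1_comparison:
  assumes s: "s \<ge> 0" and a: "a \<in> L2 m" "integrable m a" and h: "h \<in> L2 m" "integrable m h"
    and p: "integrable m p"
  shows "(\<integral>x. \<bar>T s a x - p x\<bar> \<partial>m) \<le> (\<integral>x. \<bar>a x - h x\<bar> \<partial>m) + (\<integral>x. \<bar>T s h x - p x\<bar> \<partial>m)"
proof -
  note I = T_L1_contraction(1)[OF s a] T_L1_contraction(1)[OF s h]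
  have "(\<integral>x. \<bar>T s a x - p x\<bar> \<partial>m) = (\<integral>x. \<bar>(T s a x - T s h x) + (T s h x - p x)\<bar> \<partial>m)" by simp
  also have "\<dots> \<le> (\<integral>x. \<bar>T s a x - T s h x\<bar> \<partial>m) + (\<integral>x. \<bar>T s h x - p x\<bar> \<partial>m)"
    using I p by (intro integral_abs_triangle) auto
  also have "(\<integral>x. \<bar>T s a x - T s h x\<bar> \<partial>m) = (\<integral>x. \<bar>T s (\<lambda>z. a z - h z) x\<bar> \<partial>m)"
    using T_diff[OF s a(1) h(1)] I L2_measurable[OF T_L2[OF s L2_diff[OF a(1) h(1)]]]
    by (intro integral_cong_AE) (auto elim: eventually_mono)
  also have "\<dots> \<le> (\<integral>x. \<bar>a x - h x\<bar> \<partial>m)"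
    using a h by (intro T_L1_contraction(2)[OF s] L2_diff) auto
  finally show ?thesis by simp
qed

text \<open>Positive parts of functions approximating \<open>f \<ge> 0\<close> approximate \<open>f\<close> as well.\<close>

lemma L1_semigroup_value_nonneg:
  assumes s: "s \<ge> 0" and f: "integrable m f" "AE x in m. 0 \<le> f x"
    and p: "L1_semigroup_value m T s f p"
  shows "AE x in m. 0 \<le> p x"
proof -
  obtain h where h: "\<And>n. h n \<in> L2 m" "\<And>n. integrable m (h n)"
    and hf: "(\<lambda>n. \<integral>x. \<bar>h n x - f x\<bar> \<partial>m) \<longlonglongrightarrow> 0"
    and hp: "(\<lambda>n. \<integral>x. \<bar>T s (h n) x - p x\<bar> \<partial>m) \<longlonglongrightarrow> 0"
    and pI: "integrable m p"
    using p unfolding L1_semigroup_value_def by blast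
  define k where "k n x = max 0 (h n x)" for n x
  have k: "k n \<in> L2 m" "integrable m (k n)" for n
  proof -
    show "k n \<in> L2 m"
      by (rule L2_bound[OF h(1)[of n], of _ 1]) (use L2_measurable[OF h(1)[of n]] in \<open>auto simp: k_def[abs_def]\<close>)
    show "integrable m (k n)" unfolding k_def[abs_def] using h(2) by (intro integrable_max) auto
  qed
  have Tk: "integrable m (T s (k n))" for n
    using T_L1_contraction(1)[OF s] k by blast
  have lim: "(\<lambda>n. \<integral>x. \<bar>T s (k n) x - p x\<bar> \<partial>m) \<longlonglongrightarrow> 0"
  proof (rule tendsto_sandwich[OF _ _ tendsto_const])
    show "(\<lambda>n. (\<integral>x. \<bar>h n x - f x\<bar> \<partial>m) + (\<integral>x. \<bar>T s (h n) x - p x\<bar> \<partial>m)) \<longlonglongrightarrow> 0"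
      using tendsto_add[OF hf hp] by simp
    show "\<forall>\<^sub>F n in sequentially. (\<integral>x. \<bar>T s (k n) x - p x\<bar> \<partial>m)
        \<le> (\<integral>x. \<bar>h n x - f x\<bar> \<partial>m) + (\<integral>x. \<bar>T s (h n) x - p x\<bar> \<partial>m)"
    proof (intro always_eventually allI)
      fix n
      have "(\<integral>x. \<bar>k n x - h n x\<bar> \<partial>m) \<le> (\<integral>x. \<bar>h n x - f x\<bar> \<partial>m)"
      proof (rule integral_mono_AE)
        show "AE x in m. \<bar>k n x - h n x\<bar> \<le> \<bar>h n x - f x\<bar>"
          using f(2) by eventually_elim (auto simp: k_def max_def)
      qed (use k h f in auto)
      then show "(\<integral>x. \<bar>T s (k n) x - p x\<bar> \<partial>m)
        \<le> (\<integral>x. \<bar>h n x - f x\<bar> \<partial>m) + (\<integral>x. \<bar>T s (h n) x - p x\<bar> \<partial>m)" using T_L1_comparison[OF s k[of n] h[of n] pI] by linarith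
    qed
  qed (auto intro!: always_eventually)
  define v where "v x = (if p x < 0 then 1 else 0 :: real)" for x
  have vm: "v \<in> borel_measurable m" unfolding v_def[abs_def] using pI by measurable
  have lim2: "(\<lambda>n. \<integral>x. T s (k n) x * v x \<partial>m) \<longlonglongrightarrow> (\<integral>x. p x * v x \<partial>m)"
    by (rule L1_limit_bounded_multiplier[OF Tk pI lim vm]) (auto simp: v_def)
  have "0 \<le> (\<integral>x. p x * v x \<partial>m)"
  proof (rule LIMSEQ_le_const[OF lim2], intro exI allI impI)
    fix n
    have "AE x in m. 0 \<le> T s (k n) x"
      by (rule T_nonneg[OF s k(1)]) (auto simp: k_def)
    then show "0 \<le> (\<integral>x. T s (k n) x * v x \<partial>m)"
      by (intro integral_nonneg_AE) (auto simp: v_def elim: eventually_mono)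
  qed
  moreover have int: "integrable m (\<lambda>x. - (p x * v x))"
    by (rule Bochner_Integration.integrable_bound[OF pI]) (use vm pI in \<open>auto simp: v_def\<close>)
  moreover have nn: "0 \<le> - (p x * v x)" for x by (auto simp: v_def)
  moreover have "(\<integral>x. - (p x * v x) \<partial>m) = - (\<integral>x. p x * v x \<partial>m)" by simp
  moreover have "0 \<le> (\<integral>x. - (p x * v x) \<partial>m)" using nn by (intro integral_nonneg_AE AE_I2)
  ultimately have "(\<integral>x. - (p x * v x) \<partial>m) = 0" by linarith
  then have "AE x in m. - (p x * v x) = 0"
    using integral_nonneg_eq_0_iff_AE[OF int] nn by auto
  then show ?thesis by eventually_elim (auto simp: v_def split: if_splits)
qed

text \<open>In inner products, \<open>(T\<^sub>t \<eta>, \<eta>) \<le> (T\<^sub>t \<eta>, T\<^sub>s f) = (\<eta>, T\<^sub>s\<^sub>+\<^sub>t f)\<close>. The extensions of \<open>T\<^sub>s\<close> and \<open>T\<^sub>s\<^sub>+\<^sub>t\<close> to \<open>f\<close>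
  are limits along two possibly different sequences; by the contraction property in \<open>L\<^sup>1\<close> the first
  sequence serves for both.\<close>

lemma L1_semigroup_value_pairing:
  assumes st: "s \<ge> 0" "t \<ge> 0" and f: "integrable m f" "AE x in m. 0 \<le> f x"
    and p: "L1_semigroup_value m T s f p" and q: "L1_semigroup_value m T (s + t) f q"
    and \<eta>: "\<eta> \<in> L2 m" "AE x in m. 0 \<le> \<eta> x \<and> \<eta> x \<le> 1 \<and> \<eta> x \<le> p x"
  shows "inner2 m (T t \<eta>) \<eta> \<le> (\<integral>x. q x * \<eta> x \<partial>m)"
proof -
  obtain h where h: "\<And>n. h n \<in> L2 m" "\<And>n. integrable m (h n)"
    and hf: "(\<lambda>n. \<integral>x. \<bar>h n x - f x\<bar> \<partial>m) \<longlonglongrightarrow> 0"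
    and hp: "(\<lambda>n. \<integral>x. \<bar>T s (h n) x - p x\<bar> \<partial>m) \<longlonglongrightarrow> 0"
    and pI: "integrable m p"
    using p unfolding L1_semigroup_value_def by blast
  obtain k where k: "\<And>n. k n \<in> L2 m" "\<And>n. integrable m (k n)"
    and kf: "(\<lambda>n. \<integral>x. \<bar>k n x - f x\<bar> \<partial>m) \<longlonglongrightarrow> 0"
    and kq: "(\<lambda>n. \<integral>x. \<bar>T (s + t) (k n) x - q x\<bar> \<partial>m) \<longlonglongrightarrow> 0"
    and qI: "integrable m q"
    using q unfolding L1_semigroup_value_def by blast
  have s_t: "s + t \<ge> 0" using st by simp
  have Th: "integrable m (T (s + t) (h n))" and Tsh: "integrable m (T s (h n))" for n
    using T_L1_contraction(1)[OF s_t] T_L1_contraction(1)[OF st(1)] h by blast+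
  have lim: "(\<lambda>n. \<integral>x. \<bar>T (s + t) (h n) x - q x\<bar> \<partial>m) \<longlonglongrightarrow> 0"
  proof (rule tendsto_sandwich[OF _ _ tendsto_const])
    show "(\<lambda>n. ((\<integral>x. \<bar>h n x - f x\<bar> \<partial>m) + (\<integral>x. \<bar>k n x - f x\<bar> \<partial>m)) + (\<integral>x. \<bar>T (s + t) (k n) x - q x\<bar> \<partial>m)) \<longlonglongrightarrow> 0"
      using tendsto_add[OF tendsto_add[OF hf kf] kq] by simp
    show "\<forall>\<^sub>F n in sequentially. (\<integral>x. \<bar>T (s + t) (h n) x - q x\<bar> \<partial>m)
        \<le> ((\<integral>x. \<bar>h n x - f x\<bar> \<partial>m) + (\<integral>x. \<bar>k n x - f x\<bar> \<partial>m)) + (\<integral>x. \<bar>T (s + t) (k n) x - q x\<bar> \<partial>m)"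
    proof (intro always_eventually allI)
      fix n
      have "(\<integral>x. \<bar>h n x - k n x\<bar> \<partial>m) = (\<integral>x. \<bar>(h n x - f x) + (f x - k n x)\<bar> \<partial>m)" by simp
      also have "\<dots> \<le> (\<integral>x. \<bar>h n x - f x\<bar> \<partial>m) + (\<integral>x. \<bar>f x - k n x\<bar> \<partial>m)"
        using h k f by (intro integral_abs_triangle) auto
      finally show "(\<integral>x. \<bar>T (s + t) (h n) x - q x\<bar> \<partial>m)
        \<le> ((\<integral>x. \<bar>h n x - f x\<bar> \<partial>m) + (\<integral>x. \<bar>k n x - f x\<bar> \<partial>m)) + (\<integral>x. \<bar>T (s + t) (k n) x - q x\<bar> \<partial>m)"
        using T_L1_comparison[OF s_t h[of n] k[of n] qI] by (simp add: abs_minus_commute)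
    qed
  qed (auto intro!: always_eventually)
  have T\<eta>: "AE x in m. 0 \<le> T t \<eta> x \<and> T t \<eta> x \<le> 1"
    using \<eta>(2) by (intro T_markov[OF st(2) \<eta>(1)]) (auto elim: eventually_mono)
  have TL: "T t \<eta> \<in> L2 m" using st \<eta> by (intro T_L2)
  have "(\<lambda>n. \<integral>x. T (s + t) (h n) x * \<eta> x \<partial>m) \<longlonglongrightarrow> (\<integral>x. q x * \<eta> x \<partial>m)"
    using \<eta> by (intro L1_limit_bounded_multiplier[OF Th qI lim] L2_measurable) (auto elim: eventually_mono)
  moreover have "(\<lambda>n. \<integral>x. T s (h n) x * T t \<eta> x \<partial>m) \<longlonglongrightarrow> (\<integral>x. p x * T t \<eta> x \<partial>m)"
    using T\<eta> TL by (intro L1_limit_bounded_multiplier[OF Tsh pI hp] L2_measurable) (auto elim: eventually_mono)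
  moreover have "(\<integral>x. T (s + t) (h n) x * \<eta> x \<partial>m) = (\<integral>x. T s (h n) x * T t \<eta> x \<partial>m)" for n
    using inner2_T_semigroup[OF st(2,1) h(1) \<eta>(1)] by (simp add: inner2_def add.commute)
  ultimately have eq: "(\<integral>x. q x * \<eta> x \<partial>m) = (\<integral>x. p x * T t \<eta> x \<partial>m)"
    by (auto intro: LIMSEQ_unique)
  have "inner2 m (T t \<eta>) \<eta> \<le> (\<integral>x. p x * T t \<eta> x \<partial>m)"
    unfolding inner2_def
  proof (rule integral_mono_AE)
    show "integrable m (\<lambda>x. T t \<eta> x * \<eta> x)" using TL \<eta> by (intro L2_mult_integrable)
    show "integrable m (\<lambda>x. p x * T t \<eta> x)"
    proof (rule Bochner_Integration.integrable_bound[OF pI])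
      show "AE x in m. norm (p x * T t \<eta> x) \<le> norm (p x)"
        using T\<eta> by eventually_elim (simp add: abs_mult mult_left_le)
    qed (use pI L2_measurable[OF TL] in auto)
    show "AE x in m. T t \<eta> x * \<eta> x \<le> p x * T t \<eta> x"
      using T\<eta> \<eta>(2) by eventually_elim (simp add: mult.commute mult_right_mono)
  qed
  then show ?thesis by (simp add: eq)
qed

text \<open>The argument uses \<open>f' = T\<^sub>s f\<close> in place of \<open>f\<close>, whose potential is at most \<open>Gf\<close>. If \<open>0 \<le> \<eta> \<le> f'\<close> and
  \<open>\<eta>\<close> vanishes where \<open>Gf > N\<close>, then \<open>(\<eta>, G\<eta>) \<le> \<integral> \<eta> Gf \<le> N \<integral> \<eta> < \<infinity>\<close>. By the preceding bound
  \<open>(\<eta>, w n)\<close> tends to 0, hence \<open>\<integral> \<eta> = 0\<close>. So \<open>T\<^sub>s f\<close> vanishes where \<open>Gf\<close> is finite, for every \<open>s\<close>,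
  and by Fubini's theorem \<open>Gf\<close> vanishes where it is finite.\<close>

lemma recurrent_if_energy_vanishes:
  assumes sf: "sigma_finite_measure m"
    and w: "\<And>n. w n \<in> F" "\<And>n x. 0 \<le> w n x \<and> w n x \<le> 1" "\<And>x. (\<lambda>n. w n x) \<longlonglongrightarrow> 1"
    and Ew: "(\<lambda>n. E (w n) (w n)) \<longlonglongrightarrow> 0"
  shows "recurrent m T"
  unfolding recurrent_def
proof (intro allI impI, elim conjE)
  fix f g assume f: "integrable m f" "AE x in m. 0 \<le> f x" and "green_version m T f g"
  then obtain p where p: "(\<lambda>(t, x). p t x) \<in> borel_measurable (lborel \<Otimes>\<^sub>M m)"
    and pT: "\<And>t. t \<ge> 0 \<Longrightarrow> L1_semigroup_value m T t f (p t)"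
    and g: "\<And>x. g x = (\<integral>\<^sup>+t\<in>{0..}. ennreal (p t x) \<partial>lborel)"
    unfolding green_version_def by blast
  interpret sigma_finite_measure m by (rule sf)
  interpret pair_sigma_finite lborel m ..
  note [measurable] = p
  have p_meas [measurable]: "(\<lambda>x. p (fst x) (snd x)) \<in> borel_measurable (lborel \<Otimes>\<^sub>M m)"
    using p by (simp add: case_prod_unfold)
  have p_swap [measurable]: "(\<lambda>x. p (snd x) (fst x)) \<in> borel_measurable (m \<Otimes>\<^sub>M lborel)"
    using measurable_compose[OF measurable_pair_swap' p_meas] by (simp add: case_prod_unfold)
  have g_eq: "g = (\<lambda>x. \<integral>\<^sup>+t. ennreal (p t x) * indicator {0..} t \<partial>lborel)"
    using g by auto
  have g_meas [measurable]: "g \<in> borel_measurable m"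
    unfolding g_eq by measurable
  have pI: "integrable m (p t)" if "t \<ge> 0" for t
    using pT[OF that] by (simp add: L1_semigroup_value_def)
  have p0: "AE x in m. 0 \<le> p t x" if "t \<ge> 0" for t
    using L1_semigroup_value_nonneg[OF that f pT[OF that]] .
  have vanish: "AE x in m. g x \<le> ennreal N \<longrightarrow> p s x = 0" if s: "s \<ge> 0" and N: "N \<ge> 0" for s N
  proof -
    note [measurable] = borel_measurable_integrable[OF pI[OF s]]
    define \<eta> where "\<eta> x = (if g x \<le> ennreal N then clip (p s x) else 0)" for x
    have \<eta>_meas [measurable]: "\<eta> \<in> borel_measurable m"
      unfolding \<eta>_def[abs_def] by measurable
    have \<eta>01: "0 \<le> \<eta> x" "\<eta> x \<le> 1" "\<eta> x \<le> \<bar>p s x\<bar>" for x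
      using clip_bounds[of "p s x"] by (auto simp: \<eta>_def)
    have \<eta>I: "integrable m \<eta>"
      by (rule Bochner_Integration.integrable_bound[OF pI[OF s]]) (use \<eta>01 in auto)
    have "integrable m (\<lambda>x. (\<eta> x)\<^sup>2)"
    proof (rule Bochner_Integration.integrable_bound[OF \<eta>I])
      show "AE x in m. norm ((\<eta> x)\<^sup>2) \<le> norm (\<eta> x)"
        using \<eta>01 by (intro AE_I2) (simp add: power2_eq_square mult_left_le)
    qed measurable
    then have \<eta>L: "\<eta> \<in> L2 m" by (simp add: L2_def)
    have \<eta>p: "AE x in m. 0 \<le> \<eta> x \<and> \<eta> x \<le> 1 \<and> \<eta> x \<le> p s x"
      using p0[OF s]
    proof eventually_elim
      case (elim x)
      then show ?case using \<eta>01[of x] by simp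
    qed
    \<comment> \<open>a measurable upper bound of the function \<open>t \<mapsto> (T\<^sub>t \<eta>, \<eta>)\<close> on the half-line\<close>
    define \<Psi> where "\<Psi> t = (\<integral>\<^sup>+x. ennreal (p (s + t) x) * ennreal (\<eta> x) \<partial>m)" for t
    have shift [measurable]: "(\<lambda>x. p (s + fst x) (snd x)) \<in> borel_measurable (lborel \<Otimes>\<^sub>M m)"
    proof -
      have "(\<lambda>x. (s + fst x, snd x)) \<in> lborel \<Otimes>\<^sub>M m \<rightarrow>\<^sub>M lborel \<Otimes>\<^sub>M m" by measurable
      from measurable_compose[OF this p_meas] show ?thesis by simp
    qed
    have \<Psi>_meas [measurable]: "\<Psi> \<in> borel_measurable lborel"
      unfolding \<Psi>_def by measurable
    have \<phi>_le: "ennreal (inner2 m (T t \<eta>) \<eta>) \<le> \<Psi> t" if t: "t \<ge> 0" for t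
    proof -
      have st: "s + t \<ge> 0" using s t by simp
      have int: "integrable m (\<lambda>x. p (s + t) x * \<eta> x)"
        by (rule Bochner_Integration.integrable_bound[OF pI[OF st]])
          (use \<eta>01 borel_measurable_integrable[OF pI[OF st]] in \<open>auto simp: abs_mult mult_left_le\<close>)
      have nn: "AE x in m. 0 \<le> p (s + t) x * \<eta> x"
        using p0[OF st] by eventually_elim (simp add: \<eta>01)
      have "ennreal (inner2 m (T t \<eta>) \<eta>) \<le> ennreal (\<integral>x. p (s + t) x * \<eta> x \<partial>m)"
        by (intro ennreal_leI L1_semigroup_value_pairing[OF s t f pT[OF s] pT[OF st] \<eta>L \<eta>p])
      also have "\<dots> = (\<integral>\<^sup>+x. ennreal (p (s + t) x * \<eta> x) \<partial>m)"
        by (rule nn_integral_eq_integral[OF int nn, symmetric])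
      also have "\<dots> = \<Psi> t"
        unfolding \<Psi>_def by (intro nn_integral_cong) (simp add: ennreal_mult'' \<eta>01)
      finally show ?thesis .
    qed
    have tail: "(\<integral>\<^sup>+t. ennreal (p (s + t) x) * indicator {0..} t \<partial>lborel) \<le> g x"
      if "x \<in> space m" for x
    proof -
      have [measurable]: "(\<lambda>t. p t x) \<in> borel_measurable lborel"
        using measurable_compose[OF measurable_Pair2'[OF that] p_meas] by simp
      have "g x = (\<integral>\<^sup>+t. ennreal (p (s + t) x) * indicator {0..} (s + t) \<partial>lborel)"
        unfolding g_eq using nn_integral_real_affine[of "\<lambda>t. ennreal (p t x) * indicator {0..} t" 1 s]
        by simp
      also have "\<dots> \<ge> (\<integral>\<^sup>+t. ennreal (p (s + t) x) * indicator {0..} t \<partial>lborel)"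
        using s by (intro nn_integral_mono mult_left_mono) (auto simp: indicator_def)
      finally show ?thesis .
    qed
    define \<Phi> where "\<Phi> = N * (\<integral>x. \<eta> x \<partial>m)"
    have \<Phi>0: "\<Phi> \<ge> 0" unfolding \<Phi>_def using N \<eta>01 by (intro mult_nonneg_nonneg integral_nonneg_AE) auto
    have total: "(\<integral>\<^sup>+t. \<Psi> t * indicator {0..} t \<partial>lborel) \<le> ennreal \<Phi>"
    proof -
      have "(\<integral>\<^sup>+t. \<Psi> t * indicator {0..} t \<partial>lborel)
          = (\<integral>\<^sup>+t. \<integral>\<^sup>+x. ennreal (p (s + t) x) * ennreal (\<eta> x) * indicator {0..} t \<partial>m \<partial>lborel)"
        unfolding \<Psi>_def
      proof (rule nn_integral_cong)
        fix t :: real assume "t \<in> space lborel"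
        then have [measurable]: "(\<lambda>x. p (s + t) x) \<in> borel_measurable m"
          using measurable_compose[OF measurable_Pair1' shift] by simp
        show "(\<integral>\<^sup>+x. ennreal (p (s + t) x) * ennreal (\<eta> x) \<partial>m) * indicator {0..} t
          = (\<integral>\<^sup>+x. ennreal (p (s + t) x) * ennreal (\<eta> x) * indicator {0..} t \<partial>m)"
          by (rule nn_integral_multc[symmetric]) measurable
      qed
      also have "\<dots> = (\<integral>\<^sup>+x. \<integral>\<^sup>+t. ennreal (p (s + t) x) * ennreal (\<eta> x) * indicator {0..} t \<partial>lborel \<partial>m)"
        by (rule Fubini'[symmetric]) (use shift in \<open>simp add: case_prod_unfold, measurable\<close>)
      also have "\<dots> \<le> (\<integral>\<^sup>+x. ennreal N * ennreal (\<eta> x) \<partial>m)"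
      proof (rule nn_integral_mono)
        fix x assume x: "x \<in> space m"
        have [measurable]: "(\<lambda>t. p (s + t) x) \<in> borel_measurable lborel"
          using measurable_compose[OF measurable_Pair2'[OF x] shift] by simp
        have "(\<integral>\<^sup>+t. ennreal (p (s + t) x) * ennreal (\<eta> x) * indicator {0..} t \<partial>lborel)
            = (\<integral>\<^sup>+t. ennreal (p (s + t) x) * indicator {0..} t \<partial>lborel) * ennreal (\<eta> x)"
          by (subst nn_integral_multc[symmetric]) (auto simp: mult_ac)
        also have "\<dots> \<le> g x * ennreal (\<eta> x)" using tail[OF x] by (rule mult_right_mono) simp
        also have "\<dots> \<le> ennreal N * ennreal (\<eta> x)"
          by (cases "g x \<le> ennreal N") (auto simp: \<eta>_def intro: mult_right_mono)
        finally show "(\<integral>\<^sup>+t. ennreal (p (s + t) x) * ennreal (\<eta> x) * indicator {0..} t \<partial>lborel)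
            \<le> ennreal N * ennreal (\<eta> x)" .
      qed
      also have "\<dots> = ennreal N * (\<integral>\<^sup>+x. ennreal (\<eta> x) \<partial>m)" by (rule nn_integral_cmult) measurable
      also have "\<dots> = ennreal \<Phi>"
        using \<eta>01 N by (subst nn_integral_eq_integral[OF \<eta>I]) (auto simp: \<Phi>_def ennreal_mult')
      finally show ?thesis .
    qed
    have riemann: "h * (\<Sum>k<n. inner2 m (T (h * real (Suc k)) \<eta>) \<eta>) \<le> \<Phi>" if h: "h > 0" for h n
    proof -
      let ?a = "\<lambda>k. inner2 m (T (h * real (Suc k)) \<eta>) \<eta>"
      have a0: "0 \<le> ?a k" for k using h \<eta>L by (intro inner2_T_nonneg) auto
      have "ennreal (h * (\<Sum>k<n. ?a k)) \<le> (\<integral>\<^sup>+t. \<Psi> t * indicator {0<..h * real n} t \<partial>lborel)"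
      proof (induction n)
        case (Suc n)
        let ?I = "{h * real n<..h * real (Suc n)}"
        have "ennreal (h * ?a n) = ennreal (?a n) * emeasure lborel ?I"
          using h a0[of n] by (simp add: ennreal_mult' mult.commute algebra_simps)
        also have "\<dots> = (\<integral>\<^sup>+t. ennreal (?a n) * indicator ?I t \<partial>lborel)"
          by (rule nn_integral_cmult_indicator[symmetric]) simp
        also have "\<dots> \<le> (\<integral>\<^sup>+t. \<Psi> t * indicator ?I t \<partial>lborel)"
        proof (rule nn_integral_mono)
          fix t :: real
          show "ennreal (?a n) * indicator ?I t \<le> \<Psi> t * indicator ?I t"
          proof (cases "t \<in> ?I")
            case True
            then have t: "0 \<le> t" "t \<le> h * real (Suc n)"
              using h by (auto intro: order_trans[of 0 "h * real n"])
            have "ennreal (?a n) \<le> ennreal (inner2 m (T t \<eta>) \<eta>)"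
              by (intro ennreal_leI inner2_T_antimono t \<eta>L)
            also have "\<dots> \<le> \<Psi> t" by (rule \<phi>_le[OF t(1)])
            finally show ?thesis by (rule mult_right_mono) simp
          qed simp
        qed
        finally have new: "ennreal (h * ?a n) \<le> (\<integral>\<^sup>+t. \<Psi> t * indicator ?I t \<partial>lborel)" .
        have Un: "{0<..h * real (Suc n)} = {0<..h * real n} \<union> ?I"
          using h by (intro ivl_disj_un_two(6)[symmetric]) auto
        have "ennreal (h * (\<Sum>k<Suc n. ?a k)) = ennreal (h * (\<Sum>k<n. ?a k)) + ennreal (h * ?a n)"
          using a0 h by (subst ennreal_plus[symmetric]) (auto intro!: mult_nonneg_nonneg sum_nonneg simp: algebra_simps)
        also have "\<dots> \<le> (\<integral>\<^sup>+t. \<Psi> t * indicator {0<..h * real n} t \<partial>lborel) + (\<integral>\<^sup>+t. \<Psi> t * indicator ?I t \<partial>lborel)"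
          using Suc new by (rule add_mono)
        also have "\<dots> = (\<integral>\<^sup>+t. \<Psi> t * indicator {0<..h * real (Suc n)} t \<partial>lborel)"
          unfolding Un by (rule nn_integral_disjoint_pair[symmetric]) auto
        finally show ?case .
      qed simp
      also have "\<dots> \<le> (\<integral>\<^sup>+t. \<Psi> t * indicator {0..} t \<partial>lborel)"
        by (intro nn_integral_mono mult_left_mono) (auto simp: indicator_def)
      also note total
      finally show ?thesis using \<Phi>0 by (simp add: ennreal_le_iff)
    qed
    have lim_w: "(\<lambda>n. inner2 m \<eta> (w n)) \<longlonglongrightarrow> (\<integral>x. \<eta> x \<partial>m)"
      unfolding inner2_def
    proof (rule integral_dominated_convergence[where w = \<eta>])
      show "(\<lambda>x. \<eta> x * w n x) \<in> borel_measurable m" for n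
        using L2_measurable[OF F_L2[OF w(1)]] by measurable
      show "AE x in m. (\<lambda>n. \<eta> x * w n x) \<longlonglongrightarrow> \<eta> x"
        using tendsto_mult[OF tendsto_const w(3)] by (intro AE_I2) fastforce
      show "AE x in m. norm (\<eta> x * w n x) \<le> \<eta> x" for n
        using w(2)[of n] \<eta>01 by (intro AE_I2) (simp add: abs_mult mult_left_le)
    qed (use \<eta>I in auto)
    have "(\<integral>x. \<eta> x \<partial>m)\<^sup>2 \<le> \<Phi> * 0"
    proof (rule LIMSEQ_le)
      show "(\<lambda>n. (inner2 m \<eta> (w n))\<^sup>2) \<longlonglongrightarrow> (\<integral>x. \<eta> x \<partial>m)\<^sup>2" by (intro tendsto_intros lim_w)
      show "(\<lambda>n. \<Phi> * E (w n) (w n)) \<longlonglongrightarrow> \<Phi> * 0" by (intro tendsto_intros Ew)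
      show "\<exists>N. \<forall>n\<ge>N. (inner2 m \<eta> (w n))\<^sup>2 \<le> \<Phi> * E (w n) (w n)"
        using pairing_le_green_energy[OF \<eta>L w(1) riemann] by blast
    qed
    then have "(\<integral>x. \<eta> x \<partial>m) = 0" by simp
    then have "AE x in m. \<eta> x = 0"
      using integral_nonneg_eq_0_iff_AE[OF \<eta>I] \<eta>01 by auto
    with p0[OF s] show ?thesis
      by eventually_elim (auto simp: \<eta>_def clip_def min_def max_def split: if_splits)
  qed
  have vanish': "AE x in m. g x < \<infinity> \<longrightarrow> p s x = 0" if s: "s \<ge> 0" for s
  proof -
    have "AE x in m. \<forall>N::nat. g x \<le> ennreal (real N) \<longrightarrow> p s x = 0"
      unfolding AE_all_countable using vanish[OF s] by auto
    then show ?thesis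
    proof eventually_elim
      case (elim x)
      show ?case
      proof
        assume "g x < \<infinity>"
        then obtain r where r: "r \<ge> 0" "g x = ennreal r" by (cases "g x") auto
        obtain N :: nat where "r \<le> real N" using real_arch_simple by blast
        with r elim show "p s x = 0" by (auto simp: ennreal_le_iff)
      qed
    qed
  qed
  define fin where "fin x = (if g x < \<infinity> then 1 else 0 :: ennreal)" for x
  have [measurable]: "fin \<in> borel_measurable m" unfolding fin_def[abs_def] by measurable
  have "(\<integral>\<^sup>+x. fin x * g x \<partial>m)
      = (\<integral>\<^sup>+x. \<integral>\<^sup>+t. ennreal (p t x) * fin x * indicator {0..} t \<partial>lborel \<partial>m)"
  proof (rule nn_integral_cong)
    fix x assume x: "x \<in> space m"
    have [measurable]: "(\<lambda>t. p t x) \<in> borel_measurable lborel"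
      using measurable_compose[OF measurable_Pair2'[OF x] p_meas] by simp
    show "fin x * g x = (\<integral>\<^sup>+t. ennreal (p t x) * fin x * indicator {0..} t \<partial>lborel)"
      unfolding g_eq by (subst nn_integral_cmult[symmetric]) (auto simp: mult_ac)
  qed
  also have "\<dots> = (\<integral>\<^sup>+t. \<integral>\<^sup>+x. ennreal (p t x) * fin x * indicator {0..} t \<partial>m \<partial>lborel)"
    by (rule Fubini') (use p_meas in \<open>simp add: case_prod_unfold, measurable\<close>)
  also have "\<dots> = (\<integral>\<^sup>+t. 0 \<partial>(lborel :: real measure))"
  proof (rule nn_integral_cong)
    fix t :: real
    have "(\<integral>\<^sup>+x. ennreal (p t x) * fin x * indicator {0..} t \<partial>m) = (\<integral>\<^sup>+x. 0 \<partial>m)"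
    proof (cases "t \<ge> 0")
      case True
      show ?thesis
        using vanish'[OF True] by (intro nn_integral_cong_AE) (auto simp: fin_def elim: eventually_mono)
    qed (simp add: indicator_def)
    then show "(\<integral>\<^sup>+x. ennreal (p t x) * fin x * indicator {0..} t \<partial>m) = 0" by simp
  qed
  finally have "(\<integral>\<^sup>+x. fin x * g x \<partial>m) = 0" by simp
  then have "AE x in m. fin x * g x = 0" by (subst (asm) nn_integral_0_iff_AE) auto
  then show "AE x in m. g x = 0 \<or> g x = \<infinity>"
    by eventually_elim (auto simp: fin_def split: if_splits simp: less_top[symmetric])
qed

end

section \<open>Products of bounded functions of finite energy\<close>

lemma form_average:
  assumes form: "nonneg_symmetric_form m D B"
    and a: "\<And>k. a k \<in> D" "\<And>k. B (a k) (a k) \<le> C"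
  shows "(\<lambda>x. (\<Sum>k<Suc n. a k x) / real (Suc n)) \<in> D \<and>
    B (\<lambda>x. (\<Sum>k<Suc n. a k x) / real (Suc n)) (\<lambda>x. (\<Sum>k<Suc n. a k x) / real (Suc n)) \<le> C"
proof (induction n)
  case 0
  then show ?case using a by simp
next
  case (Suc n)
  define t where "t = real (Suc n) / real (Suc (Suc n))"
  have t: "0 \<le> t" "t \<le> 1" by (auto simp: t_def)
  have "(\<Sum>k<Suc (Suc n). a k x) / real (Suc (Suc n))
      = t * ((\<Sum>k<Suc n. a k x) / real (Suc n)) + (1 - t) * a (Suc n) x" for x
  proof -
    have "1 - t = 1 / real (Suc (Suc n))" by (simp add: t_def field_simps)
    moreover have "t * ((\<Sum>k<Suc n. a k x) / real (Suc n)) = (\<Sum>k<Suc n. a k x) / real (Suc (Suc n))"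
      unfolding t_def by (simp del: of_nat_Suc sum.lessThan_Suc)
    ultimately show ?thesis by (simp add: add_divide_distrib)
  qed
  then show ?case
    using Suc form_combination[OF form, of "\<lambda>x. (\<Sum>k<Suc n. a k x) / real (Suc n)" "a (Suc n)" t "1 - t"]
      form_convex[OF form, of "\<lambda>x. (\<Sum>k<Suc n. a k x) / real (Suc n)" "a (Suc n)" t C] t a
    by simp
qed

context dirichlet_space
begin

lemma form1_form: "nonneg_symmetric_form m F (form1 m E)"
proof -
  note E = form_zero[OF E_form] form_add[OF E_form] form_scale[OF E_form] form_AE_mem[OF E_form]
  show ?thesis
    unfolding nonneg_symmetric_form_def form1_def
  proof (intro conjI ballI allI impI)
    fix u v w assume u: "u \<in> F"
    show "v \<in> F" if "v \<in> borel_measurable m" "AE x in m. u x = v x"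
      using E(4)[OF u that] .
    show "E v w + inner2 m v w = E u w + inner2 m u w"
      if "v \<in> borel_measurable m" "AE x in m. u x = v x" "w \<in> F"
      using form_AE_eq[OF E_form u that] form_AE_eq[OF inner2_form F_L2[OF u] that(1,2) F_L2[OF that(3)]]
      by simp
    show "0 \<le> E u u + inner2 m u u" using form_nonneg[OF E_form u] inner2_self_nonneg[of m u] by simp
    show "(\<lambda>x. c * u x) \<in> F" for c using E(3)[OF u] .
    assume v: "v \<in> F"
    show "(\<lambda>x. u x + v x) \<in> F" using E(2)[OF u v] .
    show "E u v + inner2 m u v = E v u + inner2 m v u"
      using form_commute[OF E_form u v] inner2_commute[OF F_L2 F_L2, OF u v] by simp
    show "E (\<lambda>x. c * u x) v + inner2 m (\<lambda>x. c * u x) v = c * (E u v + inner2 m u v)" for c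
      using form_scale_left[OF E_form u v] inner2_scale_left[OF F_L2 F_L2, OF u v]
      by (simp add: distrib_left)
    show "E (\<lambda>x. u x + v x) w + inner2 m (\<lambda>x. u x + v x) w
        = E u w + inner2 m u w + (E v w + inner2 m v w)" if w: "w \<in> F"
      using form_add_left[OF E_form u v w] inner2_add_left[OF F_L2 F_L2 F_L2, OF u v w] by simp
  qed (rule E(1))
qed

text \<open>A closed form is weakly closed: convex combinations of the \<open>f n\<close> are Cauchy for \<open>form1 m E\<close>,
  and their limit in \<open>F\<close> must be \<open>g\<close>.\<close>

lemma F_bounded_limit:
  assumes f: "\<And>n. f n \<in> F" "\<And>n. form1 m E (f n) (f n) \<le> C"
    and h: "h \<in> L2 m" and \<epsilon>: "decseq \<epsilon>" "\<epsilon> \<longlonglongrightarrow> 0"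
    and close: "\<And>n x. \<bar>f n x - g x\<bar> \<le> \<epsilon> n * \<bar>h x\<bar>" and g: "g \<in> borel_measurable m"
  shows "g \<in> F"
proof -
  obtain k where k: "\<And>n. k n \<in> tail_hull f n" and cauchy: "form_cauchy (form1 m E) k"
    using tail_hull_cauchy[OF form1_form, of f C] f by metis
  have hull: "v \<in> F \<and> (\<forall>x. \<bar>v x - g x\<bar> \<le> \<epsilon> n * \<bar>h x\<bar>)" if "v \<in> tail_hull f n" for v n
    using that
  proof (induction rule: tail_hull.induct)
    case (base j)
    have "\<bar>f j x - g x\<bar> \<le> \<epsilon> n * \<bar>h x\<bar>" for x
      using close[of j x] mult_right_mono[OF decseqD[OF \<epsilon>(1) base], of "\<bar>h x\<bar>"] by simp
    then show ?case using f(1) by blast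
  next
    case (combine u v t)
    have "\<bar>t * u x + (1 - t) * v x - g x\<bar> \<le> \<epsilon> n * \<bar>h x\<bar>" for x
    proof -
      have "\<bar>t * u x + (1 - t) * v x - g x\<bar> = \<bar>t * (u x - g x) + (1 - t) * (v x - g x)\<bar>"
        by (simp add: algebra_simps)
      also have "\<dots> \<le> t * \<bar>u x - g x\<bar> + (1 - t) * \<bar>v x - g x\<bar>"
        using combine.hyps abs_triangle_ineq[of "t * (u x - g x)" "(1 - t) * (v x - g x)"]
        by (simp add: abs_mult)
      also have "\<dots> \<le> t * (\<epsilon> n * \<bar>h x\<bar>) + (1 - t) * (\<epsilon> n * \<bar>h x\<bar>)"
        using combine by (intro add_mono mult_left_mono) auto
      finally show ?thesis by (simp add: algebra_simps)
    qed
    then show ?case using combine form_combination[OF E_form, of u v t "1 - t"] by simp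
  qed
  have kF: "k n \<in> F" for n using hull[OF k] by blast
  obtain u where u: "u \<in> F"
    and lim: "(\<lambda>n. form1 m E (\<lambda>x. k n x - u x) (\<lambda>x. k n x - u x)) \<longlonglongrightarrow> 0"
    using F_complete[of k] kF cauchy by blast
  have diff_L2: "(\<lambda>x. k n x - g x) \<in> L2 m" for n
  proof (rule L2_bound[OF h])
    show "AE x in m. \<bar>k n x - g x\<bar> \<le> \<epsilon> n * \<bar>h x\<bar>" using hull[OF k] by simp
  qed (use L2_measurable[OF F_L2[OF kF]] g in measurable)
  have gL: "g \<in> L2 m" using L2_diff[OF F_L2[OF kF[of 0]] diff_L2[of 0]] by simp
  note uL = F_L2[OF u]
  have "inner2 m (\<lambda>x. u x - g x) (\<lambda>x. u x - g x) \<le> 2 * 0 + 2 * (0\<^sup>2 * inner2 m h h)"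
  proof (rule LIMSEQ_le_const)
    show "(\<lambda>n. 2 * form1 m E (\<lambda>x. k n x - u x) (\<lambda>x. k n x - u x) + 2 * ((\<epsilon> n)\<^sup>2 * inner2 m h h))
        \<longlonglongrightarrow> 2 * 0 + 2 * (0\<^sup>2 * inner2 m h h)"
      by (intro tendsto_intros lim \<epsilon>)
    show "\<exists>N. \<forall>n\<ge>N. inner2 m (\<lambda>x. u x - g x) (\<lambda>x. u x - g x)
        \<le> 2 * form1 m E (\<lambda>x. k n x - u x) (\<lambda>x. k n x - u x) + 2 * ((\<epsilon> n)\<^sup>2 * inner2 m h h)"
    proof (intro exI allI impI)
      fix n
      have kuL: "(\<lambda>x. k n x - u x) \<in> L2 m" using F_L2[OF kF] uL by (rule L2_diff)
      have "inner2 m (\<lambda>x. u x - g x) (\<lambda>x. u x - g x)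
          = inner2 m (\<lambda>x. (k n x - g x) - (k n x - u x)) (\<lambda>x. (k n x - g x) - (k n x - u x))" by simp
      also have "\<dots> \<le> 2 * inner2 m (\<lambda>x. k n x - g x) (\<lambda>x. k n x - g x)
          + 2 * inner2 m (\<lambda>x. k n x - u x) (\<lambda>x. k n x - u x)"
        by (rule form_square_diff_le[OF inner2_form diff_L2 kuL])
      also have "inner2 m (\<lambda>x. k n x - g x) (\<lambda>x. k n x - g x) \<le> inner2 m (\<lambda>x. \<epsilon> n * h x) (\<lambda>x. \<epsilon> n * h x)"
      proof (rule inner2_mono[OF diff_L2 L2_scale[OF h]], rule AE_I2)
        fix x
        have "\<bar>k n x - g x\<bar> \<le> \<epsilon> n * \<bar>h x\<bar>" using hull[OF k[of n]] by blast
        also have "\<dots> \<le> \<bar>\<epsilon> n * h x\<bar>" unfolding abs_mult by (intro mult_right_mono) auto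
        finally show "\<bar>k n x - g x\<bar> \<le> \<bar>\<epsilon> n * h x\<bar>" .
      qed
      also have "\<dots> = (\<epsilon> n)\<^sup>2 * inner2 m h h" by (rule form_square_scale[OF inner2_form h])
      also have "inner2 m (\<lambda>x. k n x - u x) (\<lambda>x. k n x - u x) \<le> form1 m E (\<lambda>x. k n x - u x) (\<lambda>x. k n x - u x)"
        using form_nonneg[OF E_form form_diff[OF E_form kF u]] by (simp add: form1_def)
      finally show "inner2 m (\<lambda>x. u x - g x) (\<lambda>x. u x - g x)
        \<le> 2 * form1 m E (\<lambda>x. k n x - u x) (\<lambda>x. k n x - u x) + 2 * ((\<epsilon> n)\<^sup>2 * inner2 m h h)" by simp
    qed
  qed
  then have "inner2 m (\<lambda>x. u x - g x) (\<lambda>x. u x - g x) = 0"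
    using inner2_self_nonneg[of m "\<lambda>x. u x - g x"] by simp
  then have "AE x in m. u x - g x = 0" by (rule inner2_eq_0_AE[OF L2_diff[OF uL gL]])
  then show ?thesis by (intro form_AE_mem[OF E_form u g]) (auto elim: eventually_mono)
qed

lemma min_F:
  assumes u: "u \<in> F" "\<And>x. 0 \<le> u x" and c: "c \<ge> 0"
  shows "(\<lambda>x. min c (u x)) \<in> F"
    and "form1 m E (\<lambda>x. min c (u x)) (\<lambda>x. min c (u x)) \<le> form1 m E u u"
proof -
  have 1: "(\<lambda>x. min c (u x)) \<in> F \<and> E (\<lambda>x. min c (u x)) (\<lambda>x. min c (u x)) \<le> E u u"
  proof (cases "c = 0")
    case True
    then have "(\<lambda>x. min c (u x)) = (\<lambda>x. 0)" using u(2) by (auto simp: min_def fun_eq_iff order.antisym)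
    then show ?thesis
      using form_zero[OF E_form] form_zero_left[OF E_form, of "\<lambda>x. 0"] form_nonneg[OF E_form u(1)] by simp
  next
    case False
    with c have c: "c > 0" by simp
    have uc: "(\<lambda>x. (1 / c) * u x) \<in> F" by (rule form_scale[OF E_form u(1)])
    have eq: "(\<lambda>x. min c (u x)) = (\<lambda>x. c * clip ((1 / c) * u x))"
      using u(2) c by (auto simp: fun_eq_iff clip_def min_def max_def field_simps)
    have "E (\<lambda>x. c * clip ((1 / c) * u x)) (\<lambda>x. c * clip ((1 / c) * u x))
        = c\<^sup>2 * E (\<lambda>x. clip ((1 / c) * u x)) (\<lambda>x. clip ((1 / c) * u x))"
      by (rule form_square_scale[OF E_form clip_F[OF uc]])
    also have "\<dots> \<le> c\<^sup>2 * E (\<lambda>x. (1 / c) * u x) (\<lambda>x. (1 / c) * u x)"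
      by (intro mult_left_mono E_clip uc) auto
    also have "\<dots> = E u u" unfolding form_square_scale[OF E_form u(1)] using c by (simp add: power_divide)
    finally show ?thesis
      unfolding eq using form_scale[OF E_form clip_F[OF uc]] by blast
  qed
  moreover have "inner2 m (\<lambda>x. min c (u x)) (\<lambda>x. min c (u x)) \<le> inner2 m u u"
    using 1 u c by (intro inner2_mono F_L2) auto
  ultimately show "(\<lambda>x. min c (u x)) \<in> F"
    "form1 m E (\<lambda>x. min c (u x)) (\<lambda>x. min c (u x)) \<le> form1 m E u u"
    by (auto simp: form1_def)
qed

text \<open>The sum is a left Riemann sum of \<open>y\<^sup>2 = \<integral> 2 max 0 (y - t) dt\<close> over \<open>0 \<le> t \<le> N\<close>; the error telescopes because
  each summand differs from \<open>(max 0 (y - k))\<^sup>2 - (max 0 (y - k - 1))\<^sup>2\<close> by at most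
  \<open>2 (max 0 (y - k) - max 0 (y - k - 1))\<close>.\<close>

lemma square_riemann_sum:
  fixes y :: real
  assumes "0 \<le> y" "y \<le> real N"
  shows "\<bar>2 * (\<Sum>k<N. max 0 (y - real k)) - y\<^sup>2\<bar> \<le> 2 * y"
proof -
  define p where "p k = max 0 (y - real k)" for k
  have step: "0 \<le> 2 * p k - ((p k)\<^sup>2 - (p (Suc k))\<^sup>2)"
    "2 * p k - ((p k)\<^sup>2 - (p (Suc k))\<^sup>2) \<le> 2 * (p k - p (Suc k))" for k
  proof -
    have p0: "p k \<ge> 0" by (simp add: p_def)
    have "p (Suc k) = max 0 (p k - 1)" by (auto simp: p_def max_def)
    then consider "p (Suc k) = p k - 1" "p k \<ge> 1" | "p (Suc k) = 0" "p k \<le> 1" by (auto simp: max_def split: if_splits)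
    then have "0 \<le> 2 * p k - ((p k)\<^sup>2 - (p (Suc k))\<^sup>2) \<and>
      2 * p k - ((p k)\<^sup>2 - (p (Suc k))\<^sup>2) \<le> 2 * (p k - p (Suc k))"
    proof cases
      case 1
      have "2 * p k - ((p k)\<^sup>2 - (p (Suc k))\<^sup>2) = 1"
        unfolding 1(1) by (simp add: power2_eq_square algebra_simps)
      with 1(1) show ?thesis by simp
    next
      case 2
      then have "p k * p k \<le> 1 * p k" using p0 by (intro mult_right_mono) auto
      then show ?thesis using 2 p0 by (simp add: power2_eq_square)
    qed
    then show "0 \<le> 2 * p k - ((p k)\<^sup>2 - (p (Suc k))\<^sup>2)"
      "2 * p k - ((p k)\<^sup>2 - (p (Suc k))\<^sup>2) \<le> 2 * (p k - p (Suc k))" by blast+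
  qed
  have "(\<Sum>k<N. 2 * p k - ((p k)\<^sup>2 - (p (Suc k))\<^sup>2)) = 2 * (\<Sum>k<N. p k) - ((p 0)\<^sup>2 - (p N)\<^sup>2)"
    using sum_lessThan_telescope'[of "\<lambda>k. (p k)\<^sup>2" N] by (simp add: sum_subtractf sum_distrib_left)
  moreover have "(\<Sum>k<N. 2 * (p k - p (Suc k))) = 2 * (p 0 - p N)"
    by (simp only: sum_distrib_left[symmetric] sum_lessThan_telescope')
  moreover have "0 \<le> (\<Sum>k<N. 2 * p k - ((p k)\<^sup>2 - (p (Suc k))\<^sup>2))" using step(1) by (intro sum_nonneg)
  moreover have "(\<Sum>k<N. 2 * p k - ((p k)\<^sup>2 - (p (Suc k))\<^sup>2)) \<le> (\<Sum>k<N. 2 * (p k - p (Suc k)))"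
    using step(2) by (intro sum_mono)
  moreover have "p 0 = y" "p N = 0" using assms by (auto simp: p_def)
  ultimately show ?thesis using assms by (simp add: p_def[symmetric] abs_le_iff)
qed

text \<open>The square is approximated by averages of the functions \<open>2 (u - min t u)\<close> over levels \<open>t\<close> in
  \<open>[0, 1]\<close>, whose energies are bounded uniformly in \<open>t\<close> by the contraction property.\<close>

lemma square_F_unit:
  assumes u: "u \<in> F" "\<And>x. 0 \<le> u x" "\<And>x. u x \<le> 1"
  shows "(\<lambda>x. (u x)\<^sup>2) \<in> F"
proof -
  define a where "a n k = (\<lambda>x. 2 * (u x - min (real k / real (Suc n)) (u x)))" for n k
  define f where "f n = (\<lambda>x. (\<Sum>k<Suc n. a n k x) / real (Suc n))" for n
  have a: "a n k \<in> F" "form1 m E (a n k) (a n k) \<le> 16 * form1 m E u u" for n k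
  proof -
    let ?v = "\<lambda>x. min (real k / real (Suc n)) (u x)"
    have c: "0 \<le> real k / real (Suc n)" by simp
    note v = min_F[OF u(1,2) c]
    have d: "(\<lambda>x. u x - ?v x) \<in> F" by (rule form_diff[OF E_form u(1) v(1)])
    then show "a n k \<in> F" unfolding a_def by (rule form_scale[OF E_form])
    have "form1 m E (a n k) (a n k) = 2\<^sup>2 * form1 m E (\<lambda>x. u x - ?v x) (\<lambda>x. u x - ?v x)"
      unfolding a_def by (rule form_square_scale[OF form1_form d])
    moreover have "form1 m E (\<lambda>x. u x - ?v x) (\<lambda>x. u x - ?v x) \<le> 2 * form1 m E u u + 2 * form1 m E ?v ?v"
      by (rule form_square_diff_le[OF form1_form u(1) v(1)])
    ultimately show "form1 m E (a n k) (a n k) \<le> 16 * form1 m E u u" using v(2) by simp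
  qed
  have f: "f n \<in> F" "form1 m E (f n) (f n) \<le> 16 * form1 m E u u" for n
    using form_average[OF form1_form, of "a n" "16 * form1 m E u u" n] a unfolding f_def by blast+
  show ?thesis
  proof (rule F_bounded_limit[where f = f and h = u and \<epsilon> = "\<lambda>n. 2 / real (Suc n)"])
    show "f n \<in> F" "form1 m E (f n) (f n) \<le> 16 * form1 m E u u" for n by (rule f)+
    show "u \<in> L2 m" by (rule F_L2[OF u(1)])
    show "decseq (\<lambda>n. 2 / real (Suc n))" by (auto simp: decseq_def intro!: divide_left_mono)
    show "(\<lambda>n. 2 / real (Suc n)) \<longlonglongrightarrow> 0"
      using LIMSEQ_Suc[OF lim_const_over_n[of 2]] by simp
    show "(\<lambda>x. (u x)\<^sup>2) \<in> borel_measurable m" using L2_measurable[OF F_L2[OF u(1)]] by measurable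
    fix n x
    define y where "y = real (Suc n) * u x"
    have y: "0 \<le> y" "y \<le> real (Suc n)" using u(2,3)[of x] by (auto simp: y_def mult_left_le simp del: of_nat_Suc)
    have N: "real (Suc n) > 0" by simp
    have "a n k x = 2 * max 0 (y - real k) / real (Suc n)" for k
    proof -
      have "u x - min (real k / real (Suc n)) (u x) = max 0 (u x - real k / real (Suc n))" by auto
      also have "\<dots> = max 0 ((y - real k) / real (Suc n))" using N by (simp add: y_def diff_divide_distrib del: of_nat_Suc)
      also have "\<dots> = max 0 (y - real k) / real (Suc n)" using N by (auto simp: max_def divide_le_0_iff zero_le_divide_iff simp del: of_nat_Suc)
      finally show ?thesis by (simp add: a_def)
    qed
    then have "f n x = (2 * (\<Sum>k<Suc n. max 0 (y - real k))) / (real (Suc n))\<^sup>2"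
      unfolding f_def by (simp only: sum_divide_distrib[symmetric] sum_distrib_left[symmetric] power2_eq_square divide_divide_eq_left)
    moreover have "(u x)\<^sup>2 = y\<^sup>2 / (real (Suc n))\<^sup>2" using N by (simp add: y_def power_mult_distrib del: of_nat_Suc)
    ultimately have "\<bar>f n x - (u x)\<^sup>2\<bar> = \<bar>2 * (\<Sum>k<Suc n. max 0 (y - real k)) - y\<^sup>2\<bar> / (real (Suc n))\<^sup>2"
      by (simp only: diff_divide_distrib[symmetric] abs_divide abs_power2 power2_abs)
    also have "\<dots> \<le> 2 * y / (real (Suc n))\<^sup>2"
      using y by (intro divide_right_mono square_riemann_sum) auto
    also have "\<dots> = 2 / real (Suc n) * \<bar>u x\<bar>"
      using N u(2)[of x] by (simp add: y_def power2_eq_square del: of_nat_Suc)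
    finally show "\<bar>f n x - (u x)\<^sup>2\<bar> \<le> 2 / real (Suc n) * \<bar>u x\<bar>" .
  qed
qed

lemma square_F:
  assumes u: "u \<in> F" and bound: "AE x in m. \<bar>u x\<bar> \<le> C"
  shows "(\<lambda>x. (u x)\<^sup>2) \<in> F"
proof -
  define c where "c = max 1 C"
  have c: "c > 0" by (simp add: c_def)
  have uc: "(\<lambda>x. clip ((1 / c) * u x)) \<in> F" "(\<lambda>x. clip ((- 1 / c) * u x)) \<in> F"
    by (intro clip_F form_scale[OF E_form u])+
  have sq: "(\<lambda>x. c\<^sup>2 * (clip ((1 / c) * u x))\<^sup>2 + c\<^sup>2 * (clip ((- 1 / c) * u x))\<^sup>2) \<in> F"
    using uc by (intro form_combination[OF E_form] square_F_unit) (auto simp: clip_bounds)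
  show ?thesis
  proof (rule form_AE_mem[OF E_form sq])
    show "(\<lambda>x. (u x)\<^sup>2) \<in> borel_measurable m" using L2_measurable[OF F_L2[OF u]] by measurable
    show "AE x in m. c\<^sup>2 * (clip ((1 / c) * u x))\<^sup>2 + c\<^sup>2 * (clip ((- 1 / c) * u x))\<^sup>2 = (u x)\<^sup>2"
      using bound
    proof eventually_elim
      case (elim x)
      then have "\<bar>u x\<bar> \<le> c" by (simp add: c_def)
      then have "clip ((1 / c) * u x) = max 0 (u x) / c" "clip ((- 1 / c) * u x) = max 0 (- u x) / c"
        using c by (auto simp: clip_def min_def max_def field_simps)
      then show ?case using c by (auto simp: power_divide max_def)
    qed
  qed
qed

lemma product_F:
  assumes u: "u \<in> F" "AE x in m. \<bar>u x\<bar> \<le> C" and v: "v \<in> F" "AE x in m. \<bar>v x\<bar> \<le> D"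
  shows "(\<lambda>x. u x * v x) \<in> F"
proof -
  have "(\<lambda>x. (u x + v x)\<^sup>2) \<in> F" "(\<lambda>x. (u x - v x)\<^sup>2) \<in> F"
    using u(2) v(2)
    by (auto intro!: square_F[of _ "C + D"] form_add[OF E_form] form_diff[OF E_form] u(1) v(1)
        elim!: eventually_elim2)
  then have "(\<lambda>x. (1/4) * (u x + v x)\<^sup>2 + (- 1/4) * (u x - v x)\<^sup>2) \<in> F"
    by (rule form_combination[OF E_form])
  moreover have "(1/4) * (u x + v x)\<^sup>2 + (- 1/4) * (u x - v x)\<^sup>2 = u x * v x" for x
    by (simp add: power2_eq_square algebra_simps)
  ultimately show ?thesis by simp
qed

end

section \<open>Cutoff functions in a proper metric space\<close>

definition cutoff :: "'a::metric_space set \<Rightarrow> real \<Rightarrow> 'a \<Rightarrow> real" where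
  "cutoff K b x = max 0 (1 - infdist x K / b)"

lemma cutoff_continuous: "continuous_on A (cutoff K b)"
  unfolding cutoff_def[abs_def] by (cases "b = 0") (auto intro!: continuous_intros)

lemma cutoff_bounds:
  assumes "b > 0"
  shows "0 \<le> cutoff K b x" "cutoff K b x \<le> 1"
  using assms infdist_nonneg[of x K] by (auto simp: cutoff_def)

lemma cutoff_eq_1: "x \<in> K \<Longrightarrow> cutoff K b x = 1"
  by (simp add: cutoff_def)

lemma cutoff_eq_0: "b > 0 \<Longrightarrow> b \<le> infdist x K \<Longrightarrow> cutoff K b x = 0"
  by (simp add: cutoff_def max_def)

lemma dist_le_infdist_cball:
  fixes c x :: "'a::metric_space"
  assumes "a \<ge> 0"
  shows "dist c x \<le> a + infdist x (cball c a)"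
proof -
  have ne: "cball c a \<noteq> {}" using assms by auto
  have "dist c x - a \<le> infdist x (cball c a)"
    unfolding infdist_notempty[OF ne]
  proof (rule cINF_greatest[OF ne])
    fix y assume "y \<in> cball c a"
    then show "dist c x - a \<le> dist x y"
      using dist_triangle[of c x y] by (simp add: dist_commute)
  qed
  then show ?thesis by simp
qed

context
  assumes proper: "\<forall>(x::'a::metric_space) r. 0 < r \<longrightarrow> compact (closure (ball x r))"
begin

lemma proper_compact_cball: "compact (cball (x::'a) r)"
proof -
  have "cball x r \<subseteq> closure (ball x (\<bar>r\<bar> + 1))"
    by (rule order_trans[OF _ closure_subset]) auto
  then have "cball x r = closure (ball x (\<bar>r\<bar> + 1)) \<inter> cball x r" by blast
  also have "compact \<dots>" using proper by (intro compact_Int_closed) auto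
  finally show ?thesis .
qed

lemma proper_closed_bounded_compact:
  assumes "closed S" "\<And>x. x \<in> S \<Longrightarrow> dist (c::'a) x \<le> r"
  shows "compact S"
proof -
  have "S = cball c r \<inter> S" using assms(2) by auto
  also have "compact \<dots>" using assms(1) proper_compact_cball by (intro compact_Int_closed)
  finally show ?thesis .
qed

lemma proper_relatively_compact_open:
  assumes "open G" "\<And>x. x \<in> G \<Longrightarrow> dist (c::'a) x \<le> r"
  shows "relatively_compact_open G"
proof -
  have "closure G \<subseteq> cball c r" using assms(2) by (intro closure_minimal) auto
  then have "compact (closure G)" by (intro proper_closed_bounded_compact[of _ c r]) auto
  then show ?thesis using assms(1) by (simp add: relatively_compact_open_def)
qed

lemma C0_iff: "u \<in> C0 \<longleftrightarrow> continuous_on UNIV u \<and> (\<exists>R. \<forall>x. R < dist (c::'a) x \<longrightarrow> u x = 0)"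
proof safe
  assume u: "u \<in> C0"
  then show "continuous_on UNIV u" by (simp add: C0_def)
  have "bounded (closure {x. u x \<noteq> 0})" using u by (simp add: C0_def compact_imp_bounded)
  then obtain R where R: "\<forall>y\<in>closure {x. u x \<noteq> 0}. dist c y \<le> R"
    unfolding bounded_any_center[of _ c] by blast
  have "u x = 0" if "R < dist c x" for x
    using R that closure_subset[of "{x. u x \<noteq> 0}"] by fastforce
  then show "\<exists>R. \<forall>x. R < dist c x \<longrightarrow> u x = 0" by blast
next
  fix R assume "continuous_on UNIV u" and R: "\<forall>x. R < dist c x \<longrightarrow> u x = 0"
  have "closure {x. u x \<noteq> 0} \<subseteq> cball c R"
    using R by (intro closure_minimal) (auto simp: not_less[symmetric])
  then have "compact (closure {x. u x \<noteq> 0})"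
    by (intro proper_closed_bounded_compact[of _ c R]) auto
  with \<open>continuous_on UNIV u\<close> show "u \<in> C0" by (simp add: C0_def)
qed

lemma C0_combination:
  assumes "u \<in> C0" "v \<in> C0"
  shows "(\<lambda>x::'a. s * u x + t * v x) \<in> C0"
proof -
  fix c :: 'a
  obtain R R' where "\<forall>x. R < dist c x \<longrightarrow> u x = 0" "\<forall>x. R' < dist c x \<longrightarrow> v x = 0"
    using assms C0_iff[of _ c] by blast
  then have "\<forall>x. max R R' < dist c x \<longrightarrow> s * u x + t * v x = 0" by simp
  moreover have "continuous_on UNIV (\<lambda>x. s * u x + t * v x)"
    using assms by (intro continuous_intros) (auto simp: C0_def)
  ultimately show ?thesis unfolding C0_iff[of _ c] by blast
qed

lemma C0_mult:
  assumes "u \<in> C0" "continuous_on UNIV v"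
  shows "(\<lambda>x::'a. u x * v x) \<in> C0"
proof -
  fix c :: 'a
  obtain R where "\<forall>x. R < dist c x \<longrightarrow> u x = 0"
    using assms C0_iff[of _ c] by blast
  then have "\<forall>x. R < dist c x \<longrightarrow> u x * v x = 0" by simp
  moreover have "continuous_on UNIV (\<lambda>x. u x * v x)"
    using assms by (intro continuous_intros) (auto simp: C0_def)
  ultimately show ?thesis unfolding C0_iff[of _ c] by blast
qed

lemma C0_bounded:
  assumes "u \<in> C0"
  obtains C where "\<And>x::'a. \<bar>u x\<bar> \<le> C"
proof -
  fix c :: 'a
  obtain R where R: "\<forall>x. R < dist c x \<longrightarrow> u x = 0" and cont: "continuous_on UNIV u"
    using assms C0_iff[of u c] by blast
  have "compact (u ` cball c R)"
    using proper_compact_cball continuous_on_subset[OF cont] by (intro compact_continuous_image) auto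
  then have "bounded (u ` cball c R)" by (rule compact_imp_bounded)
  then obtain C where C: "\<forall>y\<in>u ` cball c R. norm y \<le> C" by (auto simp: bounded_iff)
  have "\<bar>u x\<bar> \<le> max 0 C" for x
    using C R by (cases "R < dist c x") (auto simp: le_max_iff_disj)
  then show ?thesis using that by blast
qed

lemma cutoff_C0:
  assumes K: "compact K" "K \<noteq> {}" and b: "b > 0"
  shows "cutoff K b \<in> (C0 :: ('a \<Rightarrow> real) set)"
proof -
  obtain c where c: "c \<in> K" using K by blast
  obtain R where R: "\<forall>y\<in>K. dist c y \<le> R"
    using compact_imp_bounded[OF K(1)] unfolding bounded_any_center[of _ c] by blast
  have "cutoff K b x = 0" if x: "R + b < dist c x" for x
  proof (rule cutoff_eq_0[OF b])
    show "b \<le> infdist x K"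
      unfolding infdist_notempty[OF K(2)]
    proof (rule cINF_greatest[OF K(2)])
      fix y assume "y \<in> K"
      then show "b \<le> dist x y"
        using R x dist_triangle[of c x y] by (force simp: dist_commute)
    qed
  qed
  then show ?thesis using cutoff_continuous unfolding C0_iff[of _ c] by blast
qed

lemma borel_eq_sigma_compact: "sets (borel :: 'a measure) = sigma_sets UNIV {K. compact K}"
proof
  fix c :: 'a
  have "sets (borel :: 'a measure) = sigma_sets UNIV (Collect closed)"
    unfolding borel_eq_closed by (simp add: sets_measure_of)
  also have "\<dots> \<subseteq> sigma_sets UNIV {K. compact K}"
  proof (rule sigma_sets_mono, rule subsetI)
    fix C :: "'a set" assume "C \<in> Collect closed"
    then have "compact (cball c (real n) \<inter> C)" for n using proper_compact_cball by (intro compact_Int_closed) auto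
    then have "cball c (real n) \<inter> C \<in> sigma_sets UNIV {K. compact K}" for n by (intro sigma_sets.Basic) simp
    then have "(\<Union>n. cball c (real n) \<inter> C) \<in> sigma_sets UNIV {K. compact K}" by (rule sigma_sets.Union)
    moreover have "(\<Union>n. cball c (real n) \<inter> C) = C"
      using real_arch_simple by auto
    ultimately show "C \<in> sigma_sets UNIV {K. compact K}" by simp
  qed
  finally show "sets (borel :: 'a measure) \<subseteq> sigma_sets UNIV {K. compact K}" .
  show "sigma_sets UNIV {K. compact K} \<subseteq> sets (borel :: 'a measure)"
    by (rule sets.sigma_sets_subset') (auto intro: borel_compact simp del: space_borel simp flip: space_borel)
qed

text \<open>The two sums on either side make the statement fit the parallelogram identity of energy measures.\<close>

lemma measure_identity_from_compacts:
  fixes M1 M2 M3 M4 :: "'a measure"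
  assumes fin: "finite_measure M1" "finite_measure M2" "finite_measure M3" "finite_measure M4"
    and sets: "sets M1 = sets borel" "sets M2 = sets borel" "sets M3 = sets borel" "sets M4 = sets borel"
    and compact: "\<And>K. compact K \<Longrightarrow> measure M1 K + measure M2 K = c * (measure M3 K + measure M4 K)"
    and A: "A \<in> sets borel"
  shows "measure M1 A + measure M2 A = c * (measure M3 A + measure M4 A)"
proof -
  define P where "P A \<longleftrightarrow> measure M1 A + measure M2 A = c * (measure M3 A + measure M4 A)" for A
  note space = sets_eq_imp_space_eq[OF sets(1)] sets_eq_imp_space_eq[OF sets(2)]
    sets_eq_imp_space_eq[OF sets(3)] sets_eq_imp_space_eq[OF sets(4)]
  have UNIV: "P UNIV"
  proof -
    fix o' :: 'a
    define B where "B n = cball o' (real n)" for n :: nat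
    have B: "range B \<subseteq> sets borel" "incseq B" by (auto simp: B_def incseq_def)
    have un: "(\<Union>n. B n) = UNIV" using real_arch_simple by (auto simp: B_def)
    have lim: "(\<lambda>n. measure M (B n)) \<longlonglongrightarrow> measure M UNIV"
      if "finite_measure M" "sets M = sets borel" for M
      using finite_measure.finite_Lim_measure_incseq[OF that(1), of B] B that(2) un by simp
    have "(\<lambda>n. measure M1 (B n) + measure M2 (B n)) \<longlonglongrightarrow> measure M1 UNIV + measure M2 UNIV"
      by (intro tendsto_add lim fin sets)
    moreover have "(\<lambda>n. c * (measure M3 (B n) + measure M4 (B n))) \<longlonglongrightarrow> c * (measure M3 UNIV + measure M4 UNIV)"
      by (intro tendsto_intros lim fin sets)
    moreover have "measure M1 (B n) + measure M2 (B n) = c * (measure M3 (B n) + measure M4 (B n))" for n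
      by (rule compact) (simp add: B_def proper_compact_cball)
    ultimately show ?thesis unfolding P_def by (simp add: LIMSEQ_unique)
  qed
  have "Int_stable {K::'a set. compact K}" by (auto simp: Int_stable_def compact_Int)
  moreover have "{K::'a set. compact K} \<subseteq> Pow UNIV" by simp
  moreover have "A \<in> sigma_sets UNIV {K. compact K}" using A borel_eq_sigma_compact by simp
  ultimately have "P A"
  proof (induction rule: sigma_sets_induct_disjoint)
    case (basic K)
    then show ?case using compact by (simp add: P_def)
  next
    case empty
    then show ?case by (simp add: P_def)
  next
    case (compl A)
    then have "A \<in> sets borel" using borel_eq_sigma_compact by simp
    then have "measure M (UNIV - A) = measure M UNIV - measure M A"
      if "finite_measure M" "sets M = sets borel" for M
      using finite_measure.finite_measure_compl[OF that(1), of A] that(2) sets_eq_imp_space_eq[OF that(2)] by simp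
    then have "P (UNIV - A) \<longleftrightarrow> (measure M1 UNIV - measure M1 A) + (measure M2 UNIV - measure M2 A)
        = c * ((measure M3 UNIV - measure M3 A) + (measure M4 UNIV - measure M4 A))"
      unfolding P_def by (simp add: fin sets)
    with compl(2) UNIV show ?case by (simp add: P_def algebra_simps)
  next
    case (union B)
    then have "range B \<subseteq> sets borel" using borel_eq_sigma_compact by simp
    then have sums: "(\<lambda>n. measure M (B n)) sums measure M (\<Union>n. B n)"
      if "finite_measure M" "sets M = sets borel" for M
      using finite_measure.finite_measure_UNION[OF that(1), of B] that(2) union(1) by simp
    have "(\<lambda>n. measure M1 (B n) + measure M2 (B n)) sums (measure M1 (\<Union>n. B n) + measure M2 (\<Union>n. B n))"
      by (intro sums_add sums fin sets)
    moreover have "(\<lambda>n. c * (measure M3 (B n) + measure M4 (B n))) sums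
        (c * (measure M3 (\<Union>n. B n) + measure M4 (\<Union>n. B n)))"
      by (intro sums_mult sums_add sums fin sets)
    ultimately show ?case using union(3) unfolding P_def by (simp add: sums_unique2)
  qed
  then show ?thesis by (simp add: P_def)
qed

lemma cutoff_integral_limit:
  assumes M: "finite_measure M" "sets M = sets borel" and K: "compact (K :: 'a set)" "K \<noteq> {}"
  shows "(\<lambda>n. \<integral>x. cutoff K (1 / real (Suc n)) x \<partial>M) \<longlonglongrightarrow> measure M K"
proof -
  have Kb: "K \<in> sets M" using K M by (simp add: borel_compact)
  have "(\<lambda>n. \<integral>x. cutoff K (1 / real (Suc n)) x \<partial>M) \<longlonglongrightarrow> (\<integral>x. indicator K x \<partial>M)"
  proof (rule integral_dominated_convergence[where w = "\<lambda>_. 1"])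
    show "(indicator K :: 'a \<Rightarrow> real) \<in> borel_measurable M" using Kb by simp
    show "cutoff K (1 / real (Suc n)) \<in> borel_measurable M" for n
      using borel_measurable_continuous_onI[OF cutoff_continuous] measurable_cong_sets[OF M(2) refl] by blast
    show "integrable M (\<lambda>_. 1::real)" by (rule finite_measure.integrable_const[OF M(1)])
    show "AE x in M. norm (cutoff K (1 / real (Suc n)) x) \<le> 1" for n
      using cutoff_bounds[of "1 / real (Suc n)" K] by (intro AE_I2) (simp del: of_nat_Suc)
    show "AE x in M. (\<lambda>n. cutoff K (1 / real (Suc n)) x) \<longlonglongrightarrow> indicator K x"
    proof (intro AE_I2)
      fix x
      show "(\<lambda>n. cutoff K (1 / real (Suc n)) x) \<longlonglongrightarrow> indicator K x"
      proof (cases "x \<in> K")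
        case True
        then show ?thesis by (simp add: cutoff_eq_1)
      next
        case False
        then have "infdist x K > 0"
          using K by (simp add: compact_imp_closed infdist_pos_not_in_closed)
        then obtain N where N: "1 / real (Suc N) < infdist x K"
          using nat_approx_posE by blast
        have "cutoff K (1 / real (Suc n)) x = 0" if "n \<ge> N" for n
        proof (rule cutoff_eq_0)
          have "1 / real (Suc n) \<le> 1 / real (Suc N)" using that by (intro divide_left_mono) auto
          then show "1 / real (Suc n) \<le> infdist x K" using N by simp
        qed simp
        then have "\<forall>\<^sub>F n in sequentially. cutoff K (1 / real (Suc n)) x = indicator K x"
          using False by (auto simp: eventually_sequentially indicator_def)
        then show ?thesis by (rule tendsto_eventually)
      qed
    qed
  qed
  then show ?thesis using Kb by simp
qed

end

section \<open>Energy of cutoff functions: the strongly local part\<close>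

locale jump_diffusion =
  fixes m :: "'a::metric_space measure"
    and F :: "('a \<Rightarrow> real) set"
    and E Ee Ec :: "('a \<Rightarrow> real) \<Rightarrow> ('a \<Rightarrow> real) \<Rightarrow> real"
    and J :: "('a \<times> 'a) measure"
    and mu :: "('a \<Rightarrow> real) \<Rightarrow> 'a measure"
    and Gc Gl :: "('a \<Rightarrow> real) \<Rightarrow> ('a \<Rightarrow> real) \<Rightarrow> 'a \<Rightarrow> real"
    and j :: "'a \<Rightarrow> 'a measure"
    and Xc :: "'a set"
  assumes space: "metric_measure_space m"
    and regular: "regular_dirichlet_form m F E"
    and extended: "extended_form m F E Ee"
    and decomposition: "beurling_deny m F E Ee Ec J (null_measure borel)"
    and energy: "energy_measure m F E Ec mu"
    and density: "\<forall>u\<in>extended_space m F E. \<forall>v\<in>extended_space m F E.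
               abs_cont_with_density m (polarized mu u v) (Gc u v)"
    and kernel: "jump_kernel m J j"
    and local_ext: "local_extension m F Gc Gl"
    and diffusion: "diffusion_set m F Gc Xc"
    and distance_F_loc: "\<forall>K. compact K \<and> K \<noteq> {} \<longrightarrow> (\<lambda>x. infdist x K) \<in> F_loc m F"
begin

sublocale dirichlet_space m F E
  using regular by unfold_locales (simp add: regular_dirichlet_form_def)

lemma proper: "\<forall>(x::'a) r. 0 < r \<longrightarrow> compact (closure (ball x r))"
  using space by (simp add: metric_measure_space_def)

lemma sets_m [simp, measurable_cong]: "sets m = sets borel"
  using space by (simp add: metric_measure_space_def radon_on_def)

lemma space_m [simp]: "space m = UNIV"
  using sets_eq_imp_space_eq[OF sets_m] by simp

lemma compact_finite: "compact K \<Longrightarrow> emeasure m K < \<infinity>"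
  using space by (simp add: metric_measure_space_def radon_on_def)

lemmas compact_cball = proper_compact_cball[OF proper]
  and bounded_relatively_compact = proper_relatively_compact_open[OF proper]
  and C0_iff_bounded = C0_iff[OF proper]

lemma sigma_finite_m: "sigma_finite_measure m"
proof
  fix c :: 'a
  show "\<exists>A::'a set set. countable A \<and> A \<subseteq> sets m \<and> \<Union> A = space m \<and> (\<forall>a\<in>A. emeasure m a \<noteq> \<infinity>)"
  proof (intro exI[of _ "range (\<lambda>n. cball c (real n))"] conjI ballI)
    show "\<Union> (range (\<lambda>n. cball c (real n))) = space m" using real_arch_simple by auto
    show "emeasure m a \<noteq> \<infinity>" if "a \<in> range (\<lambda>n. cball c (real n))" for a
      using that compact_finite[OF compact_cball] by (auto simp: less_top)
  qed auto
qed

lemma F_extended: "u \<in> F \<Longrightarrow> approx_seq m F E u (\<lambda>n. u)"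
  using form_zero_left[OF E_form, of "\<lambda>x. 0"] form_zero[OF E_form]
  by (simp add: approx_seq_def form_cauchy_def)

lemma F_subset_extended: "u \<in> F \<Longrightarrow> u \<in> extended_space m F E"
  unfolding extended_space_def using F_extended[of u] L2_measurable[OF F_L2[of u]] by blast

lemma Ee_eq_E:
  assumes "u \<in> F" "v \<in> F"
  shows "Ee u v = E u v"
proof -
  have "(\<lambda>n::nat. E u v) \<longlonglongrightarrow> Ee u v"
    using extended[unfolded extended_form_def, rule_format, OF F_subset_extended F_subset_extended
        conjI[OF F_extended F_extended], OF assms assms] .
  then show ?thesis by (simp add: LIMSEQ_const_iff)
qed

lemma Ec_form: "nonneg_symmetric_form m F Ec"
proof -
  have ext: "nonneg_symmetric_form m (extended_space m F E) Ec"
    using decomposition by (simp add: beurling_deny_def)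
  note sub = F_subset_extended
  show ?thesis
    unfolding nonneg_symmetric_form_def
  proof (intro conjI ballI allI impI)
    show "(\<lambda>x. 0) \<in> F" by (rule form_zero[OF E_form])
    fix u v w assume u: "u \<in> F"
    show "v \<in> F" if "v \<in> borel_measurable m" "AE x in m. u x = v x"
      by (rule form_AE_mem[OF E_form u that])
    show "Ec v w = Ec u w" if "v \<in> borel_measurable m" "AE x in m. u x = v x" "w \<in> F"
      by (rule form_AE_eq[OF ext sub[OF u] that(1,2) sub[OF that(3)]])
    show "(\<lambda>x. c * u x) \<in> F" for c by (rule form_scale[OF E_form u])
    show "0 \<le> Ec u u" by (rule form_nonneg[OF ext sub[OF u]])
    assume v: "v \<in> F"
    show "(\<lambda>x. u x + v x) \<in> F" by (rule form_add[OF E_form u v])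
    show "Ec u v = Ec v u" by (rule form_commute[OF ext sub[OF u] sub[OF v]])
    show "Ec (\<lambda>x. c * u x) v = c * Ec u v" for c
      by (rule form_scale_left[OF ext sub[OF u] sub[OF v]])
    show "Ec (\<lambda>x. u x + v x) w = Ec u w + Ec v w" if w: "w \<in> F"
      by (rule form_add_left[OF ext sub[OF u] sub[OF v] sub[OF w]])
  qed
qed

lemma Ec_local:
  assumes "u \<in> C0 \<inter> F" "v \<in> C0 \<inter> F" "open U" "closure {x. u x \<noteq> 0} \<subseteq> U" "\<And>x. x \<in> U \<Longrightarrow> v x = c"
  shows "Ec u v = 0"
proof -
  have "strongly_local (C0 \<inter> F) Ec" using decomposition by (simp add: beurling_deny_def)
  from this[unfolded strongly_local_def, THEN bspec, OF assms(1), THEN bspec, OF assms(2)]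
  show ?thesis by (rule mp) (intro exI[of _ U] exI[of _ c] conjI ballI assms)
qed

text \<open>On a large ball the distance from \<open>K\<close> is represented by some \<open>w \<in> F\<close>. Outside that ball \<open>w\<close> is
  unknown, but there the cutoff is forced to vanish by a function \<open>h \<in> C0 \<inter> F\<close> that is 1 where
  the cutoff lives: the cutoff is the positive part of \<open>h - min 1 (w / b)\<close>.\<close>

lemma cutoff_F:
  assumes K: "compact K" "K \<noteq> {}" and b: "b > 0"
  shows "cutoff K b \<in> C0 \<inter> F"
proof -
  have C0: "cutoff K b \<in> C0" by (rule cutoff_C0[OF proper K b])
  obtain c where c: "c \<in> K" using K by blast
  obtain R0 where R0: "\<forall>x. R0 < dist c x \<longrightarrow> cutoff K b x = 0"
    using C0 C0_iff_bounded[of "cutoff K b" c] by blast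
  define R where "R = max 0 R0"
  have R: "R \<ge> 0" "\<And>x. cutoff K b x \<noteq> 0 \<Longrightarrow> x \<in> cball c R"
    using R0 by (auto simp: R_def not_less[symmetric])
  have ne: "cball c R \<noteq> {}" using R by auto
  have "(\<lambda>x. 2 * cutoff (cball c R) 1 x + 0 * cutoff (cball c R) 1 x) \<in> C0"
    by (intro C0_combination[OF proper] cutoff_C0[OF proper compact_cball ne]) auto
  then have "(\<lambda>x. 2 * cutoff (cball c R) 1 x) \<in> C0" by simp
  from regular[unfolded regular_dirichlet_form_def, THEN conjunct2, THEN conjunct2, rule_format,
      OF this zero_less_one]
  obtain v where v: "v \<in> C0 \<inter> F" "\<And>x. \<bar>2 * cutoff (cball c R) 1 x - v x\<bar> < 1"
    by blast
  have v1: "v x > 1" if "x \<in> cball c R" for x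
    using v(2)[of x] cutoff_eq_1[OF that, of 1] by (simp add: abs_if split: if_splits)
  obtain R2 where R2: "\<forall>x. R2 < dist c x \<longrightarrow> v x = 0"
    using v(1) C0_iff_bounded[of v c] by blast
  define G where "G = ball c (R2 + 1)"
  have outG: "v x = 0" if "x \<notin> G" for x using R2 that by (simp add: G_def)
  have G: "relatively_compact_open G"
    by (rule bounded_relatively_compact[of _ c "R2 + 1"]) (auto simp: G_def)
  have "(\<lambda>x. infdist x K) \<in> F_loc m F" using distance_F_loc K by blast
  from this[unfolded F_loc_def, THEN CollectD, THEN conjunct2, rule_format, OF G]
  obtain w where w: "w \<in> F" "AE x in m. x \<in> G \<longrightarrow> infdist x K = w x"
    by blast
  have h: "(\<lambda>x. clip (v x)) \<in> F" using v(1) by (intro clip_F) simp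
  have w1: "(\<lambda>x. clip ((1 / b) * w x)) \<in> F" by (intro clip_F form_scale[OF E_form w(1)])
  have uF: "(\<lambda>x. clip (clip (v x) - clip ((1 / b) * w x))) \<in> F"
    by (rule clip_F[OF form_diff[OF E_form h w1]])
  have "cutoff K b \<in> F"
  proof (rule form_AE_mem[OF E_form uF])
    show "cutoff K b \<in> borel_measurable m"
      using borel_measurable_continuous_onI[OF cutoff_continuous, of K b] by simp
    show "AE x in m. clip (clip (v x) - clip ((1 / b) * w x)) = cutoff K b x"
      using w(2)
    proof eventually_elim
      case (elim x)
      show ?case
      proof (cases "cutoff K b x = 0")
        case False
        with R have x: "x \<in> cball c R" by blast
        then have "v x > 1" by (rule v1)
        moreover have "x \<in> G" using outG[of x] \<open>v x > 1\<close> by fastforce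
        moreover have "infdist x K < b" using False cutoff_eq_0[OF b, of x K] by force
        ultimately have "w x = infdist x K" "0 \<le> infdist x K / b" "infdist x K / b \<le> 1" "clip (v x) = 1"
          using elim b infdist_nonneg[of x K] by (auto simp: clip_def)
        then show ?thesis by (simp add: cutoff_def clip_id)
      next
        case True
        have ge: "1 \<le> infdist x K / b" using True by (simp add: cutoff_def max_def split: if_splits)
        show ?thesis
        proof (cases "x \<in> G")
          case True
          then have "clip ((1 / b) * w x) = 1" using elim ge by (simp add: clip_def)
          then show ?thesis using \<open>cutoff K b x = 0\<close> clip_bounds(2)[of "v x"] by (simp add: clip_def)
        next
          case False
          then show ?thesis
            using \<open>cutoff K b x = 0\<close> outG[of x] clip_bounds(1)[of "(1 / b) * w x"] by (simp add: clip_def)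
        qed
      qed
    qed
  qed
  with C0 show ?thesis by simp
qed

lemma energy_finite: "u \<in> F \<Longrightarrow> finite_measure (mu u)"
  and energy_sets: "u \<in> F \<Longrightarrow> sets (mu u) = sets borel"
  using energy[unfolded energy_measure_def, THEN conjunct1, rule_format, OF F_subset_extended]
  by simp_all

lemma energy_formula:
  assumes "u \<in> F" "f \<in> C0 \<inter> F" "\<And>x. \<bar>u x\<bar> \<le> C"
  shows "(\<integral>x. f x \<partial>(mu u)) = 2 * Ec (\<lambda>x. u x * f x) u - Ec (\<lambda>x. (u x)\<^sup>2) f"
  by (rule energy[unfolded energy_measure_def, THEN conjunct2, THEN conjunct1, rule_format,
        OF assms(1,2)]) (use assms(3) in auto)

lemma Ec_eq_energy: "u \<in> F \<Longrightarrow> Ec u u = polarized mu u u UNIV / 2"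
  by (rule energy[unfolded energy_measure_def, THEN conjunct2, THEN conjunct2, THEN conjunct2,
        rule_format, OF F_subset_extended F_subset_extended])

lemma
  assumes u: "u \<in> F" "\<And>x. \<bar>u x\<bar> \<le> C" and v: "v \<in> F" "\<And>x. \<bar>v x\<bar> \<le> D"
  shows bounded_product_F: "(\<lambda>x. u x * v x) \<in> F"
    and bounded_square_F: "(\<lambda>x. (u x)\<^sup>2) \<in> F"
  using product_F[OF u(1) _ v(1), of C D] square_F[OF u(1), of C] u(2) v(2) by auto

text \<open>The quadratic dependence of \<open>mu u\<close> on \<open>u\<close> is seen on the test integrals and is carried over to
  Borel sets by measures of compact sets, which are limits of integrals of cutoffs.\<close>

lemma energy_scale:
  assumes u: "u \<in> F" "\<And>x. \<bar>u x\<bar> \<le> C" and A: "A \<in> sets borel"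
  shows "measure (mu (\<lambda>x. c * u x)) A = c\<^sup>2 * measure (mu u) A"
proof -
  let ?v = "\<lambda>x. c * u x"
  have v: "?v \<in> F" by (rule form_scale[OF E_form u(1)])
  have vb: "\<bar>?v x\<bar> \<le> \<bar>c\<bar> * C" for x using u(2)[of x] by (simp add: abs_mult mult_left_mono)
  have int: "(\<integral>x. f x \<partial>(mu ?v)) = c\<^sup>2 * (\<integral>x. f x \<partial>(mu u))" if f: "f \<in> C0 \<inter> F" for f
  proof -
    obtain D where D: "\<And>x. \<bar>f x\<bar> \<le> D" using C0_bounded[OF proper, of f] f by blast
    have fF: "f \<in> F" using f by simp
    have uf: "(\<lambda>x. u x * f x) \<in> F" and u2: "(\<lambda>x. (u x)\<^sup>2) \<in> F"
      using bounded_product_F[OF u fF D] bounded_square_F[OF u fF D] by blast+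
    have "Ec (\<lambda>x. ?v x * f x) ?v = Ec (\<lambda>x. c * (u x * f x)) ?v" by (simp add: mult.assoc)
    also have "\<dots> = c * (c * Ec (\<lambda>x. u x * f x) u)"
      using form_scale_left[OF Ec_form uf v] form_scale_right[OF Ec_form u(1) uf] by simp
    finally have 1: "Ec (\<lambda>x. ?v x * f x) ?v = c\<^sup>2 * Ec (\<lambda>x. u x * f x) u" by (simp add: power2_eq_square)
    have "Ec (\<lambda>x. (?v x)\<^sup>2) f = Ec (\<lambda>x. c\<^sup>2 * (u x)\<^sup>2) f" by (simp add: power_mult_distrib)
    also have "\<dots> = c\<^sup>2 * Ec (\<lambda>x. (u x)\<^sup>2) f" by (rule form_scale_left[OF Ec_form u2 fF])
    finally have 2: "Ec (\<lambda>x. (?v x)\<^sup>2) f = c\<^sup>2 * Ec (\<lambda>x. (u x)\<^sup>2) f" .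
    show ?thesis
      unfolding energy_formula[OF v f vb] energy_formula[OF u(1) f u(2)] 1 2
      by (simp add: right_diff_distrib)
  qed
  have "measure (mu ?v) A + measure (mu ?v) A = c\<^sup>2 * (measure (mu u) A + measure (mu u) A)"
  proof (rule measure_identity_from_compacts[OF proper _ _ _ _ _ _ _ _ _ A])
    fix K :: "'a set" assume K: "compact K"
    show "measure (mu ?v) K + measure (mu ?v) K = c\<^sup>2 * (measure (mu u) K + measure (mu u) K)"
    proof (cases "K = {}")
      case False
      have "(\<lambda>n. c\<^sup>2 * (\<integral>x. cutoff K (1 / real (Suc n)) x \<partial>mu u)) \<longlonglongrightarrow> c\<^sup>2 * measure (mu u) K"
        by (intro tendsto_mult_left cutoff_integral_limit[OF proper energy_finite energy_sets K False] u)
      moreover have "(\<lambda>n. c\<^sup>2 * (\<integral>x. cutoff K (1 / real (Suc n)) x \<partial>mu u)) \<longlonglongrightarrow> measure (mu ?v) K"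
        using cutoff_integral_limit[OF proper energy_finite[OF v] energy_sets[OF v] K False]
        by (subst int[OF cutoff_F[OF K False], symmetric]) auto
      ultimately show ?thesis using LIMSEQ_unique by fastforce
    qed simp
  qed (use energy_finite energy_sets u v in auto)
  then show ?thesis by simp
qed

lemma energy_parallelogram:
  assumes u: "u \<in> F" "\<And>x. \<bar>u x\<bar> \<le> C" and v: "v \<in> F" "\<And>x. \<bar>v x\<bar> \<le> C'" and A: "A \<in> sets borel"
  shows "measure (mu (\<lambda>x. u x + v x)) A + measure (mu (\<lambda>x. u x - v x)) A
    = 2 * (measure (mu u) A + measure (mu v) A)"
proof -
  let ?p = "\<lambda>x. u x + v x" and ?q = "\<lambda>x. u x - v x"
  have p: "?p \<in> F" by (rule form_add[OF E_form u(1) v(1)])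
  have q: "?q \<in> F" by (rule form_diff[OF E_form u(1) v(1)])
  have pb: "\<bar>?p x\<bar> \<le> C + C'" and qb: "\<bar>?q x\<bar> \<le> C + C'" for x using u(2)[of x] v(2)[of x] by auto
  have int: "(\<integral>x. f x \<partial>(mu ?p)) + (\<integral>x. f x \<partial>(mu ?q)) = 2 * ((\<integral>x. f x \<partial>(mu u)) + (\<integral>x. f x \<partial>(mu v)))"
    if f: "f \<in> C0 \<inter> F" for f
  proof -
    obtain D where D: "\<And>x. \<bar>f x\<bar> \<le> D" using C0_bounded[OF proper, of f] f by blast
    have fF: "f \<in> F" using f by simp
    have uf: "(\<lambda>x. u x * f x) \<in> F" and u2: "(\<lambda>x. (u x)\<^sup>2) \<in> F"
      using bounded_product_F[OF u fF D] bounded_square_F[OF u fF D] by blast+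
    have vf: "(\<lambda>x. v x * f x) \<in> F" and v2: "(\<lambda>x. (v x)\<^sup>2) \<in> F"
      using bounded_product_F[OF v fF D] bounded_square_F[OF v fF D] by blast+
    have uv: "(\<lambda>x. 2 * (u x * v x)) \<in> F" using form_scale[OF E_form bounded_product_F[OF u v]] .
    have s: "(\<lambda>x. (u x)\<^sup>2 + (v x)\<^sup>2) \<in> F" by (rule form_add[OF E_form u2 v2])
    have "Ec (\<lambda>x. ?p x * f x) ?p = Ec (\<lambda>x. u x * f x + v x * f x) ?p" by (simp add: distrib_right)
    then have 1: "Ec (\<lambda>x. ?p x * f x) ?p
        = Ec (\<lambda>x. u x * f x) u + Ec (\<lambda>x. u x * f x) v + (Ec (\<lambda>x. v x * f x) u + Ec (\<lambda>x. v x * f x) v)"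
      by (simp add: form_add_left[OF Ec_form uf vf p] form_add_right[OF Ec_form u(1) v(1) uf]
          form_add_right[OF Ec_form u(1) v(1) vf])
    have "Ec (\<lambda>x. ?q x * f x) ?q = Ec (\<lambda>x. u x * f x - v x * f x) ?q" by (simp add: left_diff_distrib)
    then have 2: "Ec (\<lambda>x. ?q x * f x) ?q
        = Ec (\<lambda>x. u x * f x) u - Ec (\<lambda>x. u x * f x) v - (Ec (\<lambda>x. v x * f x) u - Ec (\<lambda>x. v x * f x) v)"
      by (simp add: form_diff_left[OF Ec_form uf vf q] form_diff_right[OF Ec_form u(1) v(1) uf]
          form_diff_right[OF Ec_form u(1) v(1) vf])
    have "Ec (\<lambda>x. (?p x)\<^sup>2) f = Ec (\<lambda>x. ((u x)\<^sup>2 + (v x)\<^sup>2) + 2 * (u x * v x)) f"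
      by (simp add: power2_sum mult.assoc)
    also have "\<dots> = Ec (\<lambda>x. (u x)\<^sup>2 + (v x)\<^sup>2) f + Ec (\<lambda>x. 2 * (u x * v x)) f"
      by (rule form_add_left[OF Ec_form s uv fF])
    finally have 3: "Ec (\<lambda>x. (?p x)\<^sup>2) f = Ec (\<lambda>x. (u x)\<^sup>2 + (v x)\<^sup>2) f + Ec (\<lambda>x. 2 * (u x * v x)) f" .
    have "Ec (\<lambda>x. (?q x)\<^sup>2) f = Ec (\<lambda>x. ((u x)\<^sup>2 + (v x)\<^sup>2) - 2 * (u x * v x)) f"
      by (simp add: power2_diff mult.assoc)
    also have "\<dots> = Ec (\<lambda>x. (u x)\<^sup>2 + (v x)\<^sup>2) f - Ec (\<lambda>x. 2 * (u x * v x)) f"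
      by (rule form_diff_left[OF Ec_form s uv fF])
    finally have 4: "Ec (\<lambda>x. (?q x)\<^sup>2) f = Ec (\<lambda>x. (u x)\<^sup>2 + (v x)\<^sup>2) f - Ec (\<lambda>x. 2 * (u x * v x)) f" .
    have 5: "Ec (\<lambda>x. (u x)\<^sup>2 + (v x)\<^sup>2) f = Ec (\<lambda>x. (u x)\<^sup>2) f + Ec (\<lambda>x. (v x)\<^sup>2) f"
      by (rule form_add_left[OF Ec_form u2 v2 fF])
    show ?thesis
      unfolding energy_formula[OF p f pb] energy_formula[OF q f qb] energy_formula[OF u(1) f u(2)]
        energy_formula[OF v(1) f v(2)] 1 2 3 4 5
      by (simp add: algebra_simps)
  qed
  show ?thesis
  proof (rule measure_identity_from_compacts[OF proper _ _ _ _ _ _ _ _ _ A])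
    fix K :: "'a set" assume K: "compact K"
    show "measure (mu ?p) K + measure (mu ?q) K = 2 * (measure (mu u) K + measure (mu v) K)"
    proof (cases "K = {}")
      case False
      have lim: "(\<lambda>n. \<integral>x. cutoff K (1 / real (Suc n)) x \<partial>mu w) \<longlonglongrightarrow> measure (mu w) K" if "w \<in> F" for w
        using that by (intro cutoff_integral_limit[OF proper energy_finite energy_sets K False])
      have "(\<lambda>n. 2 * ((\<integral>x. cutoff K (1 / real (Suc n)) x \<partial>mu u) + (\<integral>x. cutoff K (1 / real (Suc n)) x \<partial>mu v)))
          \<longlonglongrightarrow> 2 * (measure (mu u) K + measure (mu v) K)"
        by (intro tendsto_mult_left tendsto_add lim u v)
      moreover have "(\<lambda>n. (\<integral>x. cutoff K (1 / real (Suc n)) x \<partial>mu ?p) + (\<integral>x. cutoff K (1 / real (Suc n)) x \<partial>mu ?q))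
          \<longlonglongrightarrow> measure (mu ?p) K + measure (mu ?q) K"
        by (intro tendsto_add lim p q)
      moreover have "(\<integral>x. cutoff K (1 / real (Suc n)) x \<partial>mu ?p) + (\<integral>x. cutoff K (1 / real (Suc n)) x \<partial>mu ?q)
        = 2 * ((\<integral>x. cutoff K (1 / real (Suc n)) x \<partial>mu u) + (\<integral>x. cutoff K (1 / real (Suc n)) x \<partial>mu v))" for n
        by (rule int[OF cutoff_F[OF K False]]) simp
      ultimately show ?thesis by (simp add: LIMSEQ_unique)
    qed simp
  qed (use energy_finite energy_sets u v p q in auto)
qed

lemma polarized_energy:
  assumes u: "u \<in> F" "\<And>x. \<bar>u x\<bar> \<le> C" and A: "A \<in> sets borel"
  shows "polarized mu u u A = measure (mu u) A"
proof -
  have "(\<lambda>x. u x + u x) = (\<lambda>x. 2 * u x)" by auto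
  then show ?thesis using energy_scale[OF u A, of 2] by (simp add: polarized_def)
qed

lemma energy_density:
  assumes u: "u \<in> F" "\<And>x. \<bar>u x\<bar> \<le> C" and A: "A \<in> sets borel"
  shows "measure (mu u) A = (\<integral>x\<in>A. Gc u u x \<partial>m)"
    and "integrable m (Gc u u)"
  using density[rule_format, OF F_subset_extended F_subset_extended, OF u(1) u(1)]
    polarized_energy[OF u A] A by (auto simp: abs_cont_with_density_def)

lemma energy_null:
  assumes u: "u \<in> F" "\<And>x. \<bar>u x\<bar> \<le> C" and A: "A \<in> null_sets m"
  shows "measure (mu u) A = 0"
  using density[rule_format, OF F_subset_extended F_subset_extended, OF u(1) u(1)]
    polarized_energy[OF u, of A] A by (auto simp: abs_cont_with_density_def null_sets_def)

lemma local_extension_eq: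
  assumes "u \<in> F_loc m F" "u' \<in> F" "relatively_compact_open G" "AE x in m. x \<in> G \<longrightarrow> u x = u' x"
  shows "AE x in m. x \<in> G \<longrightarrow> Gl u u x = Gc u' u' x"
  by (rule local_ext[unfolded local_extension_def, rule_format, OF assms(1,1), THEN conjunct2,
        rule_format, OF assms(2,2)]) (use assms(3,4) in simp)

lemma F_subset_F_loc: "u \<in> F \<Longrightarrow> u \<in> F_loc m F"
  unfolding F_loc_def using L2_measurable[OF F_L2[of u]] by (intro CollectI conjI allI impI bexI[of _ u]) auto

text \<open>The densities of both functions agree on \<open>G\<close> with that of their common local extension.\<close>

lemma energy_local:
  assumes u: "u \<in> F" "\<And>x. \<bar>u x\<bar> \<le> C" and v: "v \<in> F" "\<And>x. \<bar>v x\<bar> \<le> C'"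
    and G: "relatively_compact_open G" "AE x in m. x \<in> G \<longrightarrow> u x = v x"
    and A: "A \<in> sets borel" "A \<subseteq> G"
  shows "measure (mu u) A = measure (mu v) A"
proof -
  have "AE x in m. x \<in> G \<longrightarrow> Gl u u x = Gc u u x"
    by (rule local_extension_eq[OF F_subset_F_loc[OF u(1)] u(1) G(1)]) simp
  moreover have "AE x in m. x \<in> G \<longrightarrow> Gl u u x = Gc v v x"
    by (rule local_extension_eq[OF F_subset_F_loc[OF u(1)] v(1) G])
  ultimately have "AE x in m. indicator A x *\<^sub>R Gc u u x = indicator A x *\<^sub>R Gc v v x"
    by eventually_elim (use A(2) in \<open>auto simp: indicator_def\<close>)
  then have "(\<integral>x\<in>A. Gc u u x \<partial>m) = (\<integral>x\<in>A. Gc v v x \<partial>m)"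
    unfolding set_lebesgue_integral_def
    using energy_density(2)[OF u A(1)] energy_density(2)[OF v A(1)] A(1)
    by (intro integral_cong_AE) auto
  then show ?thesis using energy_density(1)[OF u A(1)] energy_density(1)[OF v A(1)] by simp
qed

lemma energy_diffusion_set:
  assumes u: "u \<in> F" "\<And>x. \<bar>u x\<bar> \<le> C" and A: "A \<in> sets borel"
  shows "measure (mu u) A = measure (mu u) (A \<inter> Xc)"
proof -
  have Xc: "Xc \<in> sets borel" using diffusion by (simp add: diffusion_set_def)
  have "AE x in m. x \<notin> Xc \<longrightarrow> Gc u u x = 0"
    using diffusion u(1) by (simp add: diffusion_set_def)
  then have "AE x in m. indicator A x *\<^sub>R Gc u u x = indicator (A \<inter> Xc) x *\<^sub>R Gc u u x"
    by eventually_elim (auto simp: indicator_def)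
  then have "(\<integral>x\<in>A. Gc u u x \<partial>m) = (\<integral>x\<in>A \<inter> Xc. Gc u u x \<partial>m)"
    unfolding set_lebesgue_integral_def
    using energy_density(2)[OF u A] A Xc by (intro integral_cong_AE) auto
  then show ?thesis using energy_density(1)[OF u] A Xc by simp
qed

text \<open>Test the energy measure with a cutoff \<open>f\<close> supported where \<open>h = 1\<close>. There \<open>h f = f\<close>, and strong locality
  makes both terms \<open>Ec (h f) h\<close> and \<open>Ec h\<^sup>2 f\<close> of the defining formula vanish.\<close>

lemma energy_plateau:
  assumes h: "h \<in> C0 \<inter> F" and one: "\<And>x. x \<in> ball c (r + 2) \<Longrightarrow> h x = 1" and r: "r \<ge> 0"
  shows "measure (mu h) (cball c r) = 0"
proof -
  have hF: "h \<in> F" using h by simp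
  obtain C where C: "\<And>x. \<bar>h x\<bar> \<le> C" using C0_bounded[OF proper, of h] h by blast
  have ne: "cball c r \<noteq> {}" using r by auto
  define f where "f = cutoff (cball c r) 1"
  have f: "f \<in> C0 \<inter> F" unfolding f_def by (rule cutoff_F[OF compact_cball ne]) simp
  have "x \<in> cball c (r + 1)" if "f x \<noteq> 0" for x
  proof -
    have "infdist x (cball c r) < 1" using that cutoff_eq_0[of 1 x "cball c r"] by (force simp: f_def)
    then show ?thesis using dist_le_infdist_cball[OF r, of c x] by simp
  qed
  then have "closure {x. f x \<noteq> 0} \<subseteq> cball c (r + 1)" by (intro closure_minimal) auto
  then have supp: "closure {x. f x \<noteq> 0} \<subseteq> ball c (r + 2)" by (auto simp: subset_iff)
  have h2: "(\<lambda>x. (h x)\<^sup>2) \<in> C0 \<inter> F"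
  proof
    show "(\<lambda>x. (h x)\<^sup>2) \<in> C0"
      using C0_mult[OF proper, of h h] h by (simp add: power2_eq_square C0_def)
    show "(\<lambda>x. (h x)\<^sup>2) \<in> F" by (rule bounded_square_F[OF hF C hF C])
  qed
  have hf: "(\<lambda>x. h x * f x) = f"
  proof
    fix x show "h x * f x = f x"
      using one[of x] supp closure_subset[of "{x. f x \<noteq> 0}"] by (cases "f x = 0") auto
  qed
  have "Ec f h = 0" by (rule Ec_local[OF f h _ supp]) (use one in auto)
  moreover have "Ec f (\<lambda>x. (h x)\<^sup>2) = 0" by (rule Ec_local[OF f h2 _ supp]) (use one in auto)
  then have "Ec (\<lambda>x. (h x)\<^sup>2) f = 0" using form_commute[OF Ec_form, of f "\<lambda>x. (h x)\<^sup>2"] f h2 by simp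
  ultimately have "(\<integral>x. f x \<partial>mu h) = 0" using energy_formula[OF hF f C] hf by simp
  moreover have "measure (mu h) (cball c r) \<le> (\<integral>x. f x \<partial>mu h)"
  proof -
    interpret finite_measure "mu h" by (rule energy_finite[OF hF])
    note sets = energy_sets[OF hF]
    have fm: "f \<in> borel_measurable (mu h)"
      unfolding f_def using borel_measurable_continuous_onI[OF cutoff_continuous]
        measurable_cong_sets[OF sets refl] by blast
    have "(\<integral>x. indicator (cball c r) x \<partial>mu h) \<le> (\<integral>x. f x \<partial>mu h)"
    proof (rule integral_mono)
      show "integrable (mu h) (indicator (cball c r) :: 'a \<Rightarrow> real)"
        by (simp add: integrable_indicator_iff sets less_top[symmetric])
      show "integrable (mu h) f"
        by (rule integrable_const_bound[of _ 1]) (use fm cutoff_bounds[of 1 "cball c r"] in \<open>auto simp: f_def\<close>)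
      show "indicator (cball c r) x \<le> f x" for x
        using cutoff_bounds[of 1 "cball c r" x] cutoff_eq_1[of x "cball c r" 1]
        by (auto simp: indicator_def f_def)
    qed
    then show ?thesis by (simp add: sets)
  qed
  ultimately show ?thesis using measure_nonneg[of "mu h" "cball c r"] by simp
qed

end

text \<open>With \<open>\<psi>\<close> the distance from the ball, the cutoff is \<open>1 - \<psi> / b\<close> where \<open>\<psi> < b\<close> and vanishes where \<open>\<psi> > b\<close>.
  By locality its energy on the first set is controlled by the density of \<open>\<psi>\<close>, and there is none on the
  second. Locality says nothing about the sphere \<open>\<psi> = b\<close>, which is therefore required to be null.\<close>

lemma (in jump_diffusion) cutoff_local_energy:
  assumes a: "a \<ge> 0" and b: "b > 0" and M: "M \<ge> 0"
    and bound: "AE x in m. x \<in> Xc \<longrightarrow> Gl (\<lambda>z. infdist z (cball c a)) (\<lambda>z. infdist z (cball c a)) x \<le> M"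
    and null: "{x. infdist x (cball c a) = b} \<in> null_sets m"
  shows "Ec (cutoff (cball c a) b) (cutoff (cball c a) b) \<le> M / b\<^sup>2 * measure m (cball c (a + b) \<inter> Xc)"
proof -
  let ?K = "cball c a"
  define \<psi> where "\<psi> z = infdist z ?K" for z
  have \<psi>_cont: "continuous_on UNIV \<psi>" unfolding \<psi>_def[abs_def] by (intro continuous_intros)
  have ne: "?K \<noteq> {}" using a by auto
  define u where "u = cutoff ?K b"
  have u: "u \<in> F" unfolding u_def using cutoff_F[OF compact_cball ne b] by simp
  have ub: "\<bar>u x\<bar> \<le> 1" for x using cutoff_bounds[OF b, of ?K x] by (simp add: u_def)
  define O' where "O' = {x. \<psi> x < b}"
  have O_open: "open O'" unfolding O'_def using \<psi>_cont by (intro open_Collect_less) auto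
  have O_ball: "x \<in> cball c (a + b)" if "x \<in> O'" for x
    using that dist_le_infdist_cball[OF a, of c x] by (simp add: O'_def \<psi>_def)
  have O_rc: "relatively_compact_open O'"
    using O_open O_ball by (intro bounded_relatively_compact[of _ c "a + b"]) auto
  have [measurable]: "O' \<in> sets borel" using O_open by simp
  have Xc [measurable]: "Xc \<in> sets borel" using diffusion by (simp add: diffusion_set_def)
  have "(\<lambda>x. infdist x ?K) \<in> F_loc m F" using distance_F_loc compact_cball ne by blast
  then have \<psi>F: "\<psi> \<in> F_loc m F" by (simp add: \<psi>_def[abs_def])
  from this[unfolded F_loc_def, THEN CollectD, THEN conjunct2, rule_format, OF O_rc]
  obtain w where w: "w \<in> F" "AE x in m. x \<in> O' \<longrightarrow> \<psi> x = w x" by blast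
  define w1 where "w1 = (\<lambda>x. b * clip ((1 / b) * w x))"
  have w1: "w1 \<in> F" unfolding w1_def by (intro form_scale[OF E_form] clip_F w)
  have w1b: "\<bar>w1 x\<bar> \<le> b" for x
    using b clip_bounds[of "(1 / b) * w x"] by (simp add: w1_def abs_mult mult_left_le)
  have w1_eq: "AE x in m. x \<in> O' \<longrightarrow> \<psi> x = w1 x"
    using w(2)
  proof eventually_elim
    case (elim x)
    show ?case
    proof
      assume "x \<in> O'"
      then have "w x = \<psi> x" "0 \<le> \<psi> x / b" "\<psi> x / b \<le> 1"
        using elim b infdist_nonneg[of x ?K] by (auto simp: O'_def \<psi>_def)
      then show "\<psi> x = w1 x" using b by (simp add: w1_def clip_id)
    qed
  qed
  define h where "h = cutoff (cball c (a + b + 2)) 1"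
  have ne': "cball c (a + b + 2) \<noteq> {}" using a b by auto
  have h: "h \<in> C0 \<inter> F" unfolding h_def by (rule cutoff_F[OF compact_cball ne']) simp
  then have hF: "h \<in> F" by simp
  have hb: "\<bar>h x\<bar> \<le> 1" for x using cutoff_bounds[of 1 "cball c (a + b + 2)" x] by (simp add: h_def)
  have h1: "h x = 1" if "x \<in> ball c (a + b + 2)" for x
    unfolding h_def by (rule cutoff_eq_1) (use that in auto)
  have h0: "measure (mu h) (cball c (a + b)) = 0"
    by (rule energy_plateau[OF h h1]) (use a b in auto)
  define z where "z = (\<lambda>x. (1 / b) * w1 x)"
  have z: "z \<in> F" unfolding z_def by (rule form_scale[OF E_form w1])
  have zb: "\<bar>z x\<bar> \<le> 1" for x using w1b[of x] b by (simp add: z_def abs_mult)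
  define v where "v = (\<lambda>x. h x - z x)"
  have v: "v \<in> F" unfolding v_def by (rule form_diff[OF E_form hF z])
  have vb: "\<bar>v x\<bar> \<le> 2" for x using hb[of x] zb[of x] by (simp add: v_def)
  have uv: "AE x in m. x \<in> O' \<longrightarrow> u x = v x"
    using w1_eq
  proof eventually_elim
    case (elim x)
    show ?case
    proof
      assume x: "x \<in> O'"
      have "h x = 1" by (rule h1) (use O_ball[OF x] in auto)
      moreover have "\<psi> x / b < 1" using x b by (simp add: O'_def)
      ultimately show "u x = v x" using elim x by (simp add: u_def cutoff_def v_def z_def \<psi>_def max_def)
    qed
  qed
  let ?A = "O' \<inter> Xc"
  have A: "?A \<in> sets borel" by simp
  \<comment> \<open>Near \<open>O'\<close> the function \<open>h\<close> is constant, so the difference \<open>h - w1 / b\<close> has at most twice the energy of \<open>w1 / b\<close>.\<close>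
  have O_part: "measure (mu u) O' \<le> 2 / b\<^sup>2 * (M * measure m ?A)"
  proof -
    have "measure (mu u) O' = measure (mu u) ?A" by (rule energy_diffusion_set[OF u ub]) simp
    also have "\<dots> = measure (mu v) ?A"
      by (rule energy_local[OF u ub v vb O_rc uv A]) simp
    also have "\<dots> \<le> 2 * (measure (mu h) ?A + measure (mu z) ?A)"
      using energy_parallelogram[OF hF hb z zb A] measure_nonneg[of "mu (\<lambda>x. h x + z x)" ?A]
      unfolding v_def by linarith
    finally have 1: "measure (mu u) O' \<le> 2 * (measure (mu h) ?A + measure (mu z) ?A)" .
    have 2: "measure (mu h) ?A \<le> measure (mu h) (cball c (a + b))"
      using O_ball energy_sets[OF hF] by (intro finite_measure.finite_measure_mono[OF energy_finite[OF hF]]) auto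
    have 3: "measure (mu z) ?A = (1 / b)\<^sup>2 * measure (mu w1) ?A"
      unfolding z_def by (rule energy_scale[OF w1 w1b A])
    have 4: "measure (mu w1) ?A \<le> M * measure m ?A"
    proof -
      have "AE x in m. x \<in> O' \<longrightarrow> Gl \<psi> \<psi> x = Gc w1 w1 x"
        by (rule local_extension_eq[OF \<psi>F w1 O_rc w1_eq])
      moreover have "AE x in m. x \<in> Xc \<longrightarrow> Gl \<psi> \<psi> x \<le> M" using bound by (simp add: \<psi>_def[abs_def])
      ultimately have le: "AE x in m. indicator ?A x *\<^sub>R Gc w1 w1 x \<le> M * indicator ?A x"
        by eventually_elim (auto simp: indicator_def)
      have "emeasure m ?A \<le> emeasure m (cball c (a + b))"
        using O_ball by (intro emeasure_mono) auto
      then have fin: "emeasure m ?A < \<infinity>" using compact_finite[OF compact_cball, of c "a + b"] by simp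
      have "measure (mu w1) ?A = (\<integral>x. indicator ?A x *\<^sub>R Gc w1 w1 x \<partial>m)"
        using energy_density(1)[OF w1 w1b A] by (simp add: set_lebesgue_integral_def)
      also have "\<dots> \<le> (\<integral>x. M * indicator ?A x \<partial>m)"
        using le fin energy_density(2)[OF w1 w1b A]
        by (intro integral_mono_AE integrable_mult_indicator integrable_mult_right)
          (auto simp: integrable_indicator_iff)
      finally show ?thesis by simp
    qed
    have "2 * (measure (mu h) ?A + measure (mu z) ?A) \<le> 2 * (0 + (1 / b)\<^sup>2 * (M * measure m ?A))"
      using 2 4 unfolding 3 h0 by (intro mult_left_mono add_mono) auto
    with 1 show ?thesis by (simp add: power_divide)
  qed
  have out_part: "measure (mu u) {x. \<psi> x > b} = 0"
  proof -
    define G where "G n = {x. \<psi> x > b} \<inter> ball c (real n)" for n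
    have G_open: "open (G n)" for n
      unfolding G_def using \<psi>_cont by (intro open_Int open_Collect_less) auto
    have "measure (mu u) (G n) = 0" for n
    proof -
      have zero: "(\<lambda>x. 0) \<in> F" by (rule form_zero[OF E_form])
      have Gb: "G n \<in> sets borel" using G_open by simp
      have "measure (mu u) (G n) = measure (mu (\<lambda>x. 0)) (G n)"
      proof (rule energy_local[OF u ub zero, where C' = 0 and G = "G n"])
        show "relatively_compact_open (G n)"
          using G_open by (intro bounded_relatively_compact[of _ c "real n"]) (auto simp: G_def)
        show "AE x in m. x \<in> G n \<longrightarrow> u x = 0"
          by (intro AE_I2 impI) (simp add: u_def G_def \<psi>_def cutoff_eq_0[OF b])
      qed (use Gb in auto)
      also have "\<dots> = 0" using energy_scale[OF u ub Gb, of 0] by simp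
      finally show ?thesis .
    qed
    moreover have "(\<lambda>n. measure (mu u) (G n)) \<longlonglongrightarrow> measure (mu u) (\<Union>n. G n)"
      using G_open energy_sets[OF u]
      by (intro finite_measure.finite_Lim_measure_incseq[OF energy_finite[OF u]]) (auto simp: incseq_def G_def)
    moreover have "(\<Union>n. G n) = {x. \<psi> x > b}" using reals_Archimedean2 by (auto simp: G_def)
    ultimately show ?thesis using LIMSEQ_unique[OF tendsto_const] by fastforce
  qed
  have mid_part: "measure (mu u) {x. \<psi> x = b} = 0"
    by (rule energy_null[OF u ub]) (use null in \<open>simp add: \<psi>_def\<close>)
  have "closed {x. \<psi> x = b}" "open {x. \<psi> x > b}"
    using \<psi>_cont by (auto intro!: closed_Collect_eq open_Collect_less)
  then have sets3: "O' \<in> sets (mu u)" "{x. \<psi> x = b} \<in> sets (mu u)" "{x. \<psi> x > b} \<in> sets (mu u)"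
    using energy_sets[OF u] O_open by (auto intro: borel_closed)
  interpret mu_u: finite_measure "mu u" by (rule energy_finite[OF u])
  have UN: "UNIV = O' \<union> ({x. \<psi> x = b} \<union> {x. \<psi> x > b})" by (auto simp: O'_def)
  have "measure (mu u) UNIV \<le> measure (mu u) O' + measure (mu u) ({x. \<psi> x = b} \<union> {x. \<psi> x > b})"
    using sets3 by (subst UN) (intro measure_Un_le sets.Un)
  also have "measure (mu u) ({x. \<psi> x = b} \<union> {x. \<psi> x > b})
      \<le> measure (mu u) {x. \<psi> x = b} + measure (mu u) {x. \<psi> x > b}"
    using sets3 by (intro measure_Un_le)
  finally have "measure (mu u) UNIV \<le> 2 / b\<^sup>2 * (M * measure m ?A)"
    using O_part out_part mid_part by simp
  moreover have "measure m ?A \<le> measure m (cball c (a + b) \<inter> Xc)"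
  proof (rule measure_mono_fmeasurable)
    have "emeasure m (cball c (a + b) \<inter> Xc) \<le> emeasure m (cball c (a + b))" by (intro emeasure_mono) auto
    then show "cball c (a + b) \<inter> Xc \<in> fmeasurable m"
      using compact_finite[OF compact_cball, of c "a + b"] by (intro fmeasurableI) auto
  qed (use O_ball in auto)
  then have "2 / b\<^sup>2 * (M * measure m ?A) \<le> 2 / b\<^sup>2 * (M * measure m (cball c (a + b) \<inter> Xc))"
    using M b by (intro mult_left_mono) auto
  moreover have "Ec u u = measure (mu u) UNIV / 2"
    using Ec_eq_energy[OF u] polarized_energy[OF u ub, of UNIV] by simp
  ultimately have "Ec u u \<le> M / b\<^sup>2 * measure m (cball c (a + b) \<inter> Xc)" by simp
  then show ?thesis by (simp add: u_def)
qed

section \<open>Energy of cutoff functions: the jump part\<close>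

text \<open>Sections of a measurable set need not have measurable masses under a kernel without finiteness
  conditions. The integral of a function that is not measurable is the supremum over smaller
  simple functions, and this lower integral is still superadditive.\<close>

lemma nn_integral_superadditive:
  "integral\<^sup>N M f + integral\<^sup>N M g \<le> (\<integral>\<^sup>+x. f x + g x \<partial>M)"
proof -
  let ?S = "\<lambda>f. {s. simple_function M s \<and> s \<le> f}"
  have ne: "?S f \<noteq> {}" for f :: "'a \<Rightarrow> ennreal"
    by (auto intro!: exI[of _ "\<lambda>_. 0"] simp: le_fun_def)
  have "integral\<^sup>S M s + integral\<^sup>S M t \<le> (\<integral>\<^sup>+x. f x + g x \<partial>M)" if "s \<in> ?S f" "t \<in> ?S g" for s t
  proof -
    have "integral\<^sup>S M s + integral\<^sup>S M t = (\<integral>\<^sup>Sx. s x + t x \<partial>M)"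
      using that by (subst simple_integral_add) auto
    also have "\<dots> = (\<integral>\<^sup>+x. s x + t x \<partial>M)"
      using that by (intro nn_integral_eq_simple_integral[symmetric] simple_function_add) auto
    also have "\<dots> \<le> (\<integral>\<^sup>+x. f x + g x \<partial>M)"
      using that by (intro nn_integral_mono add_mono) (auto simp: le_fun_def)
    finally show ?thesis .
  qed
  then have "integral\<^sup>S M s + integral\<^sup>N M g \<le> (\<integral>\<^sup>+x. f x + g x \<partial>M)" if "s \<in> ?S f" for s
    unfolding nn_integral_def[of M g] using that ne[of g]
    by (subst ennreal_SUP_add_right) (auto intro!: SUP_least)
  then show ?thesis
    unfolding nn_integral_def[of M f] using ne[of f]
    by (subst ennreal_SUP_add_left[symmetric]) (auto intro!: SUP_least)
qed

lemma nn_integral_cmult_le: "c * integral\<^sup>N M f \<le> (\<integral>\<^sup>+x. c * f x \<partial>M)"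
proof -
  have "c * integral\<^sup>S M s \<le> (\<integral>\<^sup>+x. c * f x \<partial>M)" if "simple_function M s" "s \<le> f" for s
  proof -
    have "c * integral\<^sup>S M s = (\<integral>\<^sup>+x. c * s x \<partial>M)"
      using that by (simp add: nn_integral_eq_simple_integral[symmetric] nn_integral_cmult borel_measurable_simple_function)
    also have "\<dots> \<le> (\<integral>\<^sup>+x. c * f x \<partial>M)"
      using that by (intro nn_integral_mono mult_left_mono) (auto simp: le_fun_def)
    finally show ?thesis .
  qed
  then show ?thesis
    unfolding nn_integral_def[of M f] SUP_mult_left_ennreal by (auto intro!: SUP_least)
qed

lemma nn_integral_sum_le:
  "finite I \<Longrightarrow> (\<Sum>i\<in>I. integral\<^sup>N M (f i)) \<le> (\<integral>\<^sup>+x. (\<Sum>i\<in>I. f i x) \<partial>M)"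
proof (induction I rule: finite_induct)
  case (insert i I)
  then have "(\<Sum>i\<in>insert i I. integral\<^sup>N M (f i)) \<le> integral\<^sup>N M (f i) + (\<integral>\<^sup>+x. (\<Sum>i\<in>I. f i x) \<partial>M)"
    by (simp add: add_left_mono)
  also have "\<dots> \<le> (\<integral>\<^sup>+x. f i x + (\<Sum>i\<in>I. f i x) \<partial>M)" by (rule nn_integral_superadditive)
  finally show ?case using insert by simp
qed simp

text \<open>The hypothesis concerns sets, hence simple functions; superadditivity sums it over the level sets
  of a simple function below \<open>G\<close>.\<close>

lemma nn_integral_kernel_le:
  fixes J :: "'b measure" and \<kappa> :: "'a \<Rightarrow> 'c measure"
  assumes J: "\<And>A. A \<in> sets J \<Longrightarrow> emeasure J A = (\<integral>\<^sup>+x. emeasure (\<kappa> x) (D x \<inter> s x -` A) \<partial>m)"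
    and spaces: "space J = UNIV" "\<And>x. space (\<kappa> x) = UNIV"
    and meas: "\<And>x. s x \<in> \<kappa> x \<rightarrow>\<^sub>M J" "\<And>x. D x \<in> sets (\<kappa> x)"
  shows "integral\<^sup>N J G \<le> (\<integral>\<^sup>+x. \<integral>\<^sup>+y. G (s x y) * indicator (D x) y \<partial>\<kappa> x \<partial>m)"
  unfolding nn_integral_def[of J G]
proof (rule SUP_least)
  fix g assume "g \<in> {g. simple_function J g \<and> g \<le> G}"
  then have g: "simple_function J g" "\<And>z. g z \<le> G z" by (auto simp: le_fun_def)
  have sec: "D x \<inter> s x -` (g -` {v}) \<in> sets (\<kappa> x)" for x v
  proof -
    have "s x -` (g -` {v} \<inter> space J) \<inter> space (\<kappa> x) \<in> sets (\<kappa> x)"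
      using meas(1) simple_functionD(2)[OF g(1)] by (rule measurable_sets)
    then show ?thesis using meas(2) spaces by auto
  qed
  have fin: "finite (range g)" using simple_functionD(1)[OF g(1)] by (simp add: spaces)
  have "integral\<^sup>S J g = (\<Sum>v\<in>range g. v * emeasure J (g -` {v}))"
    by (simp add: simple_integral_def spaces)
  also have "\<dots> = (\<Sum>v\<in>range g. v * (\<integral>\<^sup>+x. emeasure (\<kappa> x) (D x \<inter> s x -` (g -` {v})) \<partial>m))"
    using simple_functionD(2)[OF g(1)] by (intro sum.cong refl arg_cong2[where f = "(*)"] J) (simp add: spaces)
  also have "\<dots> \<le> (\<Sum>v\<in>range g. \<integral>\<^sup>+x. v * emeasure (\<kappa> x) (D x \<inter> s x -` (g -` {v})) \<partial>m)"
    by (intro sum_mono nn_integral_cmult_le)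
  also have "\<dots> \<le> (\<integral>\<^sup>+x. (\<Sum>v\<in>range g. v * emeasure (\<kappa> x) (D x \<inter> s x -` (g -` {v}))) \<partial>m)"
    using fin by (rule nn_integral_sum_le)
  also have "\<dots> \<le> (\<integral>\<^sup>+x. \<integral>\<^sup>+y. G (s x y) * indicator (D x) y \<partial>\<kappa> x \<partial>m)"
  proof (rule nn_integral_mono)
    fix x
    have "(\<Sum>v\<in>range g. v * emeasure (\<kappa> x) (D x \<inter> s x -` (g -` {v})))
        = (\<Sum>v\<in>range g. \<integral>\<^sup>+y. v * indicator (D x \<inter> s x -` (g -` {v})) y \<partial>\<kappa> x)"
      using sec by (simp add: nn_integral_cmult_indicator)
    also have "\<dots> = (\<integral>\<^sup>+y. (\<Sum>v\<in>range g. v * indicator (D x \<inter> s x -` (g -` {v})) y) \<partial>\<kappa> x)"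
      using sec by (intro nn_integral_sum[symmetric]) auto
    also have "\<dots> \<le> (\<integral>\<^sup>+y. G (s x y) * indicator (D x) y \<partial>\<kappa> x)"
    proof (rule nn_integral_mono)
      fix y
      have "(\<Sum>v\<in>range g. v * indicator (D x \<inter> s x -` (g -` {v})) y)
          = (\<Sum>v\<in>range g. if v = g (s x y) then v * indicator (D x) y else 0)"
        by (intro sum.cong refl) (auto simp: indicator_def)
      also have "\<dots> = g (s x y) * indicator (D x) y" using fin by (subst sum.delta) auto
      also have "\<dots> \<le> G (s x y) * indicator (D x) y" using g(2) by (intro mult_right_mono) auto
      finally show "(\<Sum>v\<in>range g. v * indicator (D x \<inter> s x -` (g -` {v})) y) \<le> G (s x y) * indicator (D x) y" .
    qed
    finally show "(\<Sum>v\<in>range g. v * emeasure (\<kappa> x) (D x \<inter> s x -` (g -` {v})))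
        \<le> (\<integral>\<^sup>+y. G (s x y) * indicator (D x) y \<partial>\<kappa> x)" .
  qed
  finally show "integral\<^sup>S J g \<le> (\<integral>\<^sup>+x. \<integral>\<^sup>+y. G (s x y) * indicator (D x) y \<partial>\<kappa> x \<partial>m)" .
qed

context jump_diffusion
begin

lemma kernel_sets: "sets (j x) = sets borel"
  and kernel_measurable: "A \<in> sets borel \<Longrightarrow> (\<lambda>x. emeasure (j x) A) \<in> borel_measurable borel"
  using kernel by (auto simp: jump_kernel_def)

lemma sets_J: "sets J = sets borel"
  using decomposition by (simp add: beurling_deny_def radon_on_def)

text \<open>The space is separable, so the complement of a point is a countable union of balls taken from a
  countable family that does not depend on the point.\<close>

lemma jump_set_borel: "jump_set j \<in> sets borel"
proof -
  fix o' :: 'a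
  have "\<exists>D. finite D \<and> cball o' (real n) \<subseteq> (\<Union>x\<in>D. ball x (1 / real (Suc k)))" for n k
  proof -
    have "cball o' (real n) \<subseteq> (\<Union>x\<in>cball o' (real n). ball x (1 / real (Suc k)))" by force
    then show ?thesis
      using compactE_image[OF compact_cball[of o' "real n"], of "cball o' (real n)" "\<lambda>x. ball x (1 / real (Suc k))"]
      by (metis open_ball)
  qed
  then obtain D where D: "\<And>n k. finite (D n k)"
    "\<And>n k. cball o' (real n) \<subseteq> (\<Union>x\<in>D n k. ball x (1 / real (Suc k)))" by metis
  define I where "I = (\<Union>n k. (\<lambda>c. (c, k)) ` D n k)"
  have I: "countable I" unfolding I_def using D(1) by (intro countable_UN) (auto intro: countable_finite)
  have cover: "- {x} = (\<Union>(c, k)\<in>{(c, k) \<in> I. 1 / real (Suc k) \<le> dist c x}. ball c (1 / real (Suc k)))" for x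
  proof (intro equalityI subsetI)
    fix y assume y: "y \<in> - {x}"
    then have "dist x y / 2 > 0" by simp
    then obtain k where k: "1 / real (Suc k) < dist x y / 2" using nat_approx_posE by blast
    obtain n where "dist o' y \<le> real n" using real_arch_simple by blast
    then have "y \<in> cball o' (real n)" by simp
    with D(2) obtain c where c: "c \<in> D n k" "y \<in> ball c (1 / real (Suc k))" by blast
    have "1 / real (Suc k) \<le> dist c x"
      using c(2) k dist_triangle[of x y c] by (simp add: dist_commute del: of_nat_Suc)
    with c show "y \<in> (\<Union>(c, k)\<in>{(c, k) \<in> I. 1 / real (Suc k) \<le> dist c x}. ball c (1 / real (Suc k)))"
      unfolding I_def by blast
  qed auto
  have "jump_set j = (\<Union>(c, k)\<in>I. {x. 1 / real (Suc k) \<le> dist c x} \<inter> {x. 0 < emeasure (j x) (ball c (1 / real (Suc k)))})"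
  proof (intro equalityI subsetI)
    fix x assume x: "x \<in> jump_set j"
    show "x \<in> (\<Union>(c, k)\<in>I. {x. 1 / real (Suc k) \<le> dist c x} \<inter> {x. 0 < emeasure (j x) (ball c (1 / real (Suc k)))})"
    proof (rule ccontr)
      assume no: "\<not> ?thesis"
      have "- {x} \<in> null_sets (j x)"
        unfolding cover[of x]
      proof (rule null_sets_UN')
        show "countable {(c, k) \<in> I. 1 / real (Suc k) \<le> dist c x}"
          by (rule countable_subset[OF _ I]) auto
        fix p assume "p \<in> {(c, k) \<in> I. 1 / real (Suc k) \<le> dist c x}"
        then obtain c k where p: "p = (c, k)" "(c, k) \<in> I" "1 / real (Suc k) \<le> dist c x" by blast
        then have "\<not> 0 < emeasure (j x) (ball c (1 / real (Suc k)))" using no by blast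
        then show "(case p of (c, k) \<Rightarrow> ball c (1 / real (Suc k))) \<in> null_sets (j x)"
          using kernel_sets[of x] by (simp add: p(1) null_sets_def)
      qed
      then show False using x by (simp add: jump_set_def null_sets_def)
    qed
  next
    fix x assume "x \<in> (\<Union>(c, k)\<in>I. {x. 1 / real (Suc k) \<le> dist c x} \<inter> {x. 0 < emeasure (j x) (ball c (1 / real (Suc k)))})"
    then obtain c k where ck: "1 / real (Suc k) \<le> dist c x" "0 < emeasure (j x) (ball c (1 / real (Suc k)))" by blast
    have "emeasure (j x) (ball c (1 / real (Suc k))) \<le> emeasure (j x) (- {x})"
      using ck(1) kernel_sets[of x] by (intro emeasure_mono) auto
    then show "x \<in> jump_set j" using ck(2) by (simp add: jump_set_def)
  qed
  also have "\<dots> \<in> sets borel"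
  proof (rule sets.countable_UN'[OF I], clarify)
    fix c :: 'a and k
    have "closed {x. 1 / real (Suc k) \<le> dist c x}" by (intro closed_Collect_le continuous_intros)
    moreover have "{x. 0 < emeasure (j x) (ball c (1 / real (Suc k)))} \<in> sets borel"
      using kernel_measurable[of "ball c (1 / real (Suc k))"] by simp
    ultimately show "{x. 1 / real (Suc k) \<le> dist c x} \<inter> {x. 0 < emeasure (j x) (ball c (1 / real (Suc k)))} \<in> sets borel"
      by auto
  qed
  finally show ?thesis .
qed

text \<open>The increment of the cutoff is at most \<open>min (d(x, y) / b) 1\<close>, and is 0 unless \<open>x\<close> or \<open>y\<close> lies in the ball of
  radius \<open>a + b\<close>. The two cases contribute equally, since \<open>J\<close> disintegrates along either coordinate.\<close>

lemma cutoff_jump_energy: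
  assumes a: "a \<ge> 0" and b: "b > 0"
  shows "(\<integral>\<^sup>+(x, y). ennreal ((cutoff (cball c a) b x - cutoff (cball c a) b y)\<^sup>2) \<partial>J)
    \<le> ennreal (2 / b\<^sup>2) * (volume m (jump_set j) c (a + b) * omega j b)"
proof -
  define u where "u = cutoff (cball c a) b"
  define B where "B = cball c (a + b)"
  define q where "q x y = ennreal ((min (dist x y) b)\<^sup>2 / b\<^sup>2)" for x y :: 'a
  have u_out: "u x = 0" if "x \<notin> B" for x
    unfolding u_def
  proof (rule cutoff_eq_0[OF b])
    show "b \<le> infdist x (cball c a)" using that dist_le_infdist_cball[OF a, of c x] by (simp add: B_def)
  qed
  have u_diff: "\<bar>u x - u y\<bar> \<le> min (dist x y) b / b" for x y
  proof -
    have "\<bar>u x - u y\<bar> \<le> 1"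
      using cutoff_bounds[OF b, of "cball c a" x] cutoff_bounds[OF b, of "cball c a" y] by (simp add: u_def)
    moreover have "\<bar>u x - u y\<bar> \<le> \<bar>infdist x (cball c a) / b - infdist y (cball c a) / b\<bar>"
      unfolding u_def cutoff_def by linarith
    moreover have "\<bar>infdist x (cball c a) / b - infdist y (cball c a) / b\<bar> \<le> dist x y / b"
      unfolding diff_divide_distrib[symmetric] abs_divide
      using b infdist_triangle_abs[of x "cball c a" y] by (simp add: divide_right_mono)
    ultimately show ?thesis using b by (simp add: min_def)
  qed
  have u_le: "ennreal ((u x - u y)\<^sup>2) \<le> q x y * indicator B x + q x y * indicator B y" for x y
  proof (cases "x \<in> B \<or> y \<in> B")
    case True
    have "\<bar>u x - u y\<bar>\<^sup>2 \<le> (min (dist x y) b / b)\<^sup>2" by (intro power_mono u_diff) simp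
    then have "ennreal ((u x - u y)\<^sup>2) \<le> q x y" by (simp add: q_def power_divide ennreal_leI)
    then show ?thesis
      using True by (cases "x \<in> B"; cases "y \<in> B") (auto intro: add_increasing2)
  qed (simp add: u_out)
  have jB: "jump_set j \<inter> B \<in> sets m" using jump_set_borel by (simp add: B_def)
  have section_bound: "(\<integral>\<^sup>+y. q x y * indicator B x * indicator (- {x}) y \<partial>j x)
      \<le> ennreal (1 / b\<^sup>2) * omega j b * indicator (jump_set j \<inter> B) x" for x
  proof (cases "x \<in> jump_set j \<inter> B")
    case True
    have [measurable]: "dist x \<in> borel_measurable borel"
      by (intro borel_measurable_continuous_onI continuous_intros)
    have [measurable]: "indicator (- {x}) \<in> borel_measurable (borel :: 'a measure)"
      by (intro borel_measurable_indicator) auto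
    have meas: "(\<lambda>y. ennreal ((min (dist x y) b)\<^sup>2) * indicator (- {x}) y) \<in> borel_measurable (j x)"
      unfolding measurable_cong_sets[OF kernel_sets refl] by measurable
    have "(\<integral>\<^sup>+y. q x y * indicator B x * indicator (- {x}) y \<partial>j x)
        = (\<integral>\<^sup>+y. ennreal (1 / b\<^sup>2) * (ennreal ((min (dist x y) b)\<^sup>2) * indicator (- {x}) y) \<partial>j x)"
      using True by (intro nn_integral_cong) (simp add: q_def ennreal_mult'[symmetric] mult.assoc[symmetric])
    also have "\<dots> = ennreal (1 / b\<^sup>2) * (\<integral>\<^sup>+y. ennreal ((min (dist x y) b)\<^sup>2) * indicator (- {x}) y \<partial>j x)"
      using meas by (rule nn_integral_cmult)
    also have "\<dots> \<le> ennreal (1 / b\<^sup>2) * omega j b"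
      unfolding omega_def using True by (intro mult_left_mono SUP_upper) auto
    finally show ?thesis using True by simp
  next
    case False
    show ?thesis
    proof (cases "x \<in> B")
      case True
      with False have "emeasure (j x) (- {x}) = 0" by (simp add: jump_set_def)
      then have "AE y in j x. y \<notin> - {x}"
        using kernel_sets[of x] by (intro AE_not_in) (simp add: null_sets_def)
      then have "(\<integral>\<^sup>+y. q x y * indicator B x * indicator (- {x}) y \<partial>j x) = (\<integral>\<^sup>+y. 0 \<partial>j x)"
        by (intro nn_integral_cong_AE) (auto elim: eventually_mono)
      then show ?thesis by simp
    qed simp
  qed
  have total: "(\<integral>\<^sup>+x. \<integral>\<^sup>+y. q x y * indicator B x * indicator (- {x}) y \<partial>j x \<partial>m)
      \<le> ennreal (1 / b\<^sup>2) * (volume m (jump_set j) c (a + b) * omega j b)"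
  proof -
    have "(\<integral>\<^sup>+x. \<integral>\<^sup>+y. q x y * indicator B x * indicator (- {x}) y \<partial>j x \<partial>m)
        \<le> (\<integral>\<^sup>+x. ennreal (1 / b\<^sup>2) * omega j b * indicator (jump_set j \<inter> B) x \<partial>m)"
      by (intro nn_integral_mono section_bound)
    also have "\<dots> = ennreal (1 / b\<^sup>2) * omega j b * emeasure m (jump_set j \<inter> B)"
      using jB by (rule nn_integral_cmult_indicator)
    finally show ?thesis by (simp add: volume_def B_def Int_commute mult_ac)
  qed
  have spJ: "space J = UNIV" using sets_eq_imp_space_eq[OF sets_J] by simp
  have spj: "space (j x) = UNIV" for x using sets_eq_imp_space_eq[OF kernel_sets[of x]] by simp
  have cont: "(\<lambda>y. (x, y)) \<in> j x \<rightarrow>\<^sub>M J" "(\<lambda>y. (y, x)) \<in> j x \<rightarrow>\<^sub>M J" for x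
    unfolding measurable_cong_sets[OF kernel_sets[of x] sets_J]
    by (intro borel_measurable_continuous_onI continuous_intros)+
  have J1: "emeasure J A = (\<integral>\<^sup>+x. emeasure (j x) (- {x} \<inter> (\<lambda>y. (x, y)) -` A) \<partial>m)"
    and J2: "emeasure J A = (\<integral>\<^sup>+x. emeasure (j x) (- {x} \<inter> (\<lambda>y. (y, x)) -` A) \<partial>m)" if "A \<in> sets J" for A
  proof -
    have "- {x} \<inter> (\<lambda>y. (x, y)) -` A = {y. y \<noteq> x \<and> (x, y) \<in> A}"
      "- {x} \<inter> (\<lambda>y. (y, x)) -` A = {y. y \<noteq> x \<and> (y, x) \<in> A}" for x by auto
    then show "emeasure J A = (\<integral>\<^sup>+x. emeasure (j x) (- {x} \<inter> (\<lambda>y. (x, y)) -` A) \<partial>m)"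
      "emeasure J A = (\<integral>\<^sup>+x. emeasure (j x) (- {x} \<inter> (\<lambda>y. (y, x)) -` A) \<partial>m)"
      using kernel that sets_J by (auto simp: jump_kernel_def)
  qed
  have D: "- {x} \<in> sets (j x)" for x using kernel_sets[of x] by simp
  have q_meas: "(\<lambda>p. q (fst p) (snd p) * indicator B (fst p)) \<in> borel_measurable J"
    "(\<lambda>p. q (fst p) (snd p) * indicator B (snd p)) \<in> borel_measurable J"
  proof -
    have [measurable]: "(\<lambda>p::'a \<times> 'a. dist (fst p) (snd p)) \<in> borel_measurable borel"
      by (intro borel_measurable_continuous_onI continuous_intros)
    have "closed {p::'a \<times> 'a. fst p \<in> B}" "closed {p::'a \<times> 'a. snd p \<in> B}"
      unfolding B_def mem_cball by (intro closed_Collect_le continuous_intros)+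
    then have [measurable]: "Measurable.pred borel (\<lambda>p::'a \<times> 'a. fst p \<in> B)"
      "Measurable.pred borel (\<lambda>p::'a \<times> 'a. snd p \<in> B)"
      by (auto simp: pred_def)
    show "(\<lambda>p. q (fst p) (snd p) * indicator B (fst p)) \<in> borel_measurable J"
      "(\<lambda>p. q (fst p) (snd p) * indicator B (snd p)) \<in> borel_measurable J"
      unfolding q_def measurable_cong_sets[OF sets_J refl] by measurable
  qed
  have "(\<integral>\<^sup>+(x, y). ennreal ((u x - u y)\<^sup>2) \<partial>J)
      \<le> (\<integral>\<^sup>+p. q (fst p) (snd p) * indicator B (fst p) + q (fst p) (snd p) * indicator B (snd p) \<partial>J)"
    by (intro nn_integral_mono) (auto simp: u_le)
  also have "\<dots> = (\<integral>\<^sup>+p. q (fst p) (snd p) * indicator B (fst p) \<partial>J) + (\<integral>\<^sup>+p. q (fst p) (snd p) * indicator B (snd p) \<partial>J)"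
    using q_meas by (rule nn_integral_add)
  also have "\<dots> \<le> ennreal (1 / b\<^sup>2) * (volume m (jump_set j) c (a + b) * omega j b)
      + ennreal (1 / b\<^sup>2) * (volume m (jump_set j) c (a + b) * omega j b)"
  proof (rule add_mono)
    have "(\<integral>\<^sup>+p. q (fst p) (snd p) * indicator B (fst p) \<partial>J)
        \<le> (\<integral>\<^sup>+x. \<integral>\<^sup>+y. q (fst (x, y)) (snd (x, y)) * indicator B (fst (x, y)) * indicator (- {x}) y \<partial>j x \<partial>m)"
      by (rule nn_integral_kernel_le[where s = "\<lambda>x y. (x, y)", OF J1 spJ spj cont(1) D])
    with total show "(\<integral>\<^sup>+p. q (fst p) (snd p) * indicator B (fst p) \<partial>J)
        \<le> ennreal (1 / b\<^sup>2) * (volume m (jump_set j) c (a + b) * omega j b)" by simp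
    have "(\<integral>\<^sup>+p. q (fst p) (snd p) * indicator B (snd p) \<partial>J)
        \<le> (\<integral>\<^sup>+x. \<integral>\<^sup>+y. q (fst (y, x)) (snd (y, x)) * indicator B (snd (y, x)) * indicator (- {x}) y \<partial>j x \<partial>m)"
      by (rule nn_integral_kernel_le[where s = "\<lambda>x y. (y, x)", OF J2 spJ spj cont(2) D])
    with total show "(\<integral>\<^sup>+p. q (fst p) (snd p) * indicator B (snd p) \<partial>J)
        \<le> ennreal (1 / b\<^sup>2) * (volume m (jump_set j) c (a + b) * omega j b)"
      by (simp add: q_def dist_commute)
  qed
  also have "\<dots> = (ennreal (1 / b\<^sup>2) + ennreal (1 / b\<^sup>2)) * (volume m (jump_set j) c (a + b) * omega j b)"
    by (simp only: distrib_right)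
  also have "ennreal (1 / b\<^sup>2) + ennreal (1 / b\<^sup>2) = ennreal (2 / b\<^sup>2)"
    by (simp flip: ennreal_plus)
  finally show ?thesis by (simp add: u_def)
qed

end

section \<open>Recurrence from the growth condition\<close>

context jump_diffusion
begin

lemma E_decomposition:
  assumes u: "u \<in> C0 \<inter> F"
  shows "integrable J (\<lambda>(x, y). (u x - u y) * (u x - u y))"
    and "E u u = Ec u u + (\<integral>(x, y). (u x - u y) * (u x - u y) \<partial>J)"
proof -
  have uF: "u \<in> F" and cont: "continuous_on UNIV u" using u by (auto simp: C0_def)
  \<comment> \<open>A continuous function is its own quasi-continuous version, with empty exceptional sets.\<close>
  have cap: "capacity m F E {} = 0"
  proof -
    have "capacity m F E {} \<le> ennreal (form1 m E (\<lambda>x. 0) (\<lambda>x. 0))"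
      unfolding capacity_def using form_zero[OF E_form] by (intro INF_lower) auto
    also have "form1 m E (\<lambda>x. 0) (\<lambda>x. 0) = 0" by (rule form_zero_left[OF form1_form form_zero[OF E_form]])
    finally show ?thesis by simp
  qed
  have qc: "quasi_continuous_version m F E u u"
    unfolding quasi_continuous_version_def
    using borel_measurable_continuous_onI[OF cont] continuous_on_subset[OF cont] cap
    by (auto intro!: exI[of _ "{}"])
  note D = decomposition[unfolded beurling_deny_def, THEN conjunct2, THEN conjunct2, THEN conjunct2,
      THEN conjunct2, THEN conjunct2, rule_format, OF F_subset_extended F_subset_extended, OF uF uF,
      OF conjI[OF qc qc]]
  show "integrable J (\<lambda>(x, y). (u x - u y) * (u x - u y))" using D by blast
  have "integral\<^sup>L (null_measure borel) (\<lambda>x. u x * u x) = 0"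
    by (intro integral_eq_zero_AE AE_I[where N = UNIV]) auto
  then show "E u u = Ec u u + (\<integral>(x, y). (u x - u y) * (u x - u y) \<partial>J)"
    using D Ee_eq_E[OF uF uF] by simp
qed

lemma jump_energy_nn_integral:
  assumes u: "u \<in> C0 \<inter> F"
  shows "ennreal (E u u) = ennreal (Ec u u) + (\<integral>\<^sup>+(x, y). ennreal ((u x - u y)\<^sup>2) \<partial>J)"
proof -
  have "(\<integral>\<^sup>+(x, y). ennreal ((u x - u y)\<^sup>2) \<partial>J) = ennreal (\<integral>(x, y). (u x - u y) * (u x - u y) \<partial>J)"
    using nn_integral_eq_integral[OF E_decomposition(1)[OF u]]
    by (simp add: case_prod_unfold power2_eq_square)
  moreover have "0 \<le> (\<integral>(x, y). (u x - u y) * (u x - u y) \<partial>J)"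
    by (intro integral_nonneg_AE) (simp add: case_prod_unfold)
  moreover have "0 \<le> Ec u u" using form_nonneg[OF Ec_form] u by simp
  ultimately show ?thesis using E_decomposition(2)[OF u] by (simp add: ennreal_plus)
qed

text \<open>A finite measure on the line, here the image of \<open>m\<close> on a ball, has only countably many atoms.\<close>

lemma sphere_null:
  assumes "r1 < r2" and a: "a \<ge> 0"
  obtains b where "r1 < b" "b < r2" "{x. infdist x (cball c a) = b} \<in> null_sets m"
proof -
  define \<psi> where "\<psi> x = infdist x (cball c a)" for x
  have \<psi>_cont: "continuous_on UNIV \<psi>" unfolding \<psi>_def[abs_def] by (intro continuous_intros)
  define B where "B = cball c (\<bar>a\<bar> + \<bar>r2\<bar>)"
  have \<psi>m: "\<psi> \<in> borel_measurable (restrict_space m B)"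
    using borel_measurable_continuous_onI[OF \<psi>_cont] by (intro measurable_restrict_space1) simp
  define M where "M = distr (restrict_space m B) borel \<psi>"
  have em: "emeasure M X = emeasure m (\<psi> -` X \<inter> B)" if "X \<in> sets borel" for X
    unfolding M_def using that \<psi>m
    by (simp add: emeasure_distr space_restrict_space emeasure_restrict_space B_def)
  interpret M: finite_measure M
  proof
    have "emeasure M (space M) \<le> emeasure m B"
      using em[of UNIV] by (simp add: M_def B_def)
    then show "emeasure M (space M) \<noteq> \<infinity>"
      using compact_finite[OF compact_cball, of c "\<bar>a\<bar> + \<bar>r2\<bar>"] by (auto simp: B_def top_unique)
  qed
  obtain b where b: "b \<in> {r1<..<r2}" "b \<notin> {x. measure M {x} \<noteq> 0}"
    using open_minus_countable[OF M.countable_support, of "{r1<..<r2}"] assms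
    by (metis greaterThanLessThan_empty_iff not_le open_greaterThanLessThan)
  have "emeasure M {b} = 0" using b(2) by (simp add: M.emeasure_eq_measure)
  then have "emeasure m (\<psi> -` {b} \<inter> B) = 0" using em[of "{b}"] by simp
  moreover have "\<psi> -` {b} \<inter> B = {x. \<psi> x = b}"
  proof -
    have "x \<in> B" if "\<psi> x = b" for x
      using dist_le_infdist_cball[OF a, of c x] that b(1) a abs_ge_self[of r2]
      by (simp add: \<psi>_def B_def)
    then show ?thesis by auto
  qed
  ultimately have "emeasure m {x. \<psi> x = b} = 0" by simp
  moreover have "closed {x. \<psi> x = b}" using \<psi>_cont by (intro closed_Collect_eq) auto
  ultimately have "{x. \<psi> x = b} \<in> null_sets m" by (simp add: null_sets_def borel_closed)
  then show ?thesis using that[of b] b(1) by (simp add: \<psi>_def)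
qed

lemma cutoff_energy:
  assumes a: "a \<ge> 0" and b: "b > 0" and M: "M \<ge> 0"
    and bound: "AE x in m. x \<in> Xc \<longrightarrow> Gl (\<lambda>z. infdist z (cball c a)) (\<lambda>z. infdist z (cball c a)) x \<le> M"
    and null: "{x. infdist x (cball c a) = b} \<in> null_sets m"
  shows "ennreal (E (cutoff (cball c a) b) (cutoff (cball c a) b))
    \<le> ennreal (M / b\<^sup>2) * volume m Xc c (a + b)
      + ennreal (2 / b\<^sup>2) * (volume m (jump_set j) c (a + b) * omega j b)"
proof -
  have ne: "cball c a \<noteq> {}" using a by auto
  have fin: "emeasure m (cball c (a + b) \<inter> Xc) \<noteq> \<infinity>"
  proof -
    have "emeasure m (cball c (a + b) \<inter> Xc) \<le> emeasure m (cball c (a + b))"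
      by (intro emeasure_mono) auto
    then show ?thesis using compact_finite[OF compact_cball, of c "a + b"] by (auto simp: top_unique)
  qed
  have "ennreal (Ec (cutoff (cball c a) b) (cutoff (cball c a) b))
      \<le> ennreal (M / b\<^sup>2 * measure m (cball c (a + b) \<inter> Xc))"
    by (intro ennreal_leI cutoff_local_energy assms)
  also have "\<dots> = ennreal (M / b\<^sup>2) * volume m Xc c (a + b)"
    using fin M b by (simp add: volume_def emeasure_eq_ennreal_measure ennreal_mult'[symmetric])
  finally show ?thesis
    unfolding jump_energy_nn_integral[OF cutoff_F[OF compact_cball ne b]]
    using cutoff_jump_energy[OF a b] by (rule add_mono)
qed

text \<open>Convex combinations \<open>g n\<close> of the tails are Cauchy in energy. Compare a fixed \<open>g n\<close>, whose support is
  compact, with \<open>g k\<close> for large \<open>k\<close>, which is 1 near that support: the strongly local energy of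
  \<open>g n - g k\<close> is at least that of \<open>g n\<close>, and the increments of \<open>g n - g k\<close> converge to those of \<open>g n\<close>,
  so that Fatou's lemma applies to the jump part.\<close>

lemma energy_vanishing_plateaus:
  assumes u: "\<And>n. u n \<in> C0 \<inter> F" "\<And>n. E (u n) (u n) \<le> C"
    and u01: "\<And>n x. 0 \<le> u n x \<and> u n x \<le> 1"
    and u1: "\<And>n x. dist c x \<le> real n \<Longrightarrow> u n x = 1"
  obtains g where "\<And>n. g n \<in> F" "\<And>n x. 0 \<le> g n x \<and> g n x \<le> 1" "\<And>x. (\<lambda>n. g n x) \<longlonglongrightarrow> 1"
    "(\<lambda>n. E (g n) (g n)) \<longlonglongrightarrow> 0"
proof -
  have uF: "u n \<in> F" for n using u(1) by simp
  obtain g where g: "\<And>n. g n \<in> tail_hull u n" and cauchy: "form_cauchy E g"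
    using tail_hull_cauchy[OF E_form, of u C] uF u(2) by metis
  have hull: "v \<in> C0 \<inter> F \<and> (\<forall>x. 0 \<le> v x \<and> v x \<le> 1) \<and> (\<forall>x. dist c x \<le> real n \<longrightarrow> v x = 1)"
    if "v \<in> tail_hull u n" for v n
    using that
  proof (induction rule: tail_hull.induct)
    case (base k)
    then show ?case using u(1)[of k] u01[of k] u1[of _ k] by auto
  next
    case (combine v w t)
    have "(\<lambda>x. t * v x + (1 - t) * w x) \<in> C0 \<inter> F"
      using combine C0_combination[OF proper, of v w t "1 - t"] form_combination[OF E_form, of v w t "1 - t"]
      by simp
    moreover have "0 \<le> t * v x + (1 - t) * w x \<and> t * v x + (1 - t) * w x \<le> 1" for x
    proof
      show "0 \<le> t * v x + (1 - t) * w x"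
        using combine by (intro add_nonneg_nonneg mult_nonneg_nonneg) auto
      have "t * v x + (1 - t) * w x \<le> t * 1 + (1 - t) * 1"
        using combine by (intro add_mono mult_left_mono) auto
      then show "t * v x + (1 - t) * w x \<le> 1" by simp
    qed
    moreover have "t * v x + (1 - t) * w x = 1" if "dist c x \<le> real n" for x
      using combine that by simp
    ultimately show ?case by simp
  qed
  have gC: "g n \<in> C0 \<inter> F" and g01: "0 \<le> g n x \<and> g n x \<le> 1"
    and g1: "dist c x \<le> real n \<Longrightarrow> g n x = 1" for n x
    using hull[OF g[of n]] by auto
  then have gF: "g n \<in> F" for n by simp
  have lim: "(\<lambda>n. g n x) \<longlonglongrightarrow> 1" for x
  proof -
    obtain N where "dist c x \<le> real N" using real_arch_simple by blast
    then have "g n x = 1" if "n \<ge> N" for n using that by (intro g1) auto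
    then show ?thesis by (intro tendsto_eventually) (auto simp: eventually_sequentially)
  qed
  have small: "\<exists>N. \<forall>n\<ge>N. E (g n) (g n) \<le> e" if e: "e > 0" for e
  proof -
    obtain N where N: "\<And>i k. i \<ge> N \<Longrightarrow> k \<ge> N \<Longrightarrow> E (\<lambda>x. g i x - g k x) (\<lambda>x. g i x - g k x) < e"
      using cauchy[unfolded form_cauchy_def, rule_format, OF e] by blast
    have "E (g n) (g n) \<le> e" if n: "n \<ge> N" for n
    proof -
      define d where "d k = (\<lambda>x. g n x - g k x)" for k
      have dC: "d k \<in> C0 \<inter> F" for k
        unfolding d_def using C0_combination[OF proper, of "g n" "g k" 1 "-1"] gC form_diff[OF E_form gF gF] by simp
      define D where "D v = (\<lambda>p. ennreal ((v (fst p) - v (snd p))\<^sup>2))" for v :: "'a \<Rightarrow> real"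
      have D_meas: "D v \<in> borel_measurable J" if "v \<in> C0" for v
      proof -
        have cv: "continuous_on UNIV v" using that by (simp add: C0_def)
        have "continuous_on UNIV (\<lambda>p::'a \<times> 'a. (v (fst p) - v (snd p))\<^sup>2)"
          by (intro continuous_intros continuous_on_compose2[OF cv]) auto
        then have "(\<lambda>p::'a \<times> 'a. (v (fst p) - v (snd p))\<^sup>2) \<in> borel_measurable borel"
          by (rule borel_measurable_continuous_onI)
        then show ?thesis
          unfolding D_def measurable_cong_sets[OF sets_J refl] by measurable
      qed
      obtain R where R: "\<forall>x. R < dist c x \<longrightarrow> g n x = 0"
        using gC[of n] C0_iff_bounded[of "g n" c] by blast
      have Ec_le: "Ec (g n) (g n) \<le> Ec (d k) (d k)" if k: "real k > R" for k
      proof -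
        have "closure {x. g n x \<noteq> 0} \<subseteq> cball c R"
          using R by (intro closure_minimal) (auto simp: not_less[symmetric])
        then have "closure {x. g n x \<noteq> 0} \<subseteq> ball c (real k)" using k by (auto simp: subset_iff)
        then have "Ec (g n) (g k) = 0"
          by (intro Ec_local[OF gC gC, of "ball c (real k)" n k 1]) (auto intro: g1)
        then show ?thesis
          unfolding d_def form_square_diff[OF Ec_form gF gF] using form_nonneg[OF Ec_form gF] by simp
      qed
      have "ennreal (E (g n) (g n)) = ennreal (Ec (g n) (g n)) + (\<integral>\<^sup>+p. D (g n) p \<partial>J)"
        using jump_energy_nn_integral[OF gC] by (simp add: D_def case_prod_unfold)
      also have "(\<integral>\<^sup>+p. D (g n) p \<partial>J) \<le> (\<integral>\<^sup>+p. liminf (\<lambda>k. D (d k) p) \<partial>J)"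
      proof (rule nn_integral_mono)
        fix p :: "'a \<times> 'a"
        obtain K where K: "dist c (fst p) \<le> real K" "dist c (snd p) \<le> real K"
          using real_arch_simple[of "max (dist c (fst p)) (dist c (snd p))"] by auto
        have "D (d k) p = D (g n) p" if "k \<ge> K" for k
        proof -
          have "real K \<le> real k" using that by simp
          then have "dist c (fst p) \<le> real k" "dist c (snd p) \<le> real k" using K by linarith+
          then show ?thesis by (simp add: D_def d_def g1)
        qed
        then have "(\<lambda>k. D (d k) p) \<longlonglongrightarrow> D (g n) p"
          by (intro tendsto_eventually) (auto simp: eventually_sequentially)
        then show "D (g n) p \<le> liminf (\<lambda>k. D (d k) p)"
          using lim_imp_Liminf[OF sequentially_bot] by fastforce
      qed
      also have "\<dots> \<le> liminf (\<lambda>k. \<integral>\<^sup>+p. D (d k) p \<partial>J)"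
        by (rule nn_integral_liminf) (use dC D_meas in blast)
      also have "\<dots> \<le> ennreal (e - Ec (g n) (g n))"
      proof (rule Liminf_le)
        show "\<forall>\<^sub>F k in sequentially. (\<integral>\<^sup>+p. D (d k) p \<partial>J) \<le> ennreal (e - Ec (g n) (g n))"
        proof -
          obtain K where K: "R < real K" using reals_Archimedean2 by blast
          have "(\<integral>\<^sup>+p. D (d k) p \<partial>J) \<le> ennreal (e - Ec (g n) (g n))" if k: "k \<ge> max N K" for k
          proof -
            let ?I = "\<integral>(x, y). (d k x - d k y) * (d k x - d k y) \<partial>J"
            have "(\<integral>\<^sup>+p. D (d k) p \<partial>J) = ennreal ?I"
              using nn_integral_eq_integral[OF E_decomposition(1)[OF dC[of k]]]
              by (simp add: D_def case_prod_unfold power2_eq_square)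
            also have "?I = E (d k) (d k) - Ec (d k) (d k)" using E_decomposition(2)[OF dC[of k]] by simp
            also have "\<dots> \<le> e - Ec (g n) (g n)"
              using N[of n k] n k Ec_le[of k] K by (simp add: d_def)
            finally show ?thesis by (simp add: ennreal_leI)
          qed
          then show ?thesis unfolding eventually_sequentially by blast
        qed
      qed simp
      finally have le: "ennreal (E (g n) (g n)) \<le> ennreal (Ec (g n) (g n)) + ennreal (e - Ec (g n) (g n))"
        by (simp add: add_left_mono)
      have "Ec (g n) (g n) \<le> e"
      proof -
        obtain K where K: "R < real K" using reals_Archimedean2 by blast
        define k where "k = max N K"
        have "0 \<le> (\<integral>(x, y). (d k x - d k y) * (d k x - d k y) \<partial>J)"
          by (intro integral_nonneg_AE) (simp add: case_prod_unfold)
        then have "Ec (d k) (d k) \<le> E (d k) (d k)" using E_decomposition(2)[OF dC[of k]] by simp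
        also have "\<dots> < e" unfolding d_def by (rule N) (use n in \<open>auto simp: k_def\<close>)
        finally have "Ec (d k) (d k) < e" .
        moreover have "real k > R" using K by (simp add: k_def)
        ultimately show ?thesis using Ec_le[of k] by linarith
      qed
      then have "ennreal (E (g n) (g n)) \<le> ennreal e"
        using le form_nonneg[OF Ec_form gF] by (simp flip: ennreal_plus)
      then show ?thesis using e by (simp add: ennreal_le_iff)
    qed
    then show ?thesis by blast
  qed
  have "(\<lambda>n. E (g n) (g n)) \<longlonglongrightarrow> 0"
  proof (rule LIMSEQ_I)
    fix r :: real assume "r > 0"
    then obtain N where "\<forall>n\<ge>N. E (g n) (g n) \<le> r / 2" using small[of "r / 2"] by auto
    then show "\<exists>N. \<forall>n\<ge>N. norm (E (g n) (g n) - 0) < r"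
      using \<open>r > 0\<close> form_nonneg[OF E_form gF] by (intro exI[of _ N]) force
  qed
  with gF g01 lim show ?thesis by (rule that)
qed

lemma omega_mono:
  assumes "0 \<le> b" "b \<le> r"
  shows "omega j b \<le> omega j r"
  unfolding omega_def
proof (rule SUP_mono', rule nn_integral_mono, rule mult_right_mono)
  show "ennreal ((min (dist x y) b)\<^sup>2) \<le> ennreal ((min (dist x y) r)\<^sup>2)" for x y :: 'a
    using assms by (intro ennreal_leI power_mono) auto
qed simp

lemma volume_mono: "S \<in> sets borel \<Longrightarrow> s \<le> r \<Longrightarrow> volume m S c s \<le> volume m S c r"
  unfolding volume_def by (intro emeasure_mono) auto

text \<open>With \<open>a = r / 2\<close> and \<open>b\<close> between \<open>r / 4\<close> and \<open>r / 2\<close>, the cutoff lives in the ball of radius \<open>r\<close> and has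
  slope at most \<open>4 / r\<close>. The freedom in \<open>b\<close> serves to avoid spheres of positive measure.\<close>

lemma bounded_energy_cutoffs:
  assumes M: "M \<ge> 0" "\<forall>K. compact K \<and> K \<noteq> {} \<longrightarrow>
      (AE x in m. x \<in> Xc \<longrightarrow> Gl (\<lambda>z. infdist z K) (\<lambda>z. infdist z K) x \<le> M)"
    and growth: "Liminf at_top (\<lambda>r::real. ennreal (1 / r\<^sup>2) *
      (volume m Xc c r + volume m (jump_set j) c r * omega j r)) < \<infinity>"
  obtains u C where "\<And>n. u n \<in> C0 \<inter> F" "\<And>n. E (u n) (u n) \<le> C"
    "\<And>n x. 0 \<le> u n x \<and> u n x \<le> 1" "\<And>n x. dist c x \<le> real n \<Longrightarrow> u n x = 1"
proof -
  define V where "V r = volume m Xc c r + volume m (jump_set j) c r * omega j r" for r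
  obtain C where C: "Liminf at_top (\<lambda>r::real. ennreal (1 / r\<^sup>2) * V r) < ennreal C" "C \<ge> 0"
  proof -
    obtain y where "Liminf at_top (\<lambda>r::real. ennreal (1 / r\<^sup>2) * V r) < y" "y < \<infinity>"
      using dense[OF growth] by (auto simp: V_def)
    then show ?thesis using that[of "enn2real y"] by (simp add: less_top)
  qed
  have freq: "\<exists>r\<ge>R. ennreal (1 / r\<^sup>2) * V r < ennreal C" for R :: real
  proof (rule ccontr)
    assume "\<not> ?thesis"
    then have "\<forall>\<^sub>F r in at_top. ennreal C \<le> ennreal (1 / r\<^sup>2) * V r"
      unfolding eventually_at_top_linorder by (auto simp: not_less)
    then have "ennreal C \<le> Liminf at_top (\<lambda>r::real. ennreal (1 / r\<^sup>2) * V r)" by (rule Liminf_bounded)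
    with C(1) show False by simp
  qed
  define C' where "C' = 16 * (M + 2) * C"
  have "\<exists>v. v \<in> C0 \<inter> F \<and> E v v \<le> C' \<and> (\<forall>x. 0 \<le> v x \<and> v x \<le> 1) \<and> (\<forall>x. dist c x \<le> real n \<longrightarrow> v x = 1)" for n :: nat
  proof -
    obtain r where r: "r \<ge> 2 * real n + 1" "ennreal (1 / r\<^sup>2) * V r < ennreal C" using freq by blast
    define a where "a = r / 2"
    have r0: "r > 0" and a0: "a \<ge> 0" using r(1) by (auto simp: a_def)
    obtain b where b: "r / 4 < b" "b < r / 2" "{x. infdist x (cball c a) = b} \<in> null_sets m"
      using sphere_null[of "r / 4" "r / 2" a c] r0 a0 by auto
    have b0: "b > 0" using b r0 by simp
    have ne: "cball c a \<noteq> {}" using a0 by auto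
    define v where "v = cutoff (cball c a) b"
    have bsq: "1 / b\<^sup>2 \<le> 16 * (1 / r\<^sup>2)"
    proof -
      have "(r / 4)\<^sup>2 \<le> b\<^sup>2" using b r0 by (intro power_mono) auto
      then have "1 / b\<^sup>2 \<le> 1 / (r / 4)\<^sup>2" using r0 b0 by (intro divide_left_mono) auto
      then show ?thesis by (simp add: power_divide)
    qed
    have Xcb: "Xc \<in> sets borel" using diffusion by (simp add: diffusion_set_def)
    have ab: "a + b \<le> r" using b by (simp add: a_def)
    let ?k = "ennreal (16 * (M + 2)) * ennreal (1 / r\<^sup>2)"
    have k: "ennreal (M / b\<^sup>2) \<le> ?k" "ennreal (2 / b\<^sup>2) \<le> ?k"
    proof -
      have "t / b\<^sup>2 \<le> 16 * (M + 2) * (1 / r\<^sup>2)" if t: "0 \<le> t" "t \<le> M + 2" for t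
      proof -
        have "t * (1 / b\<^sup>2) \<le> (M + 2) * (16 * (1 / r\<^sup>2))" using t bsq M by (intro mult_mono) auto
        then show ?thesis by (simp add: mult_ac)
      qed
      moreover have "?k = ennreal (16 * (M + 2) * (1 / r\<^sup>2))"
        using M(1) by (intro ennreal_mult'[symmetric]) auto
      ultimately show "ennreal (M / b\<^sup>2) \<le> ?k" "ennreal (2 / b\<^sup>2) \<le> ?k"
        using M(1) by (simp_all only:) (intro ennreal_leI; simp)+
    qed
    have "ennreal (E v v) \<le> ennreal (M / b\<^sup>2) * volume m Xc c (a + b)
        + ennreal (2 / b\<^sup>2) * (volume m (jump_set j) c (a + b) * omega j b)"
      unfolding v_def by (rule cutoff_energy[OF a0 b0 M(1) _ b(3)]) (use M(2) compact_cball ne in blast)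
    also have "\<dots> \<le> ?k * volume m Xc c r + ?k * (volume m (jump_set j) c r * omega j r)"
      using ab b b0 by (intro add_mono mult_mono k volume_mono Xcb jump_set_borel omega_mono) auto
    also have "\<dots> = ennreal (16 * (M + 2)) * (ennreal (1 / r\<^sup>2) * V r)"
      by (simp only: V_def distrib_left mult.assoc)
    also have "\<dots> \<le> ennreal (16 * (M + 2)) * ennreal C" using r(2) by (intro mult_left_mono) auto
    also have "\<dots> = ennreal C'" using M(1) C(2) by (simp add: C'_def ennreal_mult'')
    finally have "E v v \<le> C'" using M(1) C(2) by (simp add: ennreal_le_iff C'_def)
    moreover have "v \<in> C0 \<inter> F" unfolding v_def by (rule cutoff_F[OF compact_cball ne b0])
    moreover have "\<forall>x. 0 \<le> v x \<and> v x \<le> 1" using cutoff_bounds[OF b0, of "cball c a"] by (simp add: v_def)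
    moreover have "v x = 1" if "dist c x \<le> real n" for x
      unfolding v_def by (rule cutoff_eq_1) (use that r(1) in \<open>simp add: a_def\<close>)
    ultimately show ?thesis by blast
  qed
  then obtain u where "\<And>n. u n \<in> C0 \<inter> F \<and> E (u n) (u n) \<le> C' \<and> (\<forall>x. 0 \<le> u n x \<and> u n x \<le> 1)
      \<and> (\<forall>x. dist c x \<le> real n \<longrightarrow> u n x = 1)" by metis
  then show ?thesis by (intro that[of u C']) auto
qed

end

theorem theorem1p2:
  fixes m :: "'a::metric_space measure"
    and F :: "('a \<Rightarrow> real) set"
    and E Ee Ec :: "('a \<Rightarrow> real) \<Rightarrow> ('a \<Rightarrow> real) \<Rightarrow> real"
    and J :: "('a \<times> 'a) measure"
    and k :: "'a measure"
    and mu :: "('a \<Rightarrow> real) \<Rightarrow> 'a measure"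
    and Gc Gl :: "('a \<Rightarrow> real) \<Rightarrow> ('a \<Rightarrow> real) \<Rightarrow> 'a \<Rightarrow> real"
    and j :: "'a \<Rightarrow> 'a measure"
    and Xc :: "'a set"
    and T :: "real \<Rightarrow> ('a \<Rightarrow> real) \<Rightarrow> 'a \<Rightarrow> real"
    and x0 :: 'a
  assumes space: "metric_measure_space m"
    and form: "regular_dirichlet_form m F E"
    and extended: "extended_form m F E Ee"
    and decomposition: "beurling_deny m F E Ee Ec J k"
    and energy: "energy_measure m F E Ec mu"
    and A1: "k = null_measure borel"
    and A2: "\<forall>u\<in>extended_space m F E. \<forall>v\<in>extended_space m F E.
               abs_cont_with_density m (polarized mu u v) (Gc u v)"
    and A3: "jump_kernel m J j"
    and local_ext: "local_extension m F Gc Gl"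
    and Xc: "diffusion_set m F Gc Xc"
    and M1: "\<forall>K. compact K \<and> K \<noteq> {} \<longrightarrow> (\<lambda>x. infdist x K) \<in> F_loc m F"
    and M2: "\<exists>Mc::real. \<forall>K. compact K \<and> K \<noteq> {} \<longrightarrow>
               (AE x in m. x \<in> Xc \<longrightarrow> Gl (\<lambda>z. infdist z K) (\<lambda>z. infdist z K) x \<le> Mc)"
    and M3: "\<exists>Mj::real. AE x in m. x \<in> jump_set j \<longrightarrow>
               (\<integral>\<^sup>+y\<in>- {x}. ennreal (min 1 ((dist x y)\<^sup>2)) \<partial>(j x)) \<le> ennreal Mj"
    and semigroup: "associated_semigroup m F E T"
    and growth: "Liminf at_top (\<lambda>r::real. ennreal (1 / r\<^sup>2) *
                   (volume m Xc x0 r + volume m (jump_set j) x0 r * omega j r)) < \<infinity>"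
  shows "recurrent m T"
proof -
  interpret jump_diffusion m F E Ee Ec J mu Gc Gl j Xc
    using space form extended decomposition energy A2 A3 local_ext Xc M1
    unfolding A1 by unfold_locales
  interpret dirichlet_semigroup m F E T
    using semigroup by unfold_locales
  obtain Mc :: real where Mc: "\<forall>K. compact K \<and> K \<noteq> {} \<longrightarrow>
      (AE x in m. x \<in> Xc \<longrightarrow> Gl (\<lambda>z. infdist z K) (\<lambda>z. infdist z K) x \<le> Mc)"
    using M2 by blast
  have Mc': "\<forall>K. compact K \<and> K \<noteq> {} \<longrightarrow>
      (AE x in m. x \<in> Xc \<longrightarrow> Gl (\<lambda>z. infdist z K) (\<lambda>z. infdist z K) x \<le> max 0 Mc)"
  proof (intro allI impI)
    fix K :: "'a set" assume "compact K \<and> K \<noteq> {}"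
    with Mc have "AE x in m. x \<in> Xc \<longrightarrow> Gl (\<lambda>z. infdist z K) (\<lambda>z. infdist z K) x \<le> Mc" by blast
    then show "AE x in m. x \<in> Xc \<longrightarrow> Gl (\<lambda>z. infdist z K) (\<lambda>z. infdist z K) x \<le> max 0 Mc"
      by eventually_elim auto
  qed
  obtain u C where u: "\<And>n. u n \<in> C0 \<inter> F" "\<And>n. E (u n) (u n) \<le> C"
    "\<And>n x. 0 \<le> u n x \<and> u n x \<le> 1" "\<And>n x. dist x0 x \<le> real n \<Longrightarrow> u n x = 1"
    by (rule bounded_energy_cutoffs[OF _ Mc' growth]) auto
  show ?thesis
  proof (rule energy_vanishing_plateaus[OF u])
    fix g assume "\<And>n. g n \<in> F" "\<And>n x. 0 \<le> g n x \<and> g n x \<le> 1"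
      "\<And>x. (\<lambda>n. g n x) \<longlonglongrightarrow> 1" "(\<lambda>n. E (g n) (g n)) \<longlonglongrightarrow> 0"
    then show ?thesis by (rule recurrent_if_energy_vanishes[OF sigma_finite_m])
  qed
qed

end
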